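(* Let $G$ and $H$ be locally compact Hausdorff groupoids, let $Z$ be a $G$–$H$ equivalence, and let $L=G\sqcup Z\sqcup Z^{\mathrm{op}}\sqcup H$ be the linking groupoid. Let $p_G:\mathscr B\to G$ and $p_H:\mathscr C\to H$ be upper semicontinuous Fell bundles with associated $C^*$-algebras $A=\Gamma_0(G^{(0)};p_G^{-1}(G^{(0)}))$ and $D=\Gamma_0(H^{(0)};p_H^{-1}(H^{(0)}))$, and let $q:\mathscr E\to Z$ be a $\mathscr B$–$\mathscr C$ equivalence. Then the bundle $L(q):L(\mathscr E)=\mathscr B\sqcup\mathscr E\sqcup\mathscr E^{\mathrm{op}}\sqcup\mathscr C\to L$, with the multiplication and involution described in the context, is a Fell bundle over $L$. Moreover, the $C^*$-algebra $\Gamma_0(L^{(0)};L(q)^{-1}(L^{(0)}))$ is isomorphic to $A\oplus D$.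
   Context: **Groupoid equivalence.** A $G$–$H$ equivalence is a locally compact Hausdorff space $Z$ which is a free and proper left $G$-space and a free and proper right $H$-space, with continuous open fibre maps $r:Z\to G^{(0)}$, $s:Z\to H^{(0)}$, such that the actions commute, $r$ induces a homeomorphism $Z/H\cong G^{(0)}$ and $s$ induces a homeomorphism $G\backslash Z\cong H^{(0)}$. For $r(y)=r(z)$, $[y,z]_H\in H$ is the unique element with $y\cdot[y,z]_H=z$; for $s(y)=s(z)$, ${}_G[y,z]\in G$ is the unique element with ${}_G[y,z]\cdot z=y$. **Upper semicontinuous Banach bundle** over a locally compact Hausdorff space $Z$: a topological space $\mathscr B$ with a continuous open surjection $q:\mathscr B\to Z$ such that each $q^{-1}(z)$ is a Banach space, $b\mapsto\|b\|$ is upper semicontinuous, addition is continuous on $\{(a,b):q(a)=q(b)\}$, scalar multiplication is continuous, and $\|b_i\|\to0$, $q(b_i)\to z$ imply $b_i\to 0_z$. $\Gamma_0$ denotes the continuous sections vanishing in norm at infinity. **Fell bundle** over a locally compact Hausdorff groupoid $G$: an upper semicontinuous Banach bundle $q:\mathscr B\to G$ with a continuous bilinear associative multiplication $(a,b)\mapsto ab$ defined when $s(q(a))=r(q(b))$, and a continuous conjugate-linear involution $a\mapsto a^*$, such that $q(ab)=q(a)q(b)$, $q(a^* )=q(a)^{-1}$, $(ab)^*=b^*a^*$; each $A_u:=q^{-1}(u)$, $u\in G^{(0)}$, is a $C^*$-algebra under these operations; and each $B_g:=q^{-1}(g)$ is an $A_{r(g)}$–$A_{s(g)}$ imprimitivity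 bimodule under multiplication in $\mathscr B$, with left inner product $ab^*$ and right inner product $a^*b$. Write $r(a)=r(q(a))$, $s(a)=s(q(a))$, and similarly for bundles over $Z$. The fibres of $\mathscr C$ over $v\in H^{(0)}$ are denoted $D_v$. **Equivalence of Fell bundles.** A $\mathscr B$–$\mathscr C$ equivalence is an upper semicontinuous Banach bundle $q:\mathscr E\to Z$ over a $G$–$H$ equivalence $Z$ such that: (a) there are commuting continuous left and right actions of $\mathscr B$ and $\mathscr C$ on $\mathscr E$: $b\cdot e$ is defined when $s(b)=r(e)$, with $q(b\cdot e)=p_G(b)\cdot q(e)$, $a\cdot(b\cdot e)=(ab)\cdot e$, $\|b\cdot e\|\le\|b\|\|e\|$; similarly $e\cdot c$ when $s(e)=r(c)$; (b) there are continuous sesquilinear maps ${}_{\mathscr B}\langle\cdot,\cdot\rangle:\{(e,f):s(e)=s(f)\}\to\mathscr B$ and $\langle\cdot,\cdot\rangle_{\mathscr C}:\{(e,f):r(e)=r(f)\}\to\mathscr C$ with $p_G({}_{\mathscr B}\langle e,f\rangle)={}_G[q(e),q(f)]$, $p_H(\langle e,f\rangle_{\mathscr C})=[q(e),q(f)]_H$, ${}_{\mathscr B}\langle e,f\rangle^*={}_{\mathscr B}\langle f,e\rangle$, $\langle e,f\rangle_{\mathscr C}^*=\langle f,e\rangle_{\mathscr C}$, $b\,{}_{\mathscr B}\langle e,f\rangle={}_{\mathscr B}\langle b\cdot e,f\rangle$, $\langle e,f\rangle_{\mathscr C}\,c=\langle e,f\cdot c\rangle_{\mathscr C}$, and ${}_{\mathscr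 B}\langle e,f\rangle\cdot g=e\cdot\langle f,g\rangle_{\mathscr C}$ whenever these make sense; (c) under these operations each fibre $E_z=q^{-1}(z)$ is an $A_{r(z)}$–$D_{s(z)}$ imprimitivity bimodule. **Linking groupoid.** $Z^{\mathrm{op}}=\{\bar z:z\in Z\}$ is a copy of $Z$ with $r(\bar z)=s(z)$, $s(\bar z)=r(z)$, $h\cdot\bar z=\overline{z\cdot h^{-1}}$, $\bar z\cdot g=\overline{g^{-1}\cdot z}$. $L=G\sqcup Z\sqcup Z^{\mathrm{op}}\sqcup H$ (topological disjoint union) is a groupoid with unit space $L^{(0)}=G^{(0)}\sqcup H^{(0)}$, containing $G$ and $H$ as subgroupoids, with $z^{-1}=\bar z$, products between $Z,Z^{\mathrm{op}}$ and $G,H$ given by the actions, $y\bar z={}_G[y,z]$ and $\bar y z=[y,z]_H$. **Linking bundle.** $\mathscr E^{\mathrm{op}}=\{\bar e:e\in\mathscr E\}$ is a copy of the topological space $\mathscr E$ with the conjugate Banach space structure $\alpha\bar e+\bar f=\overline{\bar\alpha e+f}$ on each fibre, and bundle map $q^{\mathrm{op}}:\mathscr E^{\mathrm{op}}\to Z^{\mathrm{op}}$, $q^{\mathrm{op}}(\bar e)=\overline{q(e)}$. $L(\mathscr E)$ is the topological disjoint union $\mathscr B\sqcup\mathscr E\sqcup\mathscr E^{\mathrm{op}}\sqcup\mathscr C$, and $L(q)$ restricts to $p_G,q,q^{\mathrm{op}},p_H$ on the respective pieces. The multiplication, defined on pairs $(\mathfrak a,\mathfrak b)$ with $s(L(q)(\mathfrak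 a))=r(L(q)(\mathfrak b))$, coincides with the given multiplications on $\mathscr B$ and $\mathscr C$ and with the actions of $\mathscr B$ and $\mathscr C$ on $\mathscr E$, and satisfies $\bar e\cdot b=\overline{b^*\cdot e}$, $c\cdot\bar e=\overline{e\cdot c^*}$, $e\bar f={}_{\mathscr B}\langle e,f\rangle$ (when $s(e)=s(f)$), $\bar ef=\langle e,f\rangle_{\mathscr C}$ (when $r(e)=r(f)$). The involution extends those of $\mathscr B$ and $\mathscr C$ by $e^*=\bar e$ and $\bar e^*=e$. *)

theory Defs
  imports "HOL-Analysis.Analysis"
begin

section \<open>Carrier-based Banach spaces, C*-algebras and imprimitivity bimodules\<close>

text \<open>Fibres of a bundle are subsets of the total space, so linear structure is carried by records
  with an explicit carrier.\<close>

record 'a cspace =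
  carr :: "'a set"
  vadd :: "'a \<Rightarrow> 'a \<Rightarrow> 'a"
  vscale :: "complex \<Rightarrow> 'a \<Rightarrow> 'a"
  vzero :: 'a
  vnorm :: "'a \<Rightarrow> real"

record 'a cstar = "'a cspace" +
  amul :: "'a \<Rightarrow> 'a \<Rightarrow> 'a"
  astar :: "'a \<Rightarrow> 'a"

text \<open>\<^const>\<open>Metric_space\<close> requires a distance that is symmetric and nonnegative on the whole type,
  hence the default value off the carrier.\<close>

definition norm_dist :: "('a, 'm) cspace_scheme \<Rightarrow> 'a \<Rightarrow> 'a \<Rightarrow> real" where
  "norm_dist V x y =
    (if x \<in> carr V \<and> y \<in> carr V then vnorm V (vadd V x (vscale V (-1) y)) else 0)"

definition norm_topology :: "('a, 'm) cspace_scheme \<Rightarrow> 'a topology" where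
  "norm_topology V = Metric_space.mtopology (carr V) (norm_dist V)"

locale banach_space =
  fixes V :: "('a, 'm) cspace_scheme"
  assumes zero_closed: "vzero V \<in> carr V"
    and add_closed: "\<lbrakk>x \<in> carr V; y \<in> carr V\<rbrakk> \<Longrightarrow> vadd V x y \<in> carr V"
    and scale_closed: "x \<in> carr V \<Longrightarrow> vscale V \<alpha> x \<in> carr V"
    and add_assoc: "\<lbrakk>x \<in> carr V; y \<in> carr V; z \<in> carr V\<rbrakk>
          \<Longrightarrow> vadd V (vadd V x y) z = vadd V x (vadd V y z)"
    and add_commute: "\<lbrakk>x \<in> carr V; y \<in> carr V\<rbrakk> \<Longrightarrow> vadd V x y = vadd V y x"
    and add_zero: "x \<in> carr V \<Longrightarrow> vadd V x (vzero V) = x"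
    and add_inverse: "x \<in> carr V \<Longrightarrow> vadd V x (vscale V (-1) x) = vzero V"
    and scale_one: "x \<in> carr V \<Longrightarrow> vscale V 1 x = x"
    and scale_scale: "x \<in> carr V \<Longrightarrow> vscale V \<alpha> (vscale V \<beta> x) = vscale V (\<alpha> * \<beta>) x"
    and scale_add: "\<lbrakk>x \<in> carr V; y \<in> carr V\<rbrakk>
          \<Longrightarrow> vscale V \<alpha> (vadd V x y) = vadd V (vscale V \<alpha> x) (vscale V \<alpha> y)"
    and add_scale: "x \<in> carr V
          \<Longrightarrow> vscale V (\<alpha> + \<beta>) x = vadd V (vscale V \<alpha> x) (vscale V \<beta> x)"
    and norm_nonneg: "x \<in> carr V \<Longrightarrow> 0 \<le> vnorm V x"
    and norm_eq_zero: "x \<in> carr V \<Longrightarrow> vnorm V x = 0 \<longleftrightarrow> x = vzero V"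
    and norm_scale: "x \<in> carr V \<Longrightarrow> vnorm V (vscale V \<alpha> x) = cmod \<alpha> * vnorm V x"
    and norm_triangle: "\<lbrakk>x \<in> carr V; y \<in> carr V\<rbrakk>
          \<Longrightarrow> vnorm V (vadd V x y) \<le> vnorm V x + vnorm V y"
    and complete: "Metric_space.mcomplete (carr V) (norm_dist V)"

locale cstar_algebra = banach_space A
  for A :: "('a, 'm) cstar_scheme" +
  assumes mult_closed: "\<lbrakk>x \<in> carr A; y \<in> carr A\<rbrakk> \<Longrightarrow> amul A x y \<in> carr A"
    and star_closed: "x \<in> carr A \<Longrightarrow> astar A x \<in> carr A"
    and mult_assoc: "\<lbrakk>x \<in> carr A; y \<in> carr A; z \<in> carr A\<rbrakk>
          \<Longrightarrow> amul A (amul A x y) z = amul A x (amul A y z)"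
    and mult_add_left: "\<lbrakk>x \<in> carr A; y \<in> carr A; z \<in> carr A\<rbrakk>
          \<Longrightarrow> amul A (vadd A x y) z = vadd A (amul A x z) (amul A y z)"
    and mult_add_right: "\<lbrakk>x \<in> carr A; y \<in> carr A; z \<in> carr A\<rbrakk>
          \<Longrightarrow> amul A x (vadd A y z) = vadd A (amul A x y) (amul A x z)"
    and mult_scale_left: "\<lbrakk>x \<in> carr A; y \<in> carr A\<rbrakk>
          \<Longrightarrow> amul A (vscale A \<alpha> x) y = vscale A \<alpha> (amul A x y)"
    and mult_scale_right: "\<lbrakk>x \<in> carr A; y \<in> carr A\<rbrakk>
          \<Longrightarrow> amul A x (vscale A \<alpha> y) = vscale A \<alpha> (amul A x y)"
    and star_star: "x \<in> carr A \<Longrightarrow> astar A (astar A x) = x"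
    and star_add: "\<lbrakk>x \<in> carr A; y \<in> carr A\<rbrakk>
          \<Longrightarrow> astar A (vadd A x y) = vadd A (astar A x) (astar A y)"
    and star_scale: "x \<in> carr A \<Longrightarrow> astar A (vscale A \<alpha> x) = vscale A (cnj \<alpha>) (astar A x)"
    and star_mult: "\<lbrakk>x \<in> carr A; y \<in> carr A\<rbrakk>
          \<Longrightarrow> astar A (amul A x y) = amul A (astar A y) (astar A x)"
    and norm_mult: "\<lbrakk>x \<in> carr A; y \<in> carr A\<rbrakk>
          \<Longrightarrow> vnorm A (amul A x y) \<le> vnorm A x * vnorm A y"
    and cstar_identity: "x \<in> carr A \<Longrightarrow> vnorm A (amul A (astar A x) x) = (vnorm A x)\<^sup>2"

definition positive_elem :: "('a, 'm) cstar_scheme \<Rightarrow> 'a \<Rightarrow> bool" where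
  "positive_elem A a \<longleftrightarrow> (\<exists>x\<in>carr A. a = amul A (astar A x) x)"

definition lin_subspace :: "('a, 'm) cspace_scheme \<Rightarrow> 'a set \<Rightarrow> bool" where
  "lin_subspace V W \<longleftrightarrow> W \<subseteq> carr V \<and> vzero V \<in> W \<and>
    (\<forall>x\<in>W. \<forall>y\<in>W. vadd V x y \<in> W) \<and> (\<forall>\<alpha>. \<forall>x\<in>W. vscale V \<alpha> x \<in> W)"

definition total_set :: "('a, 'm) cspace_scheme \<Rightarrow> 'a set \<Rightarrow> bool" where
  "total_set V S \<longleftrightarrow> norm_topology V closure_of (lin_subspace V hull S) = carr V"

text \<open>The given Banach norm of a Hilbert module is required to be the one defined by the inner
  product.\<close>

locale full_left_hilbert_module = A: cstar_algebra A + X: banach_space X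
  for A :: "('a, 'm) cstar_scheme" and X :: "('x, 'n) cspace_scheme"
    and act :: "'a \<Rightarrow> 'x \<Rightarrow> 'x" and ip :: "'x \<Rightarrow> 'x \<Rightarrow> 'a" +
  assumes act_closed: "\<lbrakk>a \<in> carr A; x \<in> carr X\<rbrakk> \<Longrightarrow> act a x \<in> carr X"
    and act_act: "\<lbrakk>a \<in> carr A; b \<in> carr A; x \<in> carr X\<rbrakk> \<Longrightarrow> act a (act b x) = act (amul A a b) x"
    and act_add_left: "\<lbrakk>a \<in> carr A; b \<in> carr A; x \<in> carr X\<rbrakk>
          \<Longrightarrow> act (vadd A a b) x = vadd X (act a x) (act b x)"
    and act_add_right: "\<lbrakk>a \<in> carr A; x \<in> carr X; y \<in> carr X\<rbrakk>
          \<Longrightarrow> act a (vadd X x y) = vadd X (act a x) (act a y)"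
    and act_scale_left: "\<lbrakk>a \<in> carr A; x \<in> carr X\<rbrakk>
          \<Longrightarrow> act (vscale A \<alpha> a) x = vscale X \<alpha> (act a x)"
    and act_scale_right: "\<lbrakk>a \<in> carr A; x \<in> carr X\<rbrakk>
          \<Longrightarrow> act a (vscale X \<alpha> x) = vscale X \<alpha> (act a x)"
    and ip_closed: "\<lbrakk>x \<in> carr X; y \<in> carr X\<rbrakk> \<Longrightarrow> ip x y \<in> carr A"
    and ip_add: "\<lbrakk>x \<in> carr X; y \<in> carr X; z \<in> carr X\<rbrakk>
          \<Longrightarrow> ip (vadd X x y) z = vadd A (ip x z) (ip y z)"
    and ip_scale: "\<lbrakk>x \<in> carr X; y \<in> carr X\<rbrakk> \<Longrightarrow> ip (vscale X \<alpha> x) y = vscale A \<alpha> (ip x y)"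
    and ip_act: "\<lbrakk>a \<in> carr A; x \<in> carr X; y \<in> carr X\<rbrakk> \<Longrightarrow> ip (act a x) y = amul A a (ip x y)"
    and ip_star: "\<lbrakk>x \<in> carr X; y \<in> carr X\<rbrakk> \<Longrightarrow> astar A (ip x y) = ip y x"
    and ip_positive: "x \<in> carr X \<Longrightarrow> positive_elem A (ip x x)"
    and norm_ip: "x \<in> carr X \<Longrightarrow> vnorm A (ip x x) = (vnorm X x)\<^sup>2"
    and full: "total_set A {ip x y | x y. x \<in> carr X \<and> y \<in> carr X}"

locale full_right_hilbert_module = D: cstar_algebra D + X: banach_space X
  for D :: "('d, 'm) cstar_scheme" and X :: "('x, 'n) cspace_scheme"
    and act :: "'x \<Rightarrow> 'd \<Rightarrow> 'x" and ip :: "'x \<Rightarrow> 'x \<Rightarrow> 'd" +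
  assumes act_closed: "\<lbrakk>x \<in> carr X; d \<in> carr D\<rbrakk> \<Longrightarrow> act x d \<in> carr X"
    and act_act: "\<lbrakk>x \<in> carr X; d \<in> carr D; d' \<in> carr D\<rbrakk>
          \<Longrightarrow> act (act x d) d' = act x (amul D d d')"
    and act_add_left: "\<lbrakk>x \<in> carr X; y \<in> carr X; d \<in> carr D\<rbrakk>
          \<Longrightarrow> act (vadd X x y) d = vadd X (act x d) (act y d)"
    and act_add_right: "\<lbrakk>x \<in> carr X; d \<in> carr D; d' \<in> carr D\<rbrakk>
          \<Longrightarrow> act x (vadd D d d') = vadd X (act x d) (act x d')"
    and act_scale_left: "\<lbrakk>x \<in> carr X; d \<in> carr D\<rbrakk>
          \<Longrightarrow> act (vscale X \<alpha> x) d = vscale X \<alpha> (act x d)"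
    and act_scale_right: "\<lbrakk>x \<in> carr X; d \<in> carr D\<rbrakk>
          \<Longrightarrow> act x (vscale D \<alpha> d) = vscale X \<alpha> (act x d)"
    and ip_closed: "\<lbrakk>x \<in> carr X; y \<in> carr X\<rbrakk> \<Longrightarrow> ip x y \<in> carr D"
    and ip_add: "\<lbrakk>x \<in> carr X; y \<in> carr X; z \<in> carr X\<rbrakk>
          \<Longrightarrow> ip x (vadd X y z) = vadd D (ip x y) (ip x z)"
    and ip_scale: "\<lbrakk>x \<in> carr X; y \<in> carr X\<rbrakk> \<Longrightarrow> ip x (vscale X \<alpha> y) = vscale D \<alpha> (ip x y)"
    and ip_act: "\<lbrakk>x \<in> carr X; y \<in> carr X; d \<in> carr D\<rbrakk> \<Longrightarrow> ip x (act y d) = amul D (ip x y) d"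
    and ip_star: "\<lbrakk>x \<in> carr X; y \<in> carr X\<rbrakk> \<Longrightarrow> astar D (ip x y) = ip y x"
    and ip_positive: "x \<in> carr X \<Longrightarrow> positive_elem D (ip x x)"
    and norm_ip: "x \<in> carr X \<Longrightarrow> vnorm D (ip x x) = (vnorm X x)\<^sup>2"
    and full: "total_set D {ip x y | x y. x \<in> carr X \<and> y \<in> carr X}"

locale imprimitivity_bimodule =
  left: full_left_hilbert_module A X lact lip + right: full_right_hilbert_module D X ract rip
  for A :: "('a, 'm) cstar_scheme" and D :: "('d, 'k) cstar_scheme"
    and X :: "('x, 'n) cspace_scheme"
    and lact :: "'a \<Rightarrow> 'x \<Rightarrow> 'x" and ract :: "'x \<Rightarrow> 'd \<Rightarrow> 'x"
    and lip :: "'x \<Rightarrow> 'x \<Rightarrow> 'a" and rip :: "'x \<Rightarrow> 'x \<Rightarrow> 'd" +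
  assumes act_commute: "\<lbrakk>a \<in> carr A; x \<in> carr X; d \<in> carr D\<rbrakk>
          \<Longrightarrow> ract (lact a x) d = lact a (ract x d)"
    and rip_lact: "\<lbrakk>a \<in> carr A; x \<in> carr X; y \<in> carr X\<rbrakk>
          \<Longrightarrow> rip (lact a x) y = rip x (lact (astar A a) y)"
    and lip_ract: "\<lbrakk>d \<in> carr D; x \<in> carr X; y \<in> carr X\<rbrakk>
          \<Longrightarrow> lip (ract x d) y = lip x (ract y (astar D d))"
    and lip_rip: "\<lbrakk>x \<in> carr X; y \<in> carr X; z \<in> carr X\<rbrakk>
          \<Longrightarrow> lact (lip x y) z = ract x (rip y z)"

definition cstar_sum :: "('a, 'm) cstar_scheme \<Rightarrow> ('d, 'k) cstar_scheme \<Rightarrow> ('a \<times> 'd) cstar" where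
  "cstar_sum A D =
    \<lparr> carr = carr A \<times> carr D,
      vadd = (\<lambda>(a, d) (a', d'). (vadd A a a', vadd D d d')),
      vscale = (\<lambda>\<alpha> (a, d). (vscale A \<alpha> a, vscale D \<alpha> d)),
      vzero = (vzero A, vzero D),
      vnorm = (\<lambda>(a, d). max (vnorm A a) (vnorm D d)),
      amul = (\<lambda>(a, d) (a', d'). (amul A a a', amul D d d')),
      astar = (\<lambda>(a, d). (astar A a, astar D d)) \<rparr>"

definition cstar_isomorphic :: "('a, 'm) cstar_scheme \<Rightarrow> ('d, 'k) cstar_scheme \<Rightarrow> bool" where
  "cstar_isomorphic A D \<longleftrightarrow> cstar_algebra A \<and> cstar_algebra D \<and>
    (\<exists>\<phi>. bij_betw \<phi> (carr A) (carr D) \<and>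
      (\<forall>x\<in>carr A. \<forall>y\<in>carr A. \<phi> (vadd A x y) = vadd D (\<phi> x) (\<phi> y)) \<and>
      (\<forall>\<alpha>. \<forall>x\<in>carr A. \<phi> (vscale A \<alpha> x) = vscale D \<alpha> (\<phi> x)) \<and>
      (\<forall>x\<in>carr A. \<forall>y\<in>carr A. \<phi> (amul A x y) = amul D (\<phi> x) (\<phi> y)) \<and>
      (\<forall>x\<in>carr A. \<phi> (astar A x) = astar D (\<phi> x)))"


section \<open>Locally compact Hausdorff groupoids and their equivalences\<close>

text \<open>The underlying set of a groupoid, of an equivalence space and of the total space of a bundle
  is the \<^const>\<open>topspace\<close> of its topology.\<close>

record 'g groupoid =
  gtop :: "'g topology"
  gsrc :: "'g \<Rightarrow> 'g"
  grng :: "'g \<Rightarrow> 'g"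
  gmul :: "'g \<Rightarrow> 'g \<Rightarrow> 'g"
  ginv :: "'g \<Rightarrow> 'g"

definition units :: "'g groupoid \<Rightarrow> 'g set" where
  "units G = grng G ` topspace (gtop G)"

definition unit_space :: "'g groupoid \<Rightarrow> 'g topology" where
  "unit_space G = subtopology (gtop G) (units G)"

text \<open>Continuity of the range and source maps follows from that of multiplication and inversion.\<close>

locale lch_groupoid =
  fixes G :: "'g groupoid"
  assumes rng_closed: "g \<in> topspace (gtop G) \<Longrightarrow> grng G g \<in> topspace (gtop G)"
    and src_closed: "g \<in> topspace (gtop G) \<Longrightarrow> gsrc G g \<in> topspace (gtop G)"
    and rng_rng: "g \<in> topspace (gtop G) \<Longrightarrow> grng G (grng G g) = grng G g"
    and src_rng: "g \<in> topspace (gtop G) \<Longrightarrow> gsrc G (grng G g) = grng G g"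
    and rng_src: "g \<in> topspace (gtop G) \<Longrightarrow> grng G (gsrc G g) = gsrc G g"
    and src_src: "g \<in> topspace (gtop G) \<Longrightarrow> gsrc G (gsrc G g) = gsrc G g"
    and mul_closed: "\<lbrakk>g \<in> topspace (gtop G); k \<in> topspace (gtop G); gsrc G g = grng G k\<rbrakk>
          \<Longrightarrow> gmul G g k \<in> topspace (gtop G)"
    and rng_mul: "\<lbrakk>g \<in> topspace (gtop G); k \<in> topspace (gtop G); gsrc G g = grng G k\<rbrakk>
          \<Longrightarrow> grng G (gmul G g k) = grng G g"
    and src_mul: "\<lbrakk>g \<in> topspace (gtop G); k \<in> topspace (gtop G); gsrc G g = grng G k\<rbrakk>
          \<Longrightarrow> gsrc G (gmul G g k) = gsrc G k"
    and mul_assoc: "\<lbrakk>g \<in> topspace (gtop G); k \<in> topspace (gtop G); l \<in> topspace (gtop G);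
            gsrc G g = grng G k; gsrc G k = grng G l\<rbrakk>
          \<Longrightarrow> gmul G (gmul G g k) l = gmul G g (gmul G k l)"
    and mul_rng: "g \<in> topspace (gtop G) \<Longrightarrow> gmul G (grng G g) g = g"
    and mul_src: "g \<in> topspace (gtop G) \<Longrightarrow> gmul G g (gsrc G g) = g"
    and inv_closed: "g \<in> topspace (gtop G) \<Longrightarrow> ginv G g \<in> topspace (gtop G)"
    and rng_inv: "g \<in> topspace (gtop G) \<Longrightarrow> grng G (ginv G g) = gsrc G g"
    and src_inv: "g \<in> topspace (gtop G) \<Longrightarrow> gsrc G (ginv G g) = grng G g"
    and inv_mul: "g \<in> topspace (gtop G) \<Longrightarrow> gmul G (ginv G g) g = gsrc G g"
    and mul_inv: "g \<in> topspace (gtop G) \<Longrightarrow> gmul G g (ginv G g) = grng G g"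
    and continuous_mul: "continuous_map
          (subtopology (prod_topology (gtop G) (gtop G)) {(g, k). gsrc G g = grng G k})
          (gtop G) (\<lambda>(g, k). gmul G g k)"
    and continuous_inv: "continuous_map (gtop G) (gtop G) (ginv G)"
    and locally_compact: "locally_compact_space (gtop G)"
    and hausdorff: "Hausdorff_space (gtop G)"

locale free_proper_left_space =
  fixes G :: "'g groupoid" and X :: "'z topology" and r :: "'z \<Rightarrow> 'g" and act :: "'g \<Rightarrow> 'z \<Rightarrow> 'z"
  assumes moment_continuous: "continuous_map X (unit_space G) r"
    and act_closed: "\<lbrakk>g \<in> topspace (gtop G); z \<in> topspace X; gsrc G g = r z\<rbrakk>
          \<Longrightarrow> act g z \<in> topspace X"
    and moment_act: "\<lbrakk>g \<in> topspace (gtop G); z \<in> topspace X; gsrc G g = r z\<rbrakk>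
          \<Longrightarrow> r (act g z) = grng G g"
    and act_act: "\<lbrakk>g \<in> topspace (gtop G); k \<in> topspace (gtop G); z \<in> topspace X;
            gsrc G g = grng G k; gsrc G k = r z\<rbrakk>
          \<Longrightarrow> act g (act k z) = act (gmul G g k) z"
    and act_unit: "z \<in> topspace X \<Longrightarrow> act (r z) z = z"
    and act_continuous: "continuous_map
          (subtopology (prod_topology (gtop G) X) {(g, z). gsrc G g = r z})
          X (\<lambda>(g, z). act g z)"
    and free: "\<lbrakk>g \<in> topspace (gtop G); z \<in> topspace X; gsrc G g = r z; act g z = z\<rbrakk>
          \<Longrightarrow> g = r z"
    and proper: "proper_map
          (subtopology (prod_topology (gtop G) X) {(g, z). gsrc G g = r z})
          (prod_topology X X) (\<lambda>(g, z). (act g z, z))"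

locale free_proper_right_space =
  fixes H :: "'h groupoid" and X :: "'z topology" and s :: "'z \<Rightarrow> 'h" and act :: "'z \<Rightarrow> 'h \<Rightarrow> 'z"
  assumes moment_continuous: "continuous_map X (unit_space H) s"
    and act_closed: "\<lbrakk>z \<in> topspace X; h \<in> topspace (gtop H); s z = grng H h\<rbrakk>
          \<Longrightarrow> act z h \<in> topspace X"
    and moment_act: "\<lbrakk>z \<in> topspace X; h \<in> topspace (gtop H); s z = grng H h\<rbrakk>
          \<Longrightarrow> s (act z h) = gsrc H h"
    and act_act: "\<lbrakk>z \<in> topspace X; h \<in> topspace (gtop H); k \<in> topspace (gtop H);
            s z = grng H h; gsrc H h = grng H k\<rbrakk>
          \<Longrightarrow> act (act z h) k = act z (gmul H h k)"
    and act_unit: "z \<in> topspace X \<Longrightarrow> act z (s z) = z"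
    and act_continuous: "continuous_map
          (subtopology (prod_topology X (gtop H)) {(z, h). s z = grng H h})
          X (\<lambda>(z, h). act z h)"
    and free: "\<lbrakk>z \<in> topspace X; h \<in> topspace (gtop H); s z = grng H h; act z h = z\<rbrakk>
          \<Longrightarrow> h = s z"
    and proper: "proper_map
          (subtopology (prod_topology X (gtop H)) {(z, h). s z = grng H h})
          (prod_topology X X) (\<lambda>(z, h). (z, act z h))"

record ('g, 'z, 'h) bispace =
  ztop :: "'z topology"
  zrng :: "'z \<Rightarrow> 'g"
  zsrc :: "'z \<Rightarrow> 'h"
  zleft :: "'g \<Rightarrow> 'z \<Rightarrow> 'z"
  zright :: "'z \<Rightarrow> 'h \<Rightarrow> 'z"

definition left_orbit :: "'g groupoid \<Rightarrow> ('g, 'z, 'h) bispace \<Rightarrow> 'z \<Rightarrow> 'z set" where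
  "left_orbit G Z z = {zleft Z g z | g. g \<in> topspace (gtop G) \<and> gsrc G g = zrng Z z}"

definition right_orbit :: "'h groupoid \<Rightarrow> ('g, 'z, 'h) bispace \<Rightarrow> 'z \<Rightarrow> 'z set" where
  "right_orbit H Z z = {zright Z z h | h. h \<in> topspace (gtop H) \<and> zsrc Z z = grng H h}"

definition quotient_topology :: "'z topology \<Rightarrow> ('z \<Rightarrow> 'y) \<Rightarrow> 'y topology" where
  "quotient_topology X p =
    topology (\<lambda>U. U \<subseteq> p ` topspace X \<and> openin X {z \<in> topspace X. p z \<in> U})"

lemma openin_quotient_topology:
  "openin (quotient_topology X p) U \<longleftrightarrow>
    U \<subseteq> p ` topspace X \<and> openin X {z \<in> topspace X. p z \<in> U}"
proof -
  have "istopology (\<lambda>U. U \<subseteq> p ` topspace X \<and> openin X {z \<in> topspace X. p z \<in> U})"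
    unfolding istopology_def
  proof (intro conjI allI impI)
    fix S T
    assume S: "S \<subseteq> p ` topspace X \<and> openin X {z \<in> topspace X. p z \<in> S}"
      and T: "T \<subseteq> p ` topspace X \<and> openin X {z \<in> topspace X. p z \<in> T}"
    show "S \<inter> T \<subseteq> p ` topspace X" using S by blast
    have "{z \<in> topspace X. p z \<in> S \<inter> T} =
      {z \<in> topspace X. p z \<in> S} \<inter> {z \<in> topspace X. p z \<in> T}" by blast
    then show "openin X {z \<in> topspace X. p z \<in> S \<inter> T}" using S T by auto
  next
    fix \<K>
    assume K: "\<forall>K\<in>\<K>. K \<subseteq> p ` topspace X \<and> openin X {z \<in> topspace X. p z \<in> K}"
    then show "\<Union>\<K> \<subseteq> p ` topspace X" by blast
    have "{z \<in> topspace X. p z \<in> \<Union>\<K>} = (\<Union>K\<in>\<K>. {z \<in> topspace X. p z \<in> K})" by blast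
    then show "openin X {z \<in> topspace X. p z \<in> \<Union>\<K>}" using K by auto
  qed
  then show ?thesis by (simp add: quotient_topology_def topology_inverse')
qed

definition groupoid_equivalence ::
    "'g groupoid \<Rightarrow> 'h groupoid \<Rightarrow> ('g, 'z, 'h) bispace \<Rightarrow> bool" where
  "groupoid_equivalence G H Z \<longleftrightarrow>
    locally_compact_space (ztop Z) \<and> Hausdorff_space (ztop Z) \<and>
    free_proper_left_space G (ztop Z) (zrng Z) (zleft Z) \<and>
    free_proper_right_space H (ztop Z) (zsrc Z) (zright Z) \<and>
    open_map (ztop Z) (unit_space G) (zrng Z) \<and>
    open_map (ztop Z) (unit_space H) (zsrc Z) \<and>
    (\<forall>g\<in>topspace (gtop G). \<forall>z\<in>topspace (ztop Z).
      gsrc G g = zrng Z z \<longrightarrow> zsrc Z (zleft Z g z) = zsrc Z z) \<and>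
    (\<forall>z\<in>topspace (ztop Z). \<forall>h\<in>topspace (gtop H).
      zsrc Z z = grng H h \<longrightarrow> zrng Z (zright Z z h) = zrng Z z) \<and>
    (\<forall>g\<in>topspace (gtop G). \<forall>z\<in>topspace (ztop Z). \<forall>h\<in>topspace (gtop H).
      gsrc G g = zrng Z z \<and> zsrc Z z = grng H h \<longrightarrow>
      zright Z (zleft Z g z) h = zleft Z g (zright Z z h)) \<and>
    (\<exists>\<phi>. homeomorphic_map (quotient_topology (ztop Z) (right_orbit H Z)) (unit_space G) \<phi> \<and>
      (\<forall>z\<in>topspace (ztop Z). \<phi> (right_orbit H Z z) = zrng Z z)) \<and>
    (\<exists>\<phi>. homeomorphic_map (quotient_topology (ztop Z) (left_orbit G Z)) (unit_space H) \<phi> \<and>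
      (\<forall>z\<in>topspace (ztop Z). \<phi> (left_orbit G Z z) = zsrc Z z))"

definition left_bracket :: "'g groupoid \<Rightarrow> ('g, 'z, 'h) bispace \<Rightarrow> 'z \<Rightarrow> 'z \<Rightarrow> 'g" where
  "left_bracket G Z y z =
    (THE g. g \<in> topspace (gtop G) \<and> gsrc G g = zrng Z z \<and> zleft Z g z = y)"

definition right_bracket :: "'h groupoid \<Rightarrow> ('g, 'z, 'h) bispace \<Rightarrow> 'z \<Rightarrow> 'z \<Rightarrow> 'h" where
  "right_bracket H Z y z =
    (THE h. h \<in> topspace (gtop H) \<and> zsrc Z y = grng H h \<and> zright Z y h = z)"


section \<open>Banach bundles and Fell bundles\<close>

record ('b, 'x) banach_bundle =
  btop :: "'b topology"
  bproj :: "'b \<Rightarrow> 'x"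
  badd :: "'b \<Rightarrow> 'b \<Rightarrow> 'b"
  bscale :: "complex \<Rightarrow> 'b \<Rightarrow> 'b"
  bzero :: "'x \<Rightarrow> 'b"
  bnorm :: "'b \<Rightarrow> real"

record ('b, 'x) star_bundle = "('b, 'x) banach_bundle" +
  bmul :: "'b \<Rightarrow> 'b \<Rightarrow> 'b"
  bstar :: "'b \<Rightarrow> 'b"

definition fibre :: "('b, 'x, 'm) banach_bundle_scheme \<Rightarrow> 'x \<Rightarrow> 'b cspace" where
  "fibre B x =
    \<lparr> carr = {b \<in> topspace (btop B). bproj B b = x},
      vadd = badd B, vscale = bscale B, vzero = bzero B x, vnorm = bnorm B \<rparr>"

definition fibre_algebra :: "('b, 'x) star_bundle \<Rightarrow> 'x \<Rightarrow> 'b cstar" where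
  "fibre_algebra B x =
    \<lparr> carr = {b \<in> topspace (btop B). bproj B b = x},
      vadd = badd B, vscale = bscale B, vzero = bzero B x, vnorm = bnorm B,
      amul = bmul B, astar = bstar B \<rparr>"

text \<open>The net condition in the last axiom is phrased with filters on the total space: the filter
  \<open>F\<close> stands for the image filter of a net.\<close>

locale usc_banach_bundle =
  fixes X :: "'x topology" and B :: "('b, 'x, 'm) banach_bundle_scheme"
  assumes base_locally_compact: "locally_compact_space X"
    and base_hausdorff: "Hausdorff_space X"
    and proj_continuous: "continuous_map (btop B) X (bproj B)"
    and proj_open: "open_map (btop B) X (bproj B)"
    and proj_surj: "bproj B ` topspace (btop B) = topspace X"
    and fibre_banach: "x \<in> topspace X \<Longrightarrow> banach_space (fibre B x)"
    and norm_usc: "openin (btop B) {b \<in> topspace (btop B). bnorm B b < t}"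
    and add_continuous: "continuous_map
          (subtopology (prod_topology (btop B) (btop B)) {(a, b). bproj B a = bproj B b})
          (btop B) (\<lambda>(a, b). badd B a b)"
    and scale_continuous: "continuous_map (prod_topology euclidean (btop B)) (btop B)
          (\<lambda>(\<alpha>, b). bscale B \<alpha> b)"
    and norm_limit: "\<lbrakk>\<forall>\<^sub>F b in F. b \<in> topspace (btop B); (bnorm B \<longlongrightarrow> 0) F;
            limitin X (bproj B) x F\<rbrakk>
          \<Longrightarrow> limitin (btop B) (\<lambda>b. b) (bzero B x) F"

locale fell_bundle = lch_groupoid G + usc_banach_bundle "gtop G" B
  for G :: "'g groupoid" and B :: "('b, 'g) star_bundle" +
  assumes mult_closed: "\<lbrakk>a \<in> topspace (btop B); b \<in> topspace (btop B);
            gsrc G (bproj B a) = grng G (bproj B b)\<rbrakk>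
          \<Longrightarrow> bmul B a b \<in> topspace (btop B)"
    and mult_proj: "\<lbrakk>a \<in> topspace (btop B); b \<in> topspace (btop B);
            gsrc G (bproj B a) = grng G (bproj B b)\<rbrakk>
          \<Longrightarrow> bproj B (bmul B a b) = gmul G (bproj B a) (bproj B b)"
    and mult_continuous: "continuous_map
          (subtopology (prod_topology (btop B) (btop B))
            {(a, b). gsrc G (bproj B a) = grng G (bproj B b)})
          (btop B) (\<lambda>(a, b). bmul B a b)"
    and mult_add_left: "\<lbrakk>a \<in> topspace (btop B); a' \<in> topspace (btop B); b \<in> topspace (btop B);
            bproj B a = bproj B a'; gsrc G (bproj B a) = grng G (bproj B b)\<rbrakk>
          \<Longrightarrow> bmul B (badd B a a') b = badd B (bmul B a b) (bmul B a' b)"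
    and mult_add_right: "\<lbrakk>a \<in> topspace (btop B); b \<in> topspace (btop B); b' \<in> topspace (btop B);
            bproj B b = bproj B b'; gsrc G (bproj B a) = grng G (bproj B b)\<rbrakk>
          \<Longrightarrow> bmul B a (badd B b b') = badd B (bmul B a b) (bmul B a b')"
    and mult_scale_left: "\<lbrakk>a \<in> topspace (btop B); b \<in> topspace (btop B);
            gsrc G (bproj B a) = grng G (bproj B b)\<rbrakk>
          \<Longrightarrow> bmul B (bscale B \<alpha> a) b = bscale B \<alpha> (bmul B a b)"
    and mult_scale_right: "\<lbrakk>a \<in> topspace (btop B); b \<in> topspace (btop B);
            gsrc G (bproj B a) = grng G (bproj B b)\<rbrakk>
          \<Longrightarrow> bmul B a (bscale B \<alpha> b) = bscale B \<alpha> (bmul B a b)"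
    and mult_assoc: "\<lbrakk>a \<in> topspace (btop B); b \<in> topspace (btop B); c \<in> topspace (btop B);
            gsrc G (bproj B a) = grng G (bproj B b); gsrc G (bproj B b) = grng G (bproj B c)\<rbrakk>
          \<Longrightarrow> bmul B (bmul B a b) c = bmul B a (bmul B b c)"
    and star_closed: "a \<in> topspace (btop B) \<Longrightarrow> bstar B a \<in> topspace (btop B)"
    and star_proj: "a \<in> topspace (btop B) \<Longrightarrow> bproj B (bstar B a) = ginv G (bproj B a)"
    and star_continuous: "continuous_map (btop B) (btop B) (bstar B)"
    and star_star: "a \<in> topspace (btop B) \<Longrightarrow> bstar B (bstar B a) = a"
    and star_add: "\<lbrakk>a \<in> topspace (btop B); b \<in> topspace (btop B); bproj B a = bproj B b\<rbrakk>
          \<Longrightarrow> bstar B (badd B a b) = badd B (bstar B a) (bstar B b)"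
    and star_scale: "a \<in> topspace (btop B)
          \<Longrightarrow> bstar B (bscale B \<alpha> a) = bscale B (cnj \<alpha>) (bstar B a)"
    and star_mult: "\<lbrakk>a \<in> topspace (btop B); b \<in> topspace (btop B);
            gsrc G (bproj B a) = grng G (bproj B b)\<rbrakk>
          \<Longrightarrow> bstar B (bmul B a b) = bmul B (bstar B b) (bstar B a)"
    and unit_fibre_cstar: "u \<in> units G \<Longrightarrow> cstar_algebra (fibre_algebra B u)"
    and fibre_imprimitivity: "g \<in> topspace (gtop G) \<Longrightarrow>
          imprimitivity_bimodule (fibre_algebra B (grng G g)) (fibre_algebra B (gsrc G g))
            (fibre B g) (bmul B) (bmul B)
            (\<lambda>a b. bmul B a (bstar B b)) (\<lambda>a b. bmul B (bstar B a) b)"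

text \<open>The algebra \<open>\<Gamma>\<^sub>0\<close> of the restriction of the bundle to the unit space. Sections are extensional
  functions; inserting \<open>0\<close> into the set of norms only matters for an empty unit space.\<close>

definition section_algebra :: "'g groupoid \<Rightarrow> ('b, 'g) star_bundle \<Rightarrow> ('g \<Rightarrow> 'b) cstar" where
  "section_algebra G B =
    \<lparr> carr = {f \<in> extensional (units G).
        continuous_map (unit_space G) (btop B) f \<and>
        (\<forall>u\<in>units G. bproj B (f u) = u) \<and>
        (\<forall>\<epsilon>>0. compactin (unit_space G) {u \<in> units G. \<epsilon> \<le> bnorm B (f u)})},
      vadd = (\<lambda>f k. \<lambda>u\<in>units G. badd B (f u) (k u)),
      vscale = (\<lambda>\<alpha> f. \<lambda>u\<in>units G. bscale B \<alpha> (f u)),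
      vzero = (\<lambda>u\<in>units G. bzero B u),
      vnorm = (\<lambda>f. Sup (insert 0 ((\<lambda>u. bnorm B (f u)) ` units G))),
      amul = (\<lambda>f k. \<lambda>u\<in>units G. bmul B (f u) (k u)),
      astar = (\<lambda>f. \<lambda>u\<in>units G. bstar B (f u)) \<rparr>"


section \<open>Equivalences of Fell bundles\<close>

record ('e, 'z, 'b, 'c) bibundle = "('e, 'z) banach_bundle" +
  eleft :: "'b \<Rightarrow> 'e \<Rightarrow> 'e"
  eright :: "'e \<Rightarrow> 'c \<Rightarrow> 'e"
  lip :: "'e \<Rightarrow> 'e \<Rightarrow> 'b"
  rip :: "'e \<Rightarrow> 'e \<Rightarrow> 'c"

text \<open>Bilinearity of the actions is not an extra axiom: within the imprimitivity bimodules it is part of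
  \<open>fibre_imprimitivity\<close>, and in general it follows from \<open>lip_left\<close>, \<open>rip_right\<close>
  and nondegeneracy of the inner products.\<close>

locale fell_equivalence = usc_banach_bundle "ztop Z" E
  for G :: "'g groupoid" and H :: "'h groupoid" and Z :: "('g, 'z, 'h) bispace"
    and B :: "('b, 'g) star_bundle" and C :: "('c, 'h) star_bundle"
    and E :: "('e, 'z, 'b, 'c) bibundle" +
  assumes base_equivalence: "groupoid_equivalence G H Z"
    and left_closed: "\<lbrakk>b \<in> topspace (btop B); e \<in> topspace (btop E);
            gsrc G (bproj B b) = zrng Z (bproj E e)\<rbrakk>
          \<Longrightarrow> eleft E b e \<in> topspace (btop E)"
    and left_proj: "\<lbrakk>b \<in> topspace (btop B); e \<in> topspace (btop E);
            gsrc G (bproj B b) = zrng Z (bproj E e)\<rbrakk>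
          \<Longrightarrow> bproj E (eleft E b e) = zleft Z (bproj B b) (bproj E e)"
    and left_left: "\<lbrakk>a \<in> topspace (btop B); b \<in> topspace (btop B); e \<in> topspace (btop E);
            gsrc G (bproj B a) = grng G (bproj B b); gsrc G (bproj B b) = zrng Z (bproj E e)\<rbrakk>
          \<Longrightarrow> eleft E a (eleft E b e) = eleft E (bmul B a b) e"
    and left_norm: "\<lbrakk>b \<in> topspace (btop B); e \<in> topspace (btop E);
            gsrc G (bproj B b) = zrng Z (bproj E e)\<rbrakk>
          \<Longrightarrow> bnorm E (eleft E b e) \<le> bnorm B b * bnorm E e"
    and left_continuous: "continuous_map
          (subtopology (prod_topology (btop B) (btop E))
            {(b, e). gsrc G (bproj B b) = zrng Z (bproj E e)})
          (btop E) (\<lambda>(b, e). eleft E b e)"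
    and right_closed: "\<lbrakk>e \<in> topspace (btop E); c \<in> topspace (btop C);
            zsrc Z (bproj E e) = grng H (bproj C c)\<rbrakk>
          \<Longrightarrow> eright E e c \<in> topspace (btop E)"
    and right_proj: "\<lbrakk>e \<in> topspace (btop E); c \<in> topspace (btop C);
            zsrc Z (bproj E e) = grng H (bproj C c)\<rbrakk>
          \<Longrightarrow> bproj E (eright E e c) = zright Z (bproj E e) (bproj C c)"
    and right_right: "\<lbrakk>e \<in> topspace (btop E); c \<in> topspace (btop C); d \<in> topspace (btop C);
            zsrc Z (bproj E e) = grng H (bproj C c); gsrc H (bproj C c) = grng H (bproj C d)\<rbrakk>
          \<Longrightarrow> eright E (eright E e c) d = eright E e (bmul C c d)"
    and right_norm: "\<lbrakk>e \<in> topspace (btop E); c \<in> topspace (btop C);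
            zsrc Z (bproj E e) = grng H (bproj C c)\<rbrakk>
          \<Longrightarrow> bnorm E (eright E e c) \<le> bnorm E e * bnorm C c"
    and right_continuous: "continuous_map
          (subtopology (prod_topology (btop E) (btop C))
            {(e, c). zsrc Z (bproj E e) = grng H (bproj C c)})
          (btop E) (\<lambda>(e, c). eright E e c)"
    and actions_commute: "\<lbrakk>b \<in> topspace (btop B); e \<in> topspace (btop E); c \<in> topspace (btop C);
            gsrc G (bproj B b) = zrng Z (bproj E e); zsrc Z (bproj E e) = grng H (bproj C c)\<rbrakk>
          \<Longrightarrow> eright E (eleft E b e) c = eleft E b (eright E e c)"
    and lip_closed: "\<lbrakk>e \<in> topspace (btop E); f \<in> topspace (btop E);
            zsrc Z (bproj E e) = zsrc Z (bproj E f)\<rbrakk>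
          \<Longrightarrow> lip E e f \<in> topspace (btop B)"
    and lip_continuous: "continuous_map
          (subtopology (prod_topology (btop E) (btop E))
            {(e, f). zsrc Z (bproj E e) = zsrc Z (bproj E f)})
          (btop B) (\<lambda>(e, f). lip E e f)"
    and lip_add_left: "\<lbrakk>e \<in> topspace (btop E); e' \<in> topspace (btop E); f \<in> topspace (btop E);
            bproj E e = bproj E e'; zsrc Z (bproj E e) = zsrc Z (bproj E f)\<rbrakk>
          \<Longrightarrow> lip E (badd E e e') f = badd B (lip E e f) (lip E e' f)"
    and lip_add_right: "\<lbrakk>e \<in> topspace (btop E); f \<in> topspace (btop E); f' \<in> topspace (btop E);
            bproj E f = bproj E f'; zsrc Z (bproj E e) = zsrc Z (bproj E f)\<rbrakk>
          \<Longrightarrow> lip E e (badd E f f') = badd B (lip E e f) (lip E e f')"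
    and lip_scale_left: "\<lbrakk>e \<in> topspace (btop E); f \<in> topspace (btop E);
            zsrc Z (bproj E e) = zsrc Z (bproj E f)\<rbrakk>
          \<Longrightarrow> lip E (bscale E \<alpha> e) f = bscale B \<alpha> (lip E e f)"
    and lip_scale_right: "\<lbrakk>e \<in> topspace (btop E); f \<in> topspace (btop E);
            zsrc Z (bproj E e) = zsrc Z (bproj E f)\<rbrakk>
          \<Longrightarrow> lip E e (bscale E \<alpha> f) = bscale B (cnj \<alpha>) (lip E e f)"
    and rip_closed: "\<lbrakk>e \<in> topspace (btop E); f \<in> topspace (btop E);
            zrng Z (bproj E e) = zrng Z (bproj E f)\<rbrakk>
          \<Longrightarrow> rip E e f \<in> topspace (btop C)"
    and rip_continuous: "continuous_map
          (subtopology (prod_topology (btop E) (btop E))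
            {(e, f). zrng Z (bproj E e) = zrng Z (bproj E f)})
          (btop C) (\<lambda>(e, f). rip E e f)"
    and rip_add_left: "\<lbrakk>e \<in> topspace (btop E); e' \<in> topspace (btop E); f \<in> topspace (btop E);
            bproj E e = bproj E e'; zrng Z (bproj E e) = zrng Z (bproj E f)\<rbrakk>
          \<Longrightarrow> rip E (badd E e e') f = badd C (rip E e f) (rip E e' f)"
    and rip_add_right: "\<lbrakk>e \<in> topspace (btop E); f \<in> topspace (btop E); f' \<in> topspace (btop E);
            bproj E f = bproj E f'; zrng Z (bproj E e) = zrng Z (bproj E f)\<rbrakk>
          \<Longrightarrow> rip E e (badd E f f') = badd C (rip E e f) (rip E e f')"
    and rip_scale_left: "\<lbrakk>e \<in> topspace (btop E); f \<in> topspace (btop E);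
            zrng Z (bproj E e) = zrng Z (bproj E f)\<rbrakk>
          \<Longrightarrow> rip E (bscale E \<alpha> e) f = bscale C (cnj \<alpha>) (rip E e f)"
    and rip_scale_right: "\<lbrakk>e \<in> topspace (btop E); f \<in> topspace (btop E);
            zrng Z (bproj E e) = zrng Z (bproj E f)\<rbrakk>
          \<Longrightarrow> rip E e (bscale E \<alpha> f) = bscale C \<alpha> (rip E e f)"
    and lip_proj: "\<lbrakk>e \<in> topspace (btop E); f \<in> topspace (btop E);
            zsrc Z (bproj E e) = zsrc Z (bproj E f)\<rbrakk>
          \<Longrightarrow> bproj B (lip E e f) = left_bracket G Z (bproj E e) (bproj E f)"
    and rip_proj: "\<lbrakk>e \<in> topspace (btop E); f \<in> topspace (btop E);
            zrng Z (bproj E e) = zrng Z (bproj E f)\<rbrakk>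
          \<Longrightarrow> bproj C (rip E e f) = right_bracket H Z (bproj E e) (bproj E f)"
    and lip_star: "\<lbrakk>e \<in> topspace (btop E); f \<in> topspace (btop E);
            zsrc Z (bproj E e) = zsrc Z (bproj E f)\<rbrakk>
          \<Longrightarrow> bstar B (lip E e f) = lip E f e"
    and rip_star: "\<lbrakk>e \<in> topspace (btop E); f \<in> topspace (btop E);
            zrng Z (bproj E e) = zrng Z (bproj E f)\<rbrakk>
          \<Longrightarrow> bstar C (rip E e f) = rip E f e"
    and lip_left: "\<lbrakk>b \<in> topspace (btop B); e \<in> topspace (btop E); f \<in> topspace (btop E);
            gsrc G (bproj B b) = zrng Z (bproj E e); zsrc Z (bproj E e) = zsrc Z (bproj E f)\<rbrakk>
          \<Longrightarrow> bmul B b (lip E e f) = lip E (eleft E b e) f"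
    and rip_right: "\<lbrakk>e \<in> topspace (btop E); f \<in> topspace (btop E); c \<in> topspace (btop C);
            zrng Z (bproj E e) = zrng Z (bproj E f); zsrc Z (bproj E f) = grng H (bproj C c)\<rbrakk>
          \<Longrightarrow> bmul C (rip E e f) c = rip E e (eright E f c)"
    and lip_rip: "\<lbrakk>e \<in> topspace (btop E); f \<in> topspace (btop E); k \<in> topspace (btop E);
            zsrc Z (bproj E e) = zsrc Z (bproj E f); zrng Z (bproj E f) = zrng Z (bproj E k)\<rbrakk>
          \<Longrightarrow> eleft E (lip E e f) k = eright E e (rip E f k)"
    and fibre_imprimitivity: "z \<in> topspace (ztop Z) \<Longrightarrow>
          imprimitivity_bimodule (fibre_algebra B (zrng Z z)) (fibre_algebra C (zsrc Z z))
            (fibre E z) (eleft E) (eright E) (lip E) (rip E)"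


section \<open>Linking groupoid and linking bundle\<close>

text \<open>One datatype serves for both disjoint unions \<open>G \<squnion> Z \<squnion> Z\<^sup>o\<^sup>p \<squnion> H\<close> and
  \<open>B \<squnion> E \<squnion> E\<^sup>o\<^sup>p \<squnion> C\<close>; \<open>In21 z\<close> and \<open>In21 e\<close> are the elements of the opposite
  copies attached to \<open>z\<close> and \<open>e\<close>.\<close>

datatype ('a, 'z, 'd) link = In11 'a | In12 'z | In21 'z | In22 'd

definition link_topology ::
    "'a topology \<Rightarrow> 'z topology \<Rightarrow> 'd topology \<Rightarrow> ('a, 'z, 'd) link topology" where
  "link_topology S T W = topology (\<lambda>U.
    openin S (In11 -` U) \<and> openin T (In12 -` U) \<and> openin T (In21 -` U) \<and> openin W (In22 -` U))"

lemma openin_link_topology: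
  "openin (link_topology S T W) U \<longleftrightarrow>
    openin S (In11 -` U) \<and> openin T (In12 -` U) \<and> openin T (In21 -` U) \<and> openin W (In22 -` U)"
proof -
  have "istopology (\<lambda>U. openin S (In11 -` U) \<and> openin T (In12 -` U) \<and>
      openin T (In21 -` U) \<and> openin W (In22 -` U))"
    unfolding istopology_def by (auto simp: vimage_Int vimage_Union)
  then show ?thesis by (simp add: link_topology_def topology_inverse')
qed

fun link_rng :: "'g groupoid \<Rightarrow> 'h groupoid \<Rightarrow> ('g, 'z, 'h) bispace
    \<Rightarrow> ('g, 'z, 'h) link \<Rightarrow> ('g, 'z, 'h) link" where
  "link_rng G H Z (In11 g) = In11 (grng G g)"
| "link_rng G H Z (In12 z) = In11 (zrng Z z)"
| "link_rng G H Z (In21 z) = In22 (zsrc Z z)"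
| "link_rng G H Z (In22 h) = In22 (grng H h)"

fun link_src :: "'g groupoid \<Rightarrow> 'h groupoid \<Rightarrow> ('g, 'z, 'h) bispace
    \<Rightarrow> ('g, 'z, 'h) link \<Rightarrow> ('g, 'z, 'h) link" where
  "link_src G H Z (In11 g) = In11 (gsrc G g)"
| "link_src G H Z (In12 z) = In22 (zsrc Z z)"
| "link_src G H Z (In21 z) = In11 (zrng Z z)"
| "link_src G H Z (In22 h) = In22 (gsrc H h)"

text \<open>Only the composable combinations of constructors are specified.\<close>

fun link_mul :: "'g groupoid \<Rightarrow> 'h groupoid \<Rightarrow> ('g, 'z, 'h) bispace
    \<Rightarrow> ('g, 'z, 'h) link \<Rightarrow> ('g, 'z, 'h) link \<Rightarrow> ('g, 'z, 'h) link" where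
  "link_mul G H Z (In11 g) (In11 k) = In11 (gmul G g k)"
| "link_mul G H Z (In11 g) (In12 z) = In12 (zleft Z g z)"
| "link_mul G H Z (In12 y) (In21 z) = In11 (left_bracket G Z y z)"
| "link_mul G H Z (In12 z) (In22 h) = In12 (zright Z z h)"
| "link_mul G H Z (In21 z) (In11 g) = In21 (zleft Z (ginv G g) z)"
| "link_mul G H Z (In21 y) (In12 z) = In22 (right_bracket H Z y z)"
| "link_mul G H Z (In22 h) (In21 z) = In21 (zright Z z (ginv H h))"
| "link_mul G H Z (In22 h) (In22 k) = In22 (gmul H h k)"
| "link_mul G H Z _ _ = undefined"

fun link_inv :: "'g groupoid \<Rightarrow> 'h groupoid \<Rightarrow> ('g, 'z, 'h) link \<Rightarrow> ('g, 'z, 'h) link" where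
  "link_inv G H (In11 g) = In11 (ginv G g)"
| "link_inv G H (In12 z) = In21 z"
| "link_inv G H (In21 z) = In12 z"
| "link_inv G H (In22 h) = In22 (ginv H h)"

definition linking_groupoid :: "'g groupoid \<Rightarrow> 'h groupoid \<Rightarrow> ('g, 'z, 'h) bispace
    \<Rightarrow> ('g, 'z, 'h) link groupoid" where
  "linking_groupoid G H Z =
    \<lparr> gtop = link_topology (gtop G) (ztop Z) (gtop H),
      gsrc = link_src G H Z, grng = link_rng G H Z,
      gmul = link_mul G H Z, ginv = link_inv G H \<rparr>"

fun link_add :: "('b, 'g) star_bundle \<Rightarrow> ('c, 'h) star_bundle \<Rightarrow> ('e, 'z, 'b, 'c) bibundle
    \<Rightarrow> ('b, 'e, 'c) link \<Rightarrow> ('b, 'e, 'c) link \<Rightarrow> ('b, 'e, 'c) link" where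
  "link_add B C E (In11 a) (In11 b) = In11 (badd B a b)"
| "link_add B C E (In12 e) (In12 f) = In12 (badd E e f)"
| "link_add B C E (In21 e) (In21 f) = In21 (badd E e f)"
| "link_add B C E (In22 c) (In22 d) = In22 (badd C c d)"
| "link_add B C E _ _ = undefined"

fun link_scale :: "('b, 'g) star_bundle \<Rightarrow> ('c, 'h) star_bundle \<Rightarrow> ('e, 'z, 'b, 'c) bibundle
    \<Rightarrow> complex \<Rightarrow> ('b, 'e, 'c) link \<Rightarrow> ('b, 'e, 'c) link" where
  "link_scale B C E \<alpha> (In11 b) = In11 (bscale B \<alpha> b)"
| "link_scale B C E \<alpha> (In12 e) = In12 (bscale E \<alpha> e)"
| "link_scale B C E \<alpha> (In21 e) = In21 (bscale E (cnj \<alpha>) e)"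
| "link_scale B C E \<alpha> (In22 c) = In22 (bscale C \<alpha> c)"

fun link_norm :: "('b, 'g) star_bundle \<Rightarrow> ('c, 'h) star_bundle \<Rightarrow> ('e, 'z, 'b, 'c) bibundle
    \<Rightarrow> ('b, 'e, 'c) link \<Rightarrow> real" where
  "link_norm B C E (In11 b) = bnorm B b"
| "link_norm B C E (In12 e) = bnorm E e"
| "link_norm B C E (In21 e) = bnorm E e"
| "link_norm B C E (In22 c) = bnorm C c"

fun link_bmul :: "('b, 'g) star_bundle \<Rightarrow> ('c, 'h) star_bundle \<Rightarrow> ('e, 'z, 'b, 'c) bibundle
    \<Rightarrow> ('b, 'e, 'c) link \<Rightarrow> ('b, 'e, 'c) link \<Rightarrow> ('b, 'e, 'c) link" where
  "link_bmul B C E (In11 a) (In11 b) = In11 (bmul B a b)"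
| "link_bmul B C E (In11 b) (In12 e) = In12 (eleft E b e)"
| "link_bmul B C E (In12 e) (In21 f) = In11 (lip E e f)"
| "link_bmul B C E (In12 e) (In22 c) = In12 (eright E e c)"
| "link_bmul B C E (In21 e) (In11 b) = In21 (eleft E (bstar B b) e)"
| "link_bmul B C E (In21 e) (In12 f) = In22 (rip E e f)"
| "link_bmul B C E (In22 c) (In21 e) = In21 (eright E e (bstar C c))"
| "link_bmul B C E (In22 c) (In22 d) = In22 (bmul C c d)"
| "link_bmul B C E _ _ = undefined"

fun link_star :: "('b, 'g) star_bundle \<Rightarrow> ('c, 'h) star_bundle
    \<Rightarrow> ('b, 'e, 'c) link \<Rightarrow> ('b, 'e, 'c) link" where
  "link_star B C (In11 b) = In11 (bstar B b)"
| "link_star B C (In12 e) = In21 e"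
| "link_star B C (In21 e) = In12 e"
| "link_star B C (In22 c) = In22 (bstar C c)"

definition linking_bundle :: "('b, 'g) star_bundle \<Rightarrow> ('c, 'h) star_bundle
    \<Rightarrow> ('e, 'z, 'b, 'c) bibundle \<Rightarrow> (('b, 'e, 'c) link, ('g, 'z, 'h) link) star_bundle" where
  "linking_bundle B C E =
    \<lparr> btop = link_topology (btop B) (btop E) (btop C),
      bproj = map_link (bproj B) (bproj E) (bproj C),
      badd = link_add B C E,
      bscale = link_scale B C E,
      bzero = map_link (bzero B) (bzero E) (bzero C),
      bnorm = link_norm B C E,
      bmul = link_bmul B C E,
      bstar = link_star B C \<rparr>"

end

theory Submission
  imports Defs
begin

text \<open>
  All operations of the linking bundle are pieces of the given data, and its topology makes the four
  pieces open. So the axioms of a Fell bundle are checked piece by piece, and three of these checks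
  are not immediate.

  Over the base, multiplying elements of \<open>Z\<close> and \<open>Z\<^sup>o\<^sup>p\<close> gives the brackets. They exist because
  the homeomorphisms from the orbit spaces to the unit spaces are injective, and they are continuous
  because \<open>(g, z) \<mapsto> (g \<cdot> z, z)\<close> is proper and injective (\<open>lbr_continuous\<close>).

  On the bundle, associativity and bilinearity require that the actions are bilinear and that
  \<open>b\<close> and \<open>c\<close> can be moved from one argument of an inner product to the other as \<open>b\<^sup>*\<close> and \<open>c\<^sup>*\<close>.
  The axioms of an equivalence assert this within a single imprimitivity bimodule only, that is for
  \<open>b\<close> and \<open>c\<close> over units. In general it follows by testing against enough elements. Elements
  of \<open>\<E>\<close> are determined by their inner products (\<open>lip_separates\<close>); elements of \<open>\<B>\<close> and \<open>\<C>\<close> are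
  determined by their products with a total subset of the algebra at their range or source
  (\<open>left_mult_separates\<close>); and by fullness the inner products of \<open>\<E>\<close> are total
  (\<open>rip_left_adjoint\<close>, \<open>lip_right_adjoint\<close>).

  For the fibres, the equations of an imprimitivity bimodule are consequences of the algebra of the
  bundle, and the involution is isometric and exchanges the two inner products. What remains is that
  the left inner product is positive, full and induces the norm (\<open>fell_bundleI\<close>), which each piece
  inherits from the bimodules \<open>B\<^sub>g\<close>, \<open>E\<^sub>z\<close> and \<open>C\<^sub>h\<close>.

  The unit space of the linking groupoid is the disjoint union of \<open>G\<^sup>(\<^sup>0\<^sup>)\<close> and \<open>H\<^sup>(\<^sup>0\<^sup>)\<close>, over which
  the linking bundle is \<open>\<B>\<close> and \<open>\<C>\<close>; restricting sections to the two parts is the isomorphism onto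
  \<open>A \<oplus> D\<close>. That these sections form C*-algebras is a fact about every Fell bundle. Its only
  substantial part is completeness, which rests on uniform limits of continuous sections being
  continuous (\<open>uniform_limit_section_continuous\<close>).
\<close>

section \<open>Normed spaces on carriers\<close>

text \<open>Completeness of a \<^locale>\<open>banach_space\<close> speaks of a metric topology, and using it requires
  knowing already that \<^const>\<open>norm_dist\<close> is a metric. The incomplete notion gives the latter first,
  and then replaces the topology by sequences.\<close>

locale normed_cspace =
  fixes V :: "('a, 'm) cspace_scheme"
  assumes zero_closed: "vzero V \<in> carr V"
    and add_closed: "\<lbrakk>x \<in> carr V; y \<in> carr V\<rbrakk> \<Longrightarrow> vadd V x y \<in> carr V"
    and scale_closed: "x \<in> carr V \<Longrightarrow> vscale V \<alpha> x \<in> carr V"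
    and add_assoc: "\<lbrakk>x \<in> carr V; y \<in> carr V; z \<in> carr V\<rbrakk>
          \<Longrightarrow> vadd V (vadd V x y) z = vadd V x (vadd V y z)"
    and add_commute: "\<lbrakk>x \<in> carr V; y \<in> carr V\<rbrakk> \<Longrightarrow> vadd V x y = vadd V y x"
    and add_zero: "x \<in> carr V \<Longrightarrow> vadd V x (vzero V) = x"
    and add_inverse: "x \<in> carr V \<Longrightarrow> vadd V x (vscale V (-1) x) = vzero V"
    and scale_one: "x \<in> carr V \<Longrightarrow> vscale V 1 x = x"
    and scale_scale: "x \<in> carr V \<Longrightarrow> vscale V \<alpha> (vscale V \<beta> x) = vscale V (\<alpha> * \<beta>) x"
    and scale_add: "\<lbrakk>x \<in> carr V; y \<in> carr V\<rbrakk>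
          \<Longrightarrow> vscale V \<alpha> (vadd V x y) = vadd V (vscale V \<alpha> x) (vscale V \<alpha> y)"
    and add_scale: "x \<in> carr V
          \<Longrightarrow> vscale V (\<alpha> + \<beta>) x = vadd V (vscale V \<alpha> x) (vscale V \<beta> x)"
    and norm_nonneg: "x \<in> carr V \<Longrightarrow> 0 \<le> vnorm V x"
    and norm_eq_zero: "x \<in> carr V \<Longrightarrow> vnorm V x = 0 \<longleftrightarrow> x = vzero V"
    and norm_scale: "x \<in> carr V \<Longrightarrow> vnorm V (vscale V \<alpha> x) = cmod \<alpha> * vnorm V x"
    and norm_triangle: "\<lbrakk>x \<in> carr V; y \<in> carr V\<rbrakk>
          \<Longrightarrow> vnorm V (vadd V x y) \<le> vnorm V x + vnorm V y"
begin

definition sub :: "'a \<Rightarrow> 'a \<Rightarrow> 'a" where "sub x y = vadd V x (vscale V (-1) y)"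

lemma sub_closed: "x \<in> carr V \<Longrightarrow> y \<in> carr V \<Longrightarrow> sub x y \<in> carr V"
  by (simp add: sub_def add_closed scale_closed)

lemma add_sub_cancel:
  assumes "x \<in> carr V" "y \<in> carr V"
  shows "vadd V x (sub y x) = y"
proof -
  have "vadd V x (sub y x) = vadd V (vadd V x (vscale V (-1) x)) y"
    using assms by (simp add: sub_def add_assoc scale_closed add_commute)
  then show ?thesis
    using assms by (simp add: add_inverse add_commute[of "vzero V"] add_zero zero_closed)
qed

lemma sub_rev:
  assumes "x \<in> carr V" "y \<in> carr V"
  shows "sub y x = vscale V (-1) (sub x y)"
  using assms by (simp add: sub_def scale_add scale_scale scale_closed scale_one add_commute)

lemma sub_add_sub:
  assumes "x \<in> carr V" "y \<in> carr V" "z \<in> carr V"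
  shows "vadd V (sub x y) (sub y z) = sub x z"
proof -
  have "vadd V (sub x y) (sub y z)
      = vadd V x (vadd V (vscale V (-1) y) (vadd V y (vscale V (-1) z)))"
    using assms by (simp add: sub_def add_assoc scale_closed add_closed)
  also have "\<dots> = vadd V x (vadd V (vadd V y (vscale V (-1) y)) (vscale V (-1) z))"
    using assms by (metis add_assoc add_commute scale_closed)
  also have "\<dots> = sub x z"
    using assms
    by (simp add: sub_def add_inverse add_commute[of "vzero V"] add_zero zero_closed scale_closed)
  finally show ?thesis .
qed

lemma norm_sub_commute:
  "x \<in> carr V \<Longrightarrow> y \<in> carr V \<Longrightarrow> vnorm V (sub x y) = vnorm V (sub y x)"
  by (simp add: sub_rev[of x y] norm_scale sub_closed)

lemma sub_eq_zero:
  assumes "x \<in> carr V" "y \<in> carr V"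
  shows "sub x y = vzero V \<longleftrightarrow> x = y"
  by (metis add_sub_cancel add_zero add_inverse assms sub_def)

lemma norm_sub_eq_zero:
  "x \<in> carr V \<Longrightarrow> y \<in> carr V \<Longrightarrow> vnorm V (sub x y) = 0 \<longleftrightarrow> x = y"
  by (simp add: norm_eq_zero sub_closed sub_eq_zero)

lemma norm_sub_triangle:
  "x \<in> carr V \<Longrightarrow> y \<in> carr V \<Longrightarrow> z \<in> carr V \<Longrightarrow>
    vnorm V (sub x z) \<le> vnorm V (sub x y) + vnorm V (sub y z)"
  by (metis norm_triangle sub_add_sub sub_closed)

lemma norm_dist_eq: "x \<in> carr V \<Longrightarrow> y \<in> carr V \<Longrightarrow> norm_dist V x y = vnorm V (sub x y)"
  by (simp add: norm_dist_def sub_def)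

sublocale metric: Metric_space "carr V" "norm_dist V"
proof
  fix x y
  show "0 \<le> norm_dist V x y"
    by (auto simp: norm_dist_def norm_nonneg add_closed scale_closed)
  show "norm_dist V x y = norm_dist V y x"
    using norm_sub_commute[of x y] by (auto simp: norm_dist_def sub_def)
next
  fix x y assume "x \<in> carr V" "y \<in> carr V"
  then show "norm_dist V x y = 0 \<longleftrightarrow> x = y"
    by (simp add: norm_dist_eq norm_sub_eq_zero)
next
  fix x y z assume "x \<in> carr V" "y \<in> carr V" "z \<in> carr V"
  then show "norm_dist V x z \<le> norm_dist V x y + norm_dist V y z"
    by (simp add: norm_dist_eq norm_sub_triangle)
qed

definition cauchy_seq :: "(nat \<Rightarrow> 'a) \<Rightarrow> bool" where
  "cauchy_seq \<sigma> \<longleftrightarrow> range \<sigma> \<subseteq> carr V \<and>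
    (\<forall>\<epsilon>>0. \<exists>N. \<forall>m\<ge>N. \<forall>n\<ge>N. vnorm V (sub (\<sigma> m) (\<sigma> n)) < \<epsilon>)"

definition norm_lim :: "(nat \<Rightarrow> 'a) \<Rightarrow> 'a \<Rightarrow> bool" where
  "norm_lim \<sigma> l \<longleftrightarrow> l \<in> carr V \<and> (\<forall>\<epsilon>>0. \<exists>N. \<forall>n\<ge>N. vnorm V (sub (\<sigma> n) l) < \<epsilon>)"

lemma MCauchy_iff: "metric.MCauchy \<sigma> \<longleftrightarrow> cauchy_seq \<sigma>"
proof -
  have "norm_dist V (\<sigma> m) (\<sigma> n) = vnorm V (sub (\<sigma> m) (\<sigma> n))" if "range \<sigma> \<subseteq> carr V" for m n
    using that by (auto intro!: norm_dist_eq)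
  then show ?thesis
    unfolding metric.MCauchy_def cauchy_seq_def by auto
qed

lemma limitin_iff:
  assumes "range \<sigma> \<subseteq> carr V"
  shows "limitin metric.mtopology \<sigma> l sequentially \<longleftrightarrow> norm_lim \<sigma> l"
proof -
  have "\<sigma> n \<in> carr V" for n using assms by auto
  then show ?thesis
    by (auto simp: metric.limitin_metric norm_lim_def eventually_sequentially norm_dist_eq)
qed

lemma mcomplete_iff: "metric.mcomplete \<longleftrightarrow> (\<forall>\<sigma>. cauchy_seq \<sigma> \<longrightarrow> (\<exists>l. norm_lim \<sigma> l))"
  unfolding metric.mcomplete_def MCauchy_iff using limitin_iff cauchy_seq_def by metis

lemma banach_spaceI:
  assumes "\<And>\<sigma>. cauchy_seq \<sigma> \<Longrightarrow> \<exists>l. norm_lim \<sigma> l"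
  shows "banach_space V"
  using assms mcomplete_iff
  by unfold_locales
    ((rule add_assoc add_commute; assumption)
      | simp add: zero_closed add_closed scale_closed add_zero add_inverse scale_one scale_scale
        scale_add add_scale norm_nonneg norm_eq_zero norm_scale norm_triangle)+

text \<open>Fullness of an inner product is used only through this approximation by linear combinations.\<close>

lemma total_set_iff:
  "total_set V S \<longleftrightarrow>
    (\<forall>x\<in>carr V. \<forall>\<epsilon>>0. \<exists>y\<in>(lin_subspace V hull S) \<inter> carr V. vnorm V (sub x y) < \<epsilon>)"
proof -
  have "total_set V S \<longleftrightarrow> carr V \<subseteq> metric.mtopology closure_of (lin_subspace V hull S)"
    unfolding total_set_def norm_topology_def
    using closure_of_subset_topspace[of metric.mtopology] by (auto simp: metric.topspace_mtopology)
  also have "\<dots> \<longleftrightarrow> (\<forall>x\<in>carr V. \<forall>\<epsilon>>0. \<exists>y\<in>(lin_subspace V hull S) \<inter> carr V. norm_dist V x y < \<epsilon>)"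
    unfolding metric.metric_closure_of metric.mball_def by blast
  finally show ?thesis by (simp add: norm_dist_eq)
qed

end

context banach_space begin
sublocale normed: normed_cspace V
  by unfold_locales
    ((rule add_assoc add_commute; assumption)
      | simp add: zero_closed add_closed scale_closed add_zero add_inverse scale_one scale_scale
        scale_add add_scale norm_nonneg norm_eq_zero norm_scale norm_triangle)+

lemma is_normed: "normed_cspace V"
  by (rule normed.normed_cspace_axioms)

lemma cauchy_convergent: "normed.cauchy_seq \<sigma> \<Longrightarrow> \<exists>l. normed.norm_lim \<sigma> l"
  using complete normed.mcomplete_iff by blast
end

text \<open>The fibres of the linking bundle are copies of fibres of the given bundles, over the opposite
  space with the conjugate linear structure; \<open>\<kappa>\<close> is the identity or complex conjugation accordingly.\<close>

locale semilinear_isometry = V: banach_space V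
  for V :: "('a, 'm) cspace_scheme" +
  fixes W :: "('b, 'n) cspace_scheme" and \<kappa> :: "complex \<Rightarrow> complex" and \<phi> :: "'a \<Rightarrow> 'b"
  assumes kappa: "\<kappa> = id \<or> \<kappa> = cnj"
    and bij: "bij_betw \<phi> (carr V) (carr W)"
    and map_zero: "vzero W = \<phi> (vzero V)"
    and map_add: "\<lbrakk>x \<in> carr V; y \<in> carr V\<rbrakk> \<Longrightarrow> vadd W (\<phi> x) (\<phi> y) = \<phi> (vadd V x y)"
    and map_scale: "x \<in> carr V \<Longrightarrow> vscale W \<alpha> (\<phi> x) = \<phi> (vscale V (\<kappa> \<alpha>) x)"
    and map_norm: "x \<in> carr V \<Longrightarrow> vnorm W (\<phi> x) = vnorm V x"
begin

lemma kappa_simps: "\<kappa> 1 = 1" "\<kappa> (-1) = -1" "\<kappa> (\<alpha> * \<beta>) = \<kappa> \<alpha> * \<kappa> \<beta>"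
  "\<kappa> (\<alpha> + \<beta>) = \<kappa> \<alpha> + \<kappa> \<beta>" "cmod (\<kappa> \<alpha>) = cmod \<alpha>"
  using kappa by auto

lemma carr_image: "carr W = \<phi> ` carr V"
  using bij by (simp add: bij_betw_def)

lemma map_eq_iff: "x \<in> carr V \<Longrightarrow> y \<in> carr V \<Longrightarrow> \<phi> x = \<phi> y \<longleftrightarrow> x = y"
  using bij by (meson bij_betw_imp_inj_on inj_on_eq_iff)

lemma normed_image: "normed_cspace W"
proof
  fix x y z assume "x \<in> carr W" "y \<in> carr W" "z \<in> carr W"
  then show "vadd W (vadd W x y) z = vadd W x (vadd W y z)"
    by (auto simp: carr_image map_add V.add_closed V.add_assoc)
next
  fix x y assume "x \<in> carr W" "y \<in> carr W"
  then show "vadd W x y = vadd W y x"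
    by (auto simp: carr_image map_add) (metis V.add_commute)
qed (auto simp: carr_image map_zero map_add map_scale map_norm map_eq_iff kappa_simps V.zero_closed
    V.add_closed V.scale_closed V.add_zero V.add_inverse V.scale_one V.scale_scale V.scale_add
    V.add_scale V.norm_nonneg V.norm_eq_zero V.norm_scale V.norm_triangle)

interpretation W: normed_cspace W by (rule normed_image)

lemma map_sub: "x \<in> carr V \<Longrightarrow> y \<in> carr V \<Longrightarrow> W.sub (\<phi> x) (\<phi> y) = \<phi> (V.normed.sub x y)"
  by (simp add: W.sub_def V.normed.sub_def map_add map_scale kappa_simps V.scale_closed)

lemma banach_image: "banach_space W"
proof (rule W.banach_spaceI)
  fix \<sigma> assume \<sigma>: "W.cauchy_seq \<sigma>"
  then have "\<sigma> n \<in> \<phi> ` carr V" for n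
    unfolding W.cauchy_seq_def carr_image[symmetric] by blast
  then have "\<forall>n. \<exists>x. x \<in> carr V \<and> \<sigma> n = \<phi> x" by blast
  then obtain \<tau> where \<tau>: "\<And>n. \<tau> n \<in> carr V" "\<And>n. \<sigma> n = \<phi> (\<tau> n)" by metis
  have norm_eq: "vnorm W (W.sub (\<phi> x) (\<phi> y)) = vnorm V (V.normed.sub x y)"
    if "x \<in> carr V" "y \<in> carr V" for x y
    using that by (simp add: map_sub map_norm V.normed.sub_closed)
  have "V.normed.cauchy_seq \<tau>"
    using \<sigma> \<tau> by (auto simp: W.cauchy_seq_def V.normed.cauchy_seq_def norm_eq)
  then obtain l where "V.normed.norm_lim \<tau> l" using V.cauchy_convergent by blast
  then have "W.norm_lim \<sigma> (\<phi> l)"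
    using \<tau> by (auto simp: W.norm_lim_def V.normed.norm_lim_def norm_eq carr_image)
  then show "\<exists>l. W.norm_lim \<sigma> l" ..
qed

lemma total_image:
  assumes "total_set V S" "S \<subseteq> carr V"
  shows "total_set W (\<phi> ` S)"
  unfolding W.total_set_iff
proof (intro ballI allI impI)
  fix y and \<epsilon> :: real assume y: "y \<in> carr W" and \<epsilon>: "0 < \<epsilon>"
  then obtain x where x: "x \<in> carr V" "y = \<phi> x" by (auto simp: carr_image)
  obtain x' where x': "x' \<in> lin_subspace V hull S" "x' \<in> carr V"
    "vnorm V (V.normed.sub x x') < \<epsilon>"
    using assms(1) x(1) \<epsilon> unfolding V.normed.total_set_iff by blast
  \<comment> \<open>The preimage of \<open>T\<close> is a subspace that contains \<open>S\<close>, and hence \<open>x'\<close>.\<close>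
  have "\<phi> x' \<in> T" if T: "lin_subspace W T" "\<phi> ` S \<subseteq> T" for T
  proof -
    have "\<kappa> (\<kappa> \<alpha>) = \<alpha>" for \<alpha> using kappa by auto
    then have "vscale V \<alpha> x = vscale V (\<kappa> (\<kappa> \<alpha>)) x" for \<alpha> x by simp
    then have "lin_subspace V {x \<in> carr V. \<phi> x \<in> T}"
      using T(1) unfolding lin_subspace_def
      by (auto simp: V.zero_closed V.add_closed V.scale_closed map_zero map_add[symmetric])
        (metis map_scale)
    moreover have "S \<subseteq> {x \<in> carr V. \<phi> x \<in> T}" using T(2) assms(2) by auto
    ultimately show ?thesis using x'(1) by (auto simp: hull_def)
  qed
  then have "\<phi> x' \<in> lin_subspace W hull (\<phi> ` S)" by (auto simp: hull_def)
  then show "\<exists>y'\<in>(lin_subspace W hull (\<phi> ` S)) \<inter> carr W. vnorm W (W.sub y y') < \<epsilon>"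
    using x x'
    by (intro bexI[of _ "\<phi> x'"]) (simp_all add: map_sub map_norm V.normed.sub_closed carr_image)
qed

end


section \<open>Continuity on subspaces of products\<close>

text \<open>All operations of bundles and groupoids live on fibred products. Product neighbourhoods are the
  form in which their continuity can be used at a point and checked on pieces.\<close>

definition continuous_at_pair ::
    "'a topology \<Rightarrow> 'b topology \<Rightarrow> ('a \<times> 'b) set \<Rightarrow> 'c topology \<Rightarrow> ('a \<Rightarrow> 'b \<Rightarrow> 'c) \<Rightarrow> 'a \<Rightarrow> 'b \<Rightarrow> bool" where
  "continuous_at_pair X Y S Z f x y \<longleftrightarrow> f x y \<in> topspace Z \<and>
    (\<forall>W. openin Z W \<and> f x y \<in> W \<longrightarrow> (\<exists>U V. openin X U \<and> openin Y V \<and> x \<in> U \<and> y \<in> V \<and>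
      (\<forall>x'\<in>U. \<forall>y'\<in>V. (x', y') \<in> S \<longrightarrow> f x' y' \<in> W)))"

lemma continuous_at_pairD:
  assumes "continuous_at_pair X Y S Z f x y" "openin Z W" "f x y \<in> W"
  obtains U V where "openin X U" "openin Y V" "x \<in> U" "y \<in> V"
    "\<forall>x'\<in>U. \<forall>y'\<in>V. (x', y') \<in> S \<longrightarrow> f x' y' \<in> W"
  using assms unfolding continuous_at_pair_def by meson

lemma continuous_map_prod_subtopology_iff:
  "continuous_map (subtopology (prod_topology X Y) S) Z (\<lambda>(x, y). f x y) \<longleftrightarrow>
    (\<forall>x y. x \<in> topspace X \<and> y \<in> topspace Y \<and> (x, y) \<in> S \<longrightarrow> continuous_at_pair X Y S Z f x y)"
  (is "continuous_map ?T _ ?f \<longleftrightarrow> ?R")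
proof
  assume L: "continuous_map ?T Z ?f"
  show ?R
    unfolding continuous_at_pair_def
  proof (intro allI impI conjI)
    fix x y assume xy: "x \<in> topspace X \<and> y \<in> topspace Y \<and> (x, y) \<in> S"
    then show "f x y \<in> topspace Z" using funcset_mem[OF continuous_map_funspace[OF L], of "(x, y)"] by auto
    fix W assume W: "openin Z W \<and> f x y \<in> W"
    then have "openin ?T {p \<in> topspace ?T. ?f p \<in> W}"
      using L openin_continuous_map_preimage by blast
    then obtain T where T: "openin (prod_topology X Y) T" "{p \<in> topspace ?T. ?f p \<in> W} = T \<inter> S"
      by (auto simp: openin_subtopology)
    have "(x, y) \<in> {p \<in> topspace ?T. ?f p \<in> W}" using xy W by simp
    then have "(x, y) \<in> T" unfolding T(2) by blast
    then obtain U V where UV: "openin X U" "openin Y V" "x \<in> U" "y \<in> V" "U \<times> V \<subseteq> T"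
      using openin_prod_topology_alt[THEN iffD1, OF T(1)] by meson
    moreover have "f x' y' \<in> W" if "x' \<in> U" "y' \<in> V" "(x', y') \<in> S" for x' y'
    proof -
      have "(x', y') \<in> T \<inter> S" using that UV by auto
      then show ?thesis unfolding T(2)[symmetric] by simp
    qed
    ultimately show "\<exists>U V. openin X U \<and> openin Y V \<and> x \<in> U \<and> y \<in> V \<and>
        (\<forall>x'\<in>U. \<forall>y'\<in>V. (x', y') \<in> S \<longrightarrow> f x' y' \<in> W)" by blast
  qed
next
  assume R: ?R
  show "continuous_map ?T Z ?f"
    unfolding continuous_map_def
  proof (intro conjI allI impI)
    show "?f \<in> topspace ?T \<rightarrow> topspace Z" using R by (auto simp: continuous_at_pair_def)
    fix W assume W: "openin Z W"
    have "\<exists>T. openin ?T T \<and> p \<in> T \<and> T \<subseteq> {p \<in> topspace ?T. ?f p \<in> W}"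
      if p: "p \<in> {p \<in> topspace ?T. ?f p \<in> W}" for p
    proof -
      obtain x y where xy: "p = (x, y)" "x \<in> topspace X" "y \<in> topspace Y" "(x, y) \<in> S" "f x y \<in> W"
        using p by auto
      then have c: "continuous_at_pair X Y S Z f x y" using R by simp
      obtain U V where UV: "openin X U" "openin Y V" "x \<in> U" "y \<in> V"
        "\<forall>x'\<in>U. \<forall>y'\<in>V. (x', y') \<in> S \<longrightarrow> f x' y' \<in> W"
        using continuous_at_pairD[OF c W xy(5)] .
      then have "openin ?T ((U \<times> V) \<inter> S)"
        by (intro openin_subtopology_Int) (simp add: openin_prod_Times_iff)
      moreover have "(U \<times> V) \<inter> S \<subseteq> {p \<in> topspace ?T. ?f p \<in> W}"
        using UV openin_subset[OF UV(1)] openin_subset[OF UV(2)] by auto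
      ultimately show ?thesis using xy UV by blast
    qed
    then show "openin ?T {p \<in> topspace ?T. ?f p \<in> W}" using openin_subopen by blast
  qed
qed

lemma continuous_map_binary_op:
  assumes "continuous_map (subtopology (prod_topology X Y) S) Z (\<lambda>(x, y). m x y)"
    and "continuous_map T X f" "continuous_map T Y g" "\<And>t. t \<in> topspace T \<Longrightarrow> (f t, g t) \<in> S"
  shows "continuous_map T Z (\<lambda>t. m (f t) (g t))"
proof -
  have "continuous_map T (subtopology (prod_topology X Y) S) (\<lambda>t. (f t, g t))"
    using assms by (auto simp: continuous_map_in_subtopology continuous_map_pairedI)
  from continuous_map_compose[OF this assms(1)] show ?thesis by (simp add: o_def)
qed


section \<open>Upper semicontinuous Banach bundles\<close>

lemma fibre_simps [simp]:
  "carr (fibre B x) = {b \<in> topspace (btop B). bproj B b = x}"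
  "vadd (fibre B x) = badd B" "vscale (fibre B x) = bscale B"
  "vzero (fibre B x) = bzero B x" "vnorm (fibre B x) = bnorm B"
  by (simp_all add: fibre_def)

lemma fibre_algebra_simps [simp]:
  "carr (fibre_algebra B x) = {b \<in> topspace (btop B). bproj B b = x}"
  "vadd (fibre_algebra B x) = badd B" "vscale (fibre_algebra B x) = bscale B"
  "vzero (fibre_algebra B x) = bzero B x" "vnorm (fibre_algebra B x) = bnorm B"
  "amul (fibre_algebra B x) = bmul B" "astar (fibre_algebra B x) = bstar B"
  by (simp_all add: fibre_algebra_def)

context usc_banach_bundle
begin

abbreviation tot where "tot \<equiv> topspace (btop B)"

lemma proj_base: "b \<in> tot \<Longrightarrow> bproj B b \<in> topspace X"
  using proj_surj by blast

lemmas fibre_normed = banach_space.is_normed[OF fibre_banach]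

lemma zero_closed: "x \<in> topspace X \<Longrightarrow> bzero B x \<in> tot"
  and zero_proj: "x \<in> topspace X \<Longrightarrow> bproj B (bzero B x) = x"
  using normed_cspace.zero_closed[OF fibre_normed] by auto

lemma add_closed: "\<lbrakk>a \<in> tot; b \<in> tot; bproj B a = bproj B b\<rbrakk>
    \<Longrightarrow> badd B a b \<in> tot"
  and add_proj: "\<lbrakk>a \<in> tot; b \<in> tot; bproj B a = bproj B b\<rbrakk>
    \<Longrightarrow> bproj B (badd B a b) = bproj B b"
  using normed_cspace.add_closed[OF fibre_normed[OF proj_base, of b], of a b] by auto

lemma scale_closed: "a \<in> tot \<Longrightarrow> bscale B \<alpha> a \<in> tot"
  and scale_proj: "a \<in> tot \<Longrightarrow> bproj B (bscale B \<alpha> a) = bproj B a"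
  using normed_cspace.scale_closed[OF fibre_normed[OF proj_base, of a], of a] by auto

lemma add_assoc: "\<lbrakk>a \<in> tot; b \<in> tot; c \<in> tot;
    bproj B a = bproj B b; bproj B b = bproj B c\<rbrakk> \<Longrightarrow> badd B (badd B a b) c = badd B a (badd B b c)"
  using normed_cspace.add_assoc[OF fibre_normed[OF proj_base, of c], of a b c] by auto

lemma add_commute: "\<lbrakk>a \<in> tot; b \<in> tot; bproj B a = bproj B b\<rbrakk>
    \<Longrightarrow> badd B a b = badd B b a"
  using normed_cspace.add_commute[OF fibre_normed[OF proj_base, of b], of a b] by auto

lemma add_zero: "a \<in> tot \<Longrightarrow> badd B a (bzero B (bproj B a)) = a"
  using normed_cspace.add_zero[OF fibre_normed[OF proj_base, of a], of a] by auto

lemma add_inverse: "a \<in> tot \<Longrightarrow> badd B a (bscale B (-1) a) = bzero B (bproj B a)"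
  using normed_cspace.add_inverse[OF fibre_normed[OF proj_base, of a], of a] by auto

lemma scale_one: "a \<in> tot \<Longrightarrow> bscale B 1 a = a"
  using normed_cspace.scale_one[OF fibre_normed[OF proj_base, of a], of a] by auto

lemma scale_scale: "a \<in> tot \<Longrightarrow> bscale B \<alpha> (bscale B \<beta> a) = bscale B (\<alpha> * \<beta>) a"
  using normed_cspace.scale_scale[OF fibre_normed[OF proj_base, of a], of a] by auto

lemma scale_add: "\<lbrakk>a \<in> tot; b \<in> tot; bproj B a = bproj B b\<rbrakk>
    \<Longrightarrow> bscale B \<alpha> (badd B a b) = badd B (bscale B \<alpha> a) (bscale B \<alpha> b)"
  using normed_cspace.scale_add[OF fibre_normed[OF proj_base, of b], of a b] by auto

lemma add_scale: "a \<in> tot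
    \<Longrightarrow> bscale B (\<alpha> + \<beta>) a = badd B (bscale B \<alpha> a) (bscale B \<beta> a)"
  using normed_cspace.add_scale[OF fibre_normed[OF proj_base, of a], of a] by auto

lemma norm_nonneg: "a \<in> tot \<Longrightarrow> 0 \<le> bnorm B a"
  using normed_cspace.norm_nonneg[OF fibre_normed[OF proj_base, of a], of a] by auto

lemma norm_eq_zero: "a \<in> tot \<Longrightarrow> bnorm B a = 0 \<longleftrightarrow> a = bzero B (bproj B a)"
  using normed_cspace.norm_eq_zero[OF fibre_normed[OF proj_base, of a], of a] by auto

lemma norm_scale: "a \<in> tot \<Longrightarrow> bnorm B (bscale B \<alpha> a) = cmod \<alpha> * bnorm B a"
  using normed_cspace.norm_scale[OF fibre_normed[OF proj_base, of a], of a] by auto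

lemma norm_triangle: "\<lbrakk>a \<in> tot; b \<in> tot; bproj B a = bproj B b\<rbrakk>
    \<Longrightarrow> bnorm B (badd B a b) \<le> bnorm B a + bnorm B b"
  using normed_cspace.norm_triangle[OF fibre_normed[OF proj_base, of b], of a b] by auto

definition bsub :: "'b \<Rightarrow> 'b \<Rightarrow> 'b" where "bsub a b = badd B a (bscale B (-1) b)"

lemma sub_fibre: "x \<in> topspace X \<Longrightarrow> normed_cspace.sub (fibre B x) = bsub"
  by (simp add: fun_eq_iff normed_cspace.sub_def[OF fibre_normed] bsub_def)

lemma sub_closed: "\<lbrakk>a \<in> tot; b \<in> tot; bproj B a = bproj B b\<rbrakk>
    \<Longrightarrow> bsub a b \<in> tot"
  and sub_proj: "\<lbrakk>a \<in> tot; b \<in> tot; bproj B a = bproj B b\<rbrakk>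
    \<Longrightarrow> bproj B (bsub a b) = bproj B b"
  by (simp_all add: bsub_def add_closed add_proj scale_closed scale_proj)

lemma add_sub_cancel: "\<lbrakk>a \<in> tot; b \<in> tot; bproj B a = bproj B b\<rbrakk>
    \<Longrightarrow> badd B a (bsub b a) = b"
  using normed_cspace.add_sub_cancel[OF fibre_normed[OF proj_base, of b], of a b]
  by (simp add: sub_fibre proj_base)

lemma norm_sub_commute: "\<lbrakk>a \<in> tot; b \<in> tot; bproj B a = bproj B b\<rbrakk>
    \<Longrightarrow> bnorm B (bsub a b) = bnorm B (bsub b a)"
  using normed_cspace.norm_sub_commute[OF fibre_normed[OF proj_base, of b], of a b]
  by (simp add: sub_fibre proj_base)

lemma norm_sub_eq_zero: "\<lbrakk>a \<in> tot; b \<in> tot; bproj B a = bproj B b\<rbrakk>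
    \<Longrightarrow> bnorm B (bsub a b) = 0 \<longleftrightarrow> a = b"
  using normed_cspace.norm_sub_eq_zero[OF fibre_normed[OF proj_base, of b], of a b]
  by (simp add: sub_fibre proj_base)

lemma norm_sub_triangle: "\<lbrakk>a \<in> tot; b \<in> tot; c \<in> tot;
    bproj B a = bproj B b; bproj B b = bproj B c\<rbrakk>
    \<Longrightarrow> bnorm B (bsub a c) \<le> bnorm B (bsub a b) + bnorm B (bsub b c)"
  using normed_cspace.norm_sub_triangle[OF fibre_normed[OF proj_base, of c], of a b c]
  by (simp add: sub_fibre proj_base)

text \<open>The norm axiom is about filters on the total space; any function into the total space reduces
  to it by its image filter.\<close>

lemma norm_limit_along:
  assumes "\<forall>\<^sub>F i in F. f i \<in> tot" "((\<lambda>i. bnorm B (f i)) \<longlongrightarrow> 0) F"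
    and "limitin X (\<lambda>i. bproj B (f i)) x F"
  shows "limitin (btop B) f (bzero B x) F"
proof -
  have "limitin (btop B) (\<lambda>b. b) (bzero B x) (filtermap f F)"
    using assms by (intro norm_limit)
      (simp_all add: eventually_filtermap limitin_def filterlim_filtermap)
  then show ?thesis by (simp add: limitin_def eventually_filtermap)
qed

text \<open>The sets of elements of small norm over a neighbourhood of \<open>x\<close> generate a filter to which the norm
  axiom applies; so every neighbourhood of the zero over \<open>x\<close> contains such a set.\<close>

lemma zero_neighbourhood:
  assumes "x \<in> topspace X" "openin (btop B) V" "bzero B x \<in> V"
  obtains U \<epsilon> where "openin X U" "x \<in> U" "0 < \<epsilon>"
    "\<And>b. b \<in> tot \<Longrightarrow> bproj B b \<in> U \<Longrightarrow> bnorm B b < \<epsilon> \<Longrightarrow> b \<in> V"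
proof -
  define F where "F = inf (filtercomap (bproj B) (nhdsin X x))
    (inf (filtercomap (bnorm B) (nhds 0)) (principal tot))"
  have tot: "\<forall>\<^sub>F b in F. b \<in> tot"
    unfolding F_def eventually_inf_principal inf_assoc[symmetric] by simp
  have "F \<le> filtercomap (bnorm B) (nhds 0)"
    unfolding F_def by (simp add: inf.coboundedI1 inf.coboundedI2)
  then have "(bnorm B \<longlongrightarrow> 0) F"
    by (metis filterlim_def filterlim_filtercomap filtermap_mono order_trans)
  moreover have "limitin X (bproj B) x F"
    unfolding limitin_def
  proof (intro conjI allI impI)
    fix U assume "openin X U \<and> x \<in> U"
    then have "\<forall>\<^sub>F y in nhdsin X x. y \<in> U"
      unfolding eventually_nhdsin by blast
    then have "\<forall>\<^sub>F b in filtercomap (bproj B) (nhdsin X x). bproj B b \<in> U"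
      by (rule eventually_filtercomapI)
    then show "\<forall>\<^sub>F b in F. bproj B b \<in> U"
      by (rule filter_leD[of F, rotated]) (simp add: F_def)
  qed (rule assms(1))
  ultimately have "\<forall>\<^sub>F b in F. b \<in> V"
    using norm_limit[OF tot] assms(2,3) by (auto simp: limitin_def)
  then obtain P R where P: "eventually P (filtercomap (bproj B) (nhdsin X x))"
    and R: "eventually R (inf (filtercomap (bnorm B) (nhds 0)) (principal tot))"
    and PR: "\<And>b. P b \<Longrightarrow> R b \<Longrightarrow> b \<in> V"
    unfolding F_def by (blast dest: iffD1[OF eventually_inf])
  define Q where "Q b \<longleftrightarrow> (b \<in> tot \<longrightarrow> R b)" for b
  have Q: "eventually Q (filtercomap (bnorm B) (nhds 0))"
    using R by (simp add: Q_def[abs_def] eventually_inf_principal)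
  from P obtain U where U: "openin X U" "x \<in> U" "\<And>b. bproj B b \<in> U \<Longrightarrow> P b"
    unfolding eventually_filtercomap eventually_nhdsin using assms(1) by blast
  from Q obtain \<epsilon> where \<epsilon>: "0 < \<epsilon>" "\<And>b. \<bar>bnorm B b\<bar> < \<epsilon> \<Longrightarrow> Q b"
    by (auto simp: eventually_filtercomap eventually_nhds_metric dist_real_def)
  show thesis
    by (rule that[OF U(1,2) \<epsilon>(1)]) (use U \<epsilon> PR Q_def norm_nonneg in auto)
qed

lemma zero_section_continuous: "continuous_map X (btop B) (bzero B)"
  unfolding continuous_map_atin
proof (rule ballI, rule norm_limit_along)
  fix x assume "x \<in> topspace X"
  then show "limitin X (\<lambda>i. bproj B (bzero B i)) x (atin X x)"
    using limitin_continuous_map[OF continuous_map_id, of x X x]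
    by (rule_tac limitin_transform_eventually[of id])
      (auto simp: eventually_atin zero_proj)
  show "\<forall>\<^sub>F i in atin X x. bzero B i \<in> tot"
    by (auto simp: eventually_atin zero_closed)
  have "\<forall>\<^sub>F i in atin X x. bnorm B (bzero B i) = 0"
    by (auto simp: eventually_atin zero_closed zero_proj norm_eq_zero)
  then show "((\<lambda>i. bnorm B (bzero B i)) \<longlongrightarrow> 0) (atin X x)"
    by (rule tendsto_eventually)
qed

text \<open>Continuity of addition at \<open>(a, 0)\<close>, with the neighbourhood of zero expressed by the norm.\<close>

lemma add_neighbourhood:
  assumes "a \<in> tot" "openin (btop B) W" "a \<in> W"
  obtains V U \<epsilon> where "openin (btop B) V" "a \<in> V" "openin X U" "bproj B a \<in> U" "0 < \<epsilon>"
    "\<And>a' d. a' \<in> V \<Longrightarrow> d \<in> tot \<Longrightarrow> bproj B a' = bproj B d \<Longrightarrow> bproj B d \<in> U \<Longrightarrow>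
      bnorm B d < \<epsilon> \<Longrightarrow> badd B a' d \<in> W"
proof -
  let ?z = "bzero B (bproj B a)"
  have "continuous_at_pair (btop B) (btop B) {(a, b). bproj B a = bproj B b} (btop B) (badd B) a ?z"
    using add_continuous[unfolded continuous_map_prod_subtopology_iff, THEN spec, THEN spec, of a ?z]
      assms by (simp add: zero_proj proj_base zero_closed)
  then obtain V V' where V: "openin (btop B) V" "openin (btop B) V'" "a \<in> V" "?z \<in> V'"
    "\<forall>x'\<in>V. \<forall>y'\<in>V'. (x', y') \<in> {(a, b). bproj B a = bproj B b} \<longrightarrow> badd B x' y' \<in> W"
    by (rule continuous_at_pairD[OF _ assms(2)]) (use assms(1,3) in \<open>simp_all add: add_zero\<close>)
  obtain U \<epsilon> where U: "openin X U" "bproj B a \<in> U" "0 < \<epsilon>"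
    "\<And>b. b \<in> tot \<Longrightarrow> bproj B b \<in> U \<Longrightarrow> bnorm B b < \<epsilon> \<Longrightarrow> b \<in> V'"
    using zero_neighbourhood[OF proj_base[OF assms(1)] V(2,4)] by metis
  show thesis by (rule that[OF V(1,3) U(1-3)]) (use U V in auto)
qed

text \<open>Near \<open>x\<close>, the section \<open>f\<close> is the sum of a continuous section \<open>k\<close> and a section of small norm. Since
  \<open>k x\<close> need not be \<open>f x\<close>, the neighbourhoods for addition are chosen first, in two steps, and then
  \<open>k\<close> so close to \<open>f\<close> that \<open>k x\<close> lies in them.\<close>

lemma uniform_limit_section_continuous:
  assumes S: "S \<subseteq> topspace X"
    and f: "\<And>x. x \<in> S \<Longrightarrow> f x \<in> tot" "\<And>x. x \<in> S \<Longrightarrow> bproj B (f x) = x"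
    and approx: "\<And>\<epsilon>. 0 < \<epsilon> \<Longrightarrow> \<exists>k. continuous_map (subtopology X S) (btop B) k \<and>
      (\<forall>x\<in>S. bproj B (k x) = x \<and> bnorm B (bsub (f x) (k x)) < \<epsilon>)"
  shows "continuous_map (subtopology X S) (btop B) f"
proof -
  have topS: "topspace (subtopology X S) = S" using S by auto
  have "\<exists>T. openin (subtopology X S) T \<and> x \<in> T \<and> T \<subseteq> {x \<in> S. f x \<in> W}"
    if W: "openin (btop B) W" and x: "x \<in> S" "f x \<in> W" for W x
  proof -
    obtain V U \<epsilon> where 1: "openin (btop B) V" "f x \<in> V" "openin X U" "x \<in> U" "0 < \<epsilon>"
      "\<And>a d. a \<in> V \<Longrightarrow> d \<in> tot \<Longrightarrow> bproj B a = bproj B d \<Longrightarrow> bproj B d \<in> U \<Longrightarrow>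
        bnorm B d < \<epsilon> \<Longrightarrow> badd B a d \<in> W"
      using add_neighbourhood[OF f(1)[OF x(1)] W x(2)] f(2)[OF x(1)] by metis
    obtain V' U' \<delta> where 2: "openin (btop B) V'" "f x \<in> V'" "openin X U'" "x \<in> U'" "0 < \<delta>"
      "\<And>a d. a \<in> V' \<Longrightarrow> d \<in> tot \<Longrightarrow> bproj B a = bproj B d \<Longrightarrow> bproj B d \<in> U' \<Longrightarrow>
        bnorm B d < \<delta> \<Longrightarrow> badd B a d \<in> V"
      using add_neighbourhood[OF f(1)[OF x(1)] 1(1,2)] f(2)[OF x(1)] by metis
    have "0 < min \<epsilon> \<delta>" using 1 2 by simp
    then obtain k where k: "continuous_map (subtopology X S) (btop B) k"
      "\<forall>x\<in>S. bproj B (k x) = x \<and> bnorm B (bsub (f x) (k x)) < min \<epsilon> \<delta>"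
      using approx by blast
    have kt: "k y \<in> tot" if "y \<in> S" for y
      using k(1) that topS by (auto simp: continuous_map_def)
    have "badd B (f x) (bsub (k x) (f x)) \<in> V"
      using x k kt f 2 by (intro 2(6)) (auto simp: sub_closed sub_proj norm_sub_commute[of "k x"])
    then have "k x \<in> V"
      using x k kt f by (simp add: add_sub_cancel)
    define T where "T = {y \<in> S. k y \<in> V} \<inter> (U \<inter> S)"
    have "openin (subtopology X S) T"
      unfolding T_def using openin_continuous_map_preimage[OF k(1) 1(1)] openin_subtopology_Int[OF 1(3)]
      unfolding topS by (rule openin_Int)
    moreover have "T \<subseteq> {y \<in> S. f y \<in> W}"
    proof
      fix y assume y: "y \<in> T"
      then have "badd B (k y) (bsub (f y) (k y)) \<in> W"
        using k kt f 1 by (intro 1(6)) (auto simp: T_def sub_closed sub_proj)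
      then show "y \<in> {y \<in> S. f y \<in> W}"
        using y k kt f by (simp add: T_def add_sub_cancel)
    qed
    ultimately show ?thesis using \<open>k x \<in> V\<close> x 1 by (auto simp: T_def)
  qed
  then have "openin (subtopology X S) {x \<in> S. f x \<in> W}" if "openin (btop B) W" for W
    using that by (subst openin_subopen) blast
  then show ?thesis
    unfolding continuous_map_def topS using f(1) by auto
qed

end

section \<open>C*-algebras of sections\<close>

text \<open>From \<open>\<parallel>y\<parallel>\<^sup>2 = \<parallel>y\<^sup>* y\<parallel> \<le> \<parallel>y\<^sup>*\<parallel> \<parallel>y\<parallel>\<close> for \<open>y = x\<close> and for \<open>y = x\<^sup>*\<close>.\<close>

lemma (in cstar_algebra) norm_star:
  assumes "x \<in> carr A"
  shows "vnorm A (astar A x) = vnorm A x"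
proof -
  have le: "vnorm A y \<le> vnorm A (astar A y)" if y: "y \<in> carr A" for y
  proof (cases "vnorm A y = 0")
    case True
    then show ?thesis using norm_nonneg[OF star_closed[OF y]] by simp
  next
    case False
    have "vnorm A y * vnorm A y \<le> vnorm A (astar A y) * vnorm A y"
      using norm_mult[OF star_closed[OF y] y] cstar_identity[OF y] by (simp add: power2_eq_square)
    then show ?thesis using False norm_nonneg[OF y] by simp
  qed
  show ?thesis
    using le[OF assms] le[OF star_closed[OF assms]] by (simp add: star_star assms)
qed

context lch_groupoid
begin

lemma unit_closed: "u \<in> units G \<Longrightarrow> u \<in> topspace (gtop G)"
  and unit_rng: "u \<in> units G \<Longrightarrow> grng G u = u"
  and unit_src: "u \<in> units G \<Longrightarrow> gsrc G u = u"
  by (auto simp: units_def rng_closed rng_rng src_rng)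

lemma unit_mul: "u \<in> units G \<Longrightarrow> gmul G u u = u"
  using mul_rng[of u] by (simp add: unit_closed unit_rng)

lemma unit_inv:
  assumes "u \<in> units G"
  shows "ginv G u = u"
proof -
  have "gmul G (ginv G u) (gsrc G (ginv G u)) = ginv G u"
    using assms by (simp add: mul_src inv_closed unit_closed)
  then show ?thesis
    using assms inv_mul[of u] by (simp add: src_inv unit_closed unit_rng unit_src)
qed

lemma inv_unique:
  assumes "x \<in> topspace (gtop G)" "y \<in> topspace (gtop G)" "gsrc G x = grng G y"
    and "gmul G x y = grng G x"
  shows "ginv G x = y"
proof -
  have "gmul G (gmul G (ginv G x) x) y = gmul G (ginv G x) (gmul G x y)"
    using assms by (simp add: mul_assoc inv_closed src_inv)
  then have "y = gmul G (ginv G x) (gsrc G (ginv G x))"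
    using assms by (simp add: inv_mul mul_rng src_inv)
  then show ?thesis
    using assms by (simp add: mul_src inv_closed)
qed

lemma inv_of_mul:
  assumes "g \<in> topspace (gtop G)" "k \<in> topspace (gtop G)" "gsrc G g = grng G k"
  shows "ginv G (gmul G g k) = gmul G (ginv G k) (ginv G g)"
proof (rule inv_unique)
  have "gmul G (gmul G g k) (gmul G (ginv G k) (ginv G g))
      = gmul G g (gmul G (gmul G k (ginv G k)) (ginv G g))"
    using assms by (simp add: mul_assoc mul_closed inv_closed rng_inv src_inv rng_mul src_mul)
  also have "gmul G k (ginv G k) = grng G (ginv G g)"
    using assms by (simp add: mul_inv rng_inv)
  finally show "gmul G (gmul G g k) (gmul G (ginv G k) (ginv G g)) = grng G (gmul G g k)"
    using assms by (simp add: mul_rng mul_inv inv_closed rng_mul)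
qed (use assms in \<open>simp_all add: mul_closed inv_closed rng_inv src_inv rng_mul src_mul\<close>)

lemma rng_unit: "g \<in> topspace (gtop G) \<Longrightarrow> grng G g \<in> units G"
  by (simp add: units_def)

lemma src_unit: "g \<in> topspace (gtop G) \<Longrightarrow> gsrc G g \<in> units G"
  using rng_unit[OF src_closed, of g] by (simp add: rng_src)

lemma units_subset: "units G \<subseteq> topspace (gtop G)"
  using unit_closed by blast

lemma topspace_unit_space: "topspace (unit_space G) = units G"
  using units_subset by (auto simp: unit_space_def)

end

lemma section_algebra_simps [simp]:
  "vadd (section_algebra G B) f k = (\<lambda>u\<in>units G. badd B (f u) (k u))"
  "vscale (section_algebra G B) \<alpha> f = (\<lambda>u\<in>units G. bscale B \<alpha> (f u))"
  "vzero (section_algebra G B) = (\<lambda>u\<in>units G. bzero B u)"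
  "amul (section_algebra G B) f k = (\<lambda>u\<in>units G. bmul B (f u) (k u))"
  "astar (section_algebra G B) f = (\<lambda>u\<in>units G. bstar B (f u))"
  by (simp_all add: section_algebra_def)

context fell_bundle
begin

abbreviation \<Gamma> where "\<Gamma> \<equiv> section_algebra G B"

lemma section_carr:
  "f \<in> carr \<Gamma> \<longleftrightarrow> f \<in> extensional (units G) \<and> continuous_map (unit_space G) (btop B) f \<and>
    (\<forall>u\<in>units G. bproj B (f u) = u) \<and>
    (\<forall>\<epsilon>>0. compactin (unit_space G) {u \<in> units G. \<epsilon> \<le> bnorm B (f u)})"
  by (simp add: section_algebra_def)

lemma section_closed: "f \<in> carr \<Gamma> \<Longrightarrow> u \<in> units G \<Longrightarrow> f u \<in> tot"
  and section_proj: "f \<in> carr \<Gamma> \<Longrightarrow> u \<in> units G \<Longrightarrow> bproj B (f u) = u"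
  by (auto simp: section_carr continuous_map_def topspace_unit_space)

lemma section_continuous: "f \<in> carr \<Gamma> \<Longrightarrow> continuous_map (unit_space G) (btop B) f"
  by (simp add: section_carr)

lemma section_eqI:
  "\<lbrakk>f \<in> carr \<Gamma>; k \<in> carr \<Gamma>; \<And>u. u \<in> units G \<Longrightarrow> f u = k u\<rbrakk> \<Longrightarrow> f = k"
  by (rule extensionalityI[of _ "units G"]) (auto simp: section_carr)

lemma section_vanish:
  assumes "f \<in> carr \<Gamma>" "0 < \<epsilon>"
  obtains K where "compactin (unit_space G) K" "\<And>u. u \<in> units G - K \<Longrightarrow> bnorm B (f u) < \<epsilon>"
  by (rule that[of "{u \<in> units G. \<epsilon> \<le> bnorm B (f u)}"]) (use assms in \<open>auto simp: section_carr\<close>)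

lemma small_norm_open:
  assumes "continuous_map (unit_space G) (btop B) f"
  shows "openin (unit_space G) {u \<in> units G. bnorm B (f u) < \<epsilon>}"
proof -
  have "{u \<in> units G. bnorm B (f u) < \<epsilon>}
      = {u \<in> topspace (unit_space G). f u \<in> {b \<in> tot. bnorm B b < \<epsilon>}}"
    using assms by (auto simp: topspace_unit_space continuous_map_def)
  then show ?thesis
    using openin_continuous_map_preimage[OF assms norm_usc] by simp
qed

text \<open>Upper semicontinuity of the norm makes the sets in the definition of vanishing at infinity
  closed, so that it suffices to find a compact set containing them.\<close>

lemma sectionI:
  assumes cont: "continuous_map (unit_space G) (btop B) f"
    and proj: "\<And>u. u \<in> units G \<Longrightarrow> bproj B (f u) = u"
    and vanish: "\<And>\<epsilon>. 0 < \<epsilon> \<Longrightarrow>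
      \<exists>K. compactin (unit_space G) K \<and> (\<forall>u\<in>units G - K. bnorm B (f u) < \<epsilon>)"
  shows "restrict f (units G) \<in> carr \<Gamma>"
  unfolding section_carr
proof (intro conjI ballI allI impI)
  show "continuous_map (unit_space G) (btop B) (restrict f (units G))"
    by (rule continuous_map_eq[OF cont]) (simp add: topspace_unit_space)
  fix \<epsilon> :: real assume \<epsilon>: "0 < \<epsilon>"
  obtain K where K: "compactin (unit_space G) K" "\<forall>u\<in>units G - K. bnorm B (f u) < \<epsilon>"
    using vanish[OF \<epsilon>] by blast
  let ?C = "{u \<in> units G. \<epsilon> \<le> bnorm B (restrict f (units G) u)}"
  have "closedin (unit_space G) (topspace (unit_space G) - {u \<in> units G. bnorm B (f u) < \<epsilon>})"
    using small_norm_open[OF cont] by blast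
  moreover have "topspace (unit_space G) - {u \<in> units G. bnorm B (f u) < \<epsilon>} = ?C"
    by (auto simp: topspace_unit_space)
  moreover have "?C \<subseteq> K"
  proof
    fix u assume "u \<in> ?C"
    then show "u \<in> K" using K(2)[THEN bspec, of u] by (cases "u \<in> K") auto
  qed
  ultimately show "compactin (unit_space G) ?C"
    using closed_compactin[OF K(1)] by simp
qed (simp_all add: proj)

text \<open>A section is small off a compact set, and on that set the increasing open sets where its norm is
  below \<open>n\<close> form a cover.\<close>

lemma section_bounded:
  assumes f: "f \<in> carr \<Gamma>"
  obtains M where "0 < M" "\<And>u. u \<in> units G \<Longrightarrow> bnorm B (f u) \<le> M"
proof -
  obtain K where K: "compactin (unit_space G) K" "\<And>u. u \<in> units G - K \<Longrightarrow> bnorm B (f u) < 1"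
    using section_vanish[OF f zero_less_one] by blast
  let ?O = "\<lambda>n. {u \<in> units G. bnorm B (f u) < real n}"
  have "K \<subseteq> \<Union> (range ?O)"
  proof
    fix u assume "u \<in> K"
    then have "u \<in> units G" using K(1) compactin_subset_topspace topspace_unit_space by fastforce
    then show "u \<in> \<Union> (range ?O)" using reals_Archimedean2[of "bnorm B (f u)"] by auto
  qed
  then obtain \<F> where \<F>: "finite \<F>" "\<F> \<subseteq> range ?O" "K \<subseteq> \<Union> \<F>"
    using compactinD[OF K(1), of "range ?O"] small_norm_open[OF section_continuous[OF f]] by blast
  then obtain N where N: "finite N" "\<F> = ?O ` N" by (meson finite_subset_image)
  then obtain m where m: "\<And>n. n \<in> N \<Longrightarrow> n \<le> m" by (auto simp: finite_nat_set_iff_bounded_le)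
  have "bnorm B (f u) \<le> real m + 1" if u: "u \<in> units G" for u
  proof (cases "u \<in> K")
    case True
    then obtain n where "n \<in> N" "bnorm B (f u) < real n" using \<F>(3) N(2) by blast
    then show ?thesis using m[of n] by simp
  qed (use K(2)[of u] u in force)
  then show thesis by (intro that[of "real m + 1"]) auto
qed

lemma section_norm_bdd:
  assumes "f \<in> carr \<Gamma>"
  shows "bdd_above (insert 0 ((\<lambda>u. bnorm B (f u)) ` units G))"
proof -
  obtain M where "0 < M" "\<And>u. u \<in> units G \<Longrightarrow> bnorm B (f u) \<le> M"
    using section_bounded[OF assms] by blast
  then show ?thesis by (intro bdd_aboveI[of _ M]) auto
qed

lemma section_norm_ge: "f \<in> carr \<Gamma> \<Longrightarrow> u \<in> units G \<Longrightarrow> bnorm B (f u) \<le> vnorm \<Gamma> f"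
  using section_norm_bdd by (auto simp: section_algebra_def intro!: cSup_upper)

lemma section_norm_nonneg: "f \<in> carr \<Gamma> \<Longrightarrow> 0 \<le> vnorm \<Gamma> f"
  using section_norm_bdd by (auto simp: section_algebra_def intro!: cSup_upper)

lemma section_norm_le:
  "0 \<le> c \<Longrightarrow> (\<And>u. u \<in> units G \<Longrightarrow> bnorm B (f u) \<le> c) \<Longrightarrow> vnorm \<Gamma> f \<le> c"
  by (auto simp: section_algebra_def intro!: cSup_least)

lemma unit_norm_mult:
  "\<lbrakk>a \<in> tot; b \<in> tot; bproj B a = u; bproj B b = u; u \<in> units G\<rbrakk>
    \<Longrightarrow> bnorm B (bmul B a b) \<le> bnorm B a * bnorm B b"
  using cstar_algebra.norm_mult[OF unit_fibre_cstar, of u a b] by simp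

lemma unit_norm_star:
  "\<lbrakk>a \<in> tot; bproj B a \<in> units G\<rbrakk> \<Longrightarrow> bnorm B (bstar B a) = bnorm B a"
  using cstar_algebra.norm_star[OF unit_fibre_cstar, of "bproj B a" a] by simp

lemma unit_cstar_identity:
  "\<lbrakk>a \<in> tot; bproj B a \<in> units G\<rbrakk> \<Longrightarrow> bnorm B (bmul B (bstar B a) a) = (bnorm B a)\<^sup>2"
  using cstar_algebra.cstar_identity[OF unit_fibre_cstar, of "bproj B a" a] by simp

lemma unit_mult_proj:
  "\<lbrakk>a \<in> tot; b \<in> tot; bproj B a = u; bproj B b = u; u \<in> units G\<rbrakk>
    \<Longrightarrow> bproj B (bmul B a b) = u"
  by (simp add: mult_proj unit_rng unit_src unit_mul)

lemma section_zero_closed: "vzero \<Gamma> \<in> carr \<Gamma>"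
proof -
  have "continuous_map (unit_space G) (btop B) (bzero B)"
    unfolding unit_space_def by (rule continuous_map_from_subtopology[OF zero_section_continuous])
  then show ?thesis
    unfolding section_algebra_simps
    by (rule sectionI)
      (auto simp: zero_proj unit_closed zero_closed norm_eq_zero
        intro!: exI[of _ "{}"] iffD2[OF norm_eq_zero, THEN eq_refl, THEN le_less_trans])
qed

text \<open>Each algebraic operation is bounded in norm by a multiple of sections that vanish at infinity.\<close>

lemma section_dominated:
  assumes cont: "continuous_map (unit_space G) (btop B) f"
    and proj: "\<And>u. u \<in> units G \<Longrightarrow> bproj B (f u) = u"
    and k: "k \<in> carr \<Gamma>" and l: "l \<in> carr \<Gamma>" and M: "0 < M"
    and bound: "\<And>u. u \<in> units G \<Longrightarrow> bnorm B (f u) \<le> M * (bnorm B (k u) + bnorm B (l u))"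
  shows "restrict f (units G) \<in> carr \<Gamma>"
proof (rule sectionI[OF cont proj])
  fix \<epsilon> :: real assume "0 < \<epsilon>"
  then have \<epsilon>: "0 < \<epsilon> / M / 2" using M by simp
  obtain K where K: "compactin (unit_space G) K" "\<And>u. u \<in> units G - K \<Longrightarrow> bnorm B (k u) < \<epsilon> / M / 2"
    using section_vanish[OF k \<epsilon>] by blast
  obtain K' where K': "compactin (unit_space G) K'" "\<And>u. u \<in> units G - K' \<Longrightarrow> bnorm B (l u) < \<epsilon> / M / 2"
    using section_vanish[OF l \<epsilon>] by blast
  have "bnorm B (f u) < \<epsilon>" if u: "u \<in> units G - (K \<union> K')" for u
  proof -
    have "bnorm B (k u) + bnorm B (l u) < \<epsilon> / M" using K(2)[of u] K'(2)[of u] u by simp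
    then have "M * (bnorm B (k u) + bnorm B (l u)) < \<epsilon>"
      using M by (simp add: pos_less_divide_eq mult.commute)
    then show ?thesis using bound[of u] u by simp
  qed
  then show "\<exists>K. compactin (unit_space G) K \<and> (\<forall>u\<in>units G - K. bnorm B (f u) < \<epsilon>)"
    using compactin_Un[OF K(1) K'(1)] by blast
qed

lemma section_add_closed:
  assumes f: "f \<in> carr \<Gamma>" and k: "k \<in> carr \<Gamma>"
  shows "vadd \<Gamma> f k \<in> carr \<Gamma>"
  unfolding section_algebra_simps
proof (rule section_dominated[OF _ _ f k zero_less_one])
  show "continuous_map (unit_space G) (btop B) (\<lambda>u. badd B (f u) (k u))"
    by (rule continuous_map_binary_op[OF add_continuous section_continuous[OF f]
          section_continuous[OF k]]) (simp add: section_proj f k topspace_unit_space)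
qed (simp_all add: section_proj section_closed f k add_proj norm_triangle)

lemma section_scale_closed:
  assumes f: "f \<in> carr \<Gamma>"
  shows "vscale \<Gamma> \<alpha> f \<in> carr \<Gamma>"
  unfolding section_algebra_simps
proof (rule section_dominated[OF _ _ f f, of _ "cmod \<alpha> + 1"])
  have "continuous_map (unit_space G) (prod_topology euclidean (btop B)) (\<lambda>u. (\<alpha>, f u))"
    using section_continuous[OF f] by (intro continuous_map_pairedI) auto
  from continuous_map_compose[OF this scale_continuous]
  show "continuous_map (unit_space G) (btop B) (\<lambda>u. bscale B \<alpha> (f u))" by (simp add: o_def)
  show "bnorm B (bscale B \<alpha> (f u)) \<le> (cmod \<alpha> + 1) * (bnorm B (f u) + bnorm B (f u))"
    if "u \<in> units G" for u
    using that norm_nonneg[OF section_closed[OF f that]]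
    by (simp add: norm_scale section_closed f mult_mono)
qed (simp_all add: section_proj section_closed f scale_proj add_nonneg_pos)

lemma section_mult_closed:
  assumes f: "f \<in> carr \<Gamma>" and k: "k \<in> carr \<Gamma>"
  shows "amul \<Gamma> f k \<in> carr \<Gamma>"
proof -
  obtain M where M: "0 < M" "\<And>u. u \<in> units G \<Longrightarrow> bnorm B (f u) \<le> M"
    using section_bounded[OF f] by blast
  show ?thesis
    unfolding section_algebra_simps
  proof (rule section_dominated[OF _ _ k k M(1)])
    show "continuous_map (unit_space G) (btop B) (\<lambda>u. bmul B (f u) (k u))"
      by (rule continuous_map_binary_op[OF mult_continuous section_continuous[OF f]
            section_continuous[OF k]])
        (simp add: section_proj f k topspace_unit_space unit_rng unit_src)
    fix u assume u: "u \<in> units G"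
    then have "bnorm B (bmul B (f u) (k u)) \<le> bnorm B (f u) * bnorm B (k u)"
      by (simp add: unit_norm_mult[of _ _ u] section_closed section_proj f k)
    also have "\<dots> \<le> M * (bnorm B (k u) + bnorm B (k u))"
      using u M norm_nonneg section_closed[OF f] section_closed[OF k] by (intro mult_mono) auto
    finally show "bnorm B (bmul B (f u) (k u)) \<le> M * (bnorm B (k u) + bnorm B (k u))" .
  qed (simp add: section_proj section_closed f k unit_mult_proj)
qed

lemma section_star_closed:
  assumes f: "f \<in> carr \<Gamma>"
  shows "astar \<Gamma> f \<in> carr \<Gamma>"
  unfolding section_algebra_simps
proof (rule section_dominated[OF _ _ f f zero_less_one])
  show "continuous_map (unit_space G) (btop B) (\<lambda>u. bstar B (f u))"
    using continuous_map_compose[OF section_continuous[OF f] star_continuous] by (simp add: o_def)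
qed (simp_all add: section_proj section_closed f star_proj unit_inv unit_norm_star norm_nonneg)

lemma section_norm_eq_zero:
  assumes f: "f \<in> carr \<Gamma>"
  shows "vnorm \<Gamma> f = 0 \<longleftrightarrow> f = vzero \<Gamma>"
proof
  assume "vnorm \<Gamma> f = 0"
  then have "bnorm B (f u) = 0" if "u \<in> units G" for u
    using section_norm_ge[OF f that] norm_nonneg[OF section_closed[OF f that]] by simp
  then have "f u = bzero B u" if "u \<in> units G" for u
    using that f norm_eq_zero[of "f u"] by (simp add: section_closed section_proj)
  then show "f = vzero \<Gamma>"
    by (intro section_eqI[OF f section_zero_closed]) simp
next
  assume "f = vzero \<Gamma>"
  then have "vnorm \<Gamma> f \<le> 0"
    by (intro section_norm_le)
      (auto simp: zero_closed zero_proj unit_closed intro!: eq_refl iffD2[OF norm_eq_zero])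
  then show "vnorm \<Gamma> f = 0" using section_norm_nonneg[OF f] by simp
qed

lemma section_norm_scale:
  assumes f: "f \<in> carr \<Gamma>"
  shows "vnorm \<Gamma> (vscale \<Gamma> \<alpha> f) = cmod \<alpha> * vnorm \<Gamma> f"
proof (rule antisym)
  have le: "vnorm \<Gamma> (vscale \<Gamma> \<beta> k) \<le> cmod \<beta> * vnorm \<Gamma> k" if k: "k \<in> carr \<Gamma>" for \<beta> k
    using section_norm_nonneg[OF k] section_norm_ge[OF k]
    by (intro section_norm_le) (auto simp: norm_scale section_closed k intro: mult_left_mono)
  then show "vnorm \<Gamma> (vscale \<Gamma> \<alpha> f) \<le> cmod \<alpha> * vnorm \<Gamma> f" using f by blast
  show "cmod \<alpha> * vnorm \<Gamma> f \<le> vnorm \<Gamma> (vscale \<Gamma> \<alpha> f)"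
  proof (cases "\<alpha> = 0")
    case True
    then show ?thesis using section_norm_nonneg[OF section_scale_closed[OF f]] by simp
  next
    \<comment> \<open>Scaling back by the inverse turns the first inequality into the second.\<close>
    case False
    have "vscale \<Gamma> (inverse \<alpha>) (vscale \<Gamma> \<alpha> f) = f"
      using False f
      by (intro section_eqI section_scale_closed)
        (simp_all add: section_scale_closed[simplified] scale_scale scale_one section_closed)
    then have "vnorm \<Gamma> f \<le> inverse (cmod \<alpha>) * vnorm \<Gamma> (vscale \<Gamma> \<alpha> f)"
      using le[OF section_scale_closed[OF f], of "inverse \<alpha>" \<alpha>] by (simp add: norm_inverse)
    then show ?thesis using False by (simp add: field_simps)
  qed
qed

lemma section_norm_triangle:
  assumes f: "f \<in> carr \<Gamma>" and k: "k \<in> carr \<Gamma>"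
  shows "vnorm \<Gamma> (vadd \<Gamma> f k) \<le> vnorm \<Gamma> f + vnorm \<Gamma> k"
proof (rule section_norm_le)
  fix u assume u: "u \<in> units G"
  then show "bnorm B (vadd \<Gamma> f k u) \<le> vnorm \<Gamma> f + vnorm \<Gamma> k"
    using norm_triangle[of "f u" "k u"] section_norm_ge[OF f u] section_norm_ge[OF k u]
    by (simp add: section_closed section_proj f k)
qed (simp add: section_norm_nonneg f k)

lemma section_normed: "normed_cspace \<Gamma>"
proof
  fix f k l assume "f \<in> carr \<Gamma>" "k \<in> carr \<Gamma>" "l \<in> carr \<Gamma>"
  then show "vadd \<Gamma> (vadd \<Gamma> f k) l = vadd \<Gamma> f (vadd \<Gamma> k l)"
    by (auto simp: fun_eq_iff restrict_def section_closed section_proj add_assoc)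
next
  fix f k assume "f \<in> carr \<Gamma>" "k \<in> carr \<Gamma>"
  then show "vadd \<Gamma> f k = vadd \<Gamma> k f"
    by (auto simp: fun_eq_iff restrict_def section_closed section_proj intro!: add_commute)
next
  fix f assume f: "f \<in> carr \<Gamma>"
  have "badd B (f u) (bzero B u) = f u" if "u \<in> units G" for u
    using add_zero[of "f u"] that by (simp add: section_closed section_proj f)
  then show "vadd \<Gamma> f (vzero \<Gamma>) = f"
    by (intro section_eqI section_add_closed section_zero_closed f) simp
  show "vscale \<Gamma> 1 f = f"
    by (intro section_eqI section_scale_closed f) (simp add: scale_one section_closed f)
qed ((rule section_zero_closed section_add_closed section_scale_closed section_norm_nonneg
      section_norm_eq_zero section_norm_scale section_norm_triangle; assumption)
    | (auto simp: fun_eq_iff restrict_def section_closed section_proj add_inverse scale_scale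
        scale_add add_scale)[1])+

text \<open>A Cauchy sequence of sections converges in every fibre, uniformly over the unit space. The limit is
  continuous because it is approximated uniformly by continuous sections.\<close>

lemma section_complete:
  assumes "normed_cspace.cauchy_seq \<Gamma> \<sigma>"
  shows "\<exists>l. normed_cspace.norm_lim \<Gamma> \<sigma> l"
proof -
  interpret S: normed_cspace \<Gamma> by (rule section_normed)
  have \<sigma>: "\<sigma> n \<in> carr \<Gamma>" for n using assms by (auto simp: S.cauchy_seq_def)
  have diff: "bnorm B (bsub (f u) (k u)) \<le> vnorm \<Gamma> (S.sub f k)"
    if "f \<in> carr \<Gamma>" "k \<in> carr \<Gamma>" "u \<in> units G" for f k u
    using section_norm_ge[OF S.sub_closed[OF that(1,2)] that(3)] that(3)
    by (simp add: S.sub_def bsub_def)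
  have "\<exists>l. l \<in> tot \<and> bproj B l = u \<and>
      (\<forall>\<epsilon>>0. \<exists>N. \<forall>n\<ge>N. bnorm B (bsub (\<sigma> n u) l) < \<epsilon>)" if u: "u \<in> units G" for u
  proof -
    interpret F: banach_space "fibre B u" using fibre_banach[OF unit_closed[OF u]] .
    have sub: "F.normed.sub = bsub" by (rule sub_fibre[OF unit_closed[OF u]])
    have "F.normed.cauchy_seq (\<lambda>n. \<sigma> n u)"
      unfolding F.normed.cauchy_seq_def sub
    proof (intro conjI allI impI)
      show "range (\<lambda>n. \<sigma> n u) \<subseteq> carr (fibre B u)"
        using u \<sigma> by (auto simp: section_closed section_proj)
      fix \<epsilon> :: real assume "0 < \<epsilon>"
      then obtain N where "\<forall>m\<ge>N. \<forall>n\<ge>N. vnorm \<Gamma> (S.sub (\<sigma> m) (\<sigma> n)) < \<epsilon>"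
        using assms by (auto simp: S.cauchy_seq_def)
      then show "\<exists>N. \<forall>m\<ge>N. \<forall>n\<ge>N. vnorm (fibre B u) (bsub (\<sigma> m u) (\<sigma> n u)) < \<epsilon>"
        using diff[OF \<sigma> \<sigma> u] by (intro exI[of _ N]) (simp, meson le_less_trans)
    qed
    then obtain l where "F.normed.norm_lim (\<lambda>n. \<sigma> n u) l" using F.cauchy_convergent by blast
    then show ?thesis by (auto simp: F.normed.norm_lim_def sub)
  qed
  then obtain l where l: "\<And>u. u \<in> units G \<Longrightarrow> l u \<in> tot"
    "\<And>u. u \<in> units G \<Longrightarrow> bproj B (l u) = u"
    "\<And>u \<epsilon>. u \<in> units G \<Longrightarrow> 0 < \<epsilon> \<Longrightarrow> \<exists>N. \<forall>n\<ge>N. bnorm B (bsub (\<sigma> n u) (l u)) < \<epsilon>"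
    by metis
  have unif: "\<exists>N. \<forall>n\<ge>N. \<forall>u\<in>units G. bnorm B (bsub (\<sigma> n u) (l u)) < \<epsilon>" if \<epsilon>: "0 < \<epsilon>" for \<epsilon>
  proof -
    have "0 < \<epsilon> / 2" using \<epsilon> by simp
    then obtain N where N: "\<forall>m\<ge>N. \<forall>n\<ge>N. vnorm \<Gamma> (S.sub (\<sigma> m) (\<sigma> n)) < \<epsilon> / 2"
      using assms unfolding S.cauchy_seq_def by blast
    have "bnorm B (bsub (\<sigma> n u) (l u)) \<le> \<epsilon> / 2" if n: "n \<ge> N" and u: "u \<in> units G" for n u
    proof (rule field_le_epsilon)
      fix \<delta> :: real assume "0 < \<delta>"
      then obtain N' where N': "\<forall>m\<ge>N'. bnorm B (bsub (\<sigma> m u) (l u)) < \<delta>" using l(3)[OF u] by blast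
      let ?m = "max N N'"
      have "bnorm B (bsub (\<sigma> n u) (l u))
          \<le> bnorm B (bsub (\<sigma> n u) (\<sigma> ?m u)) + bnorm B (bsub (\<sigma> ?m u) (l u))"
        using u by (intro norm_sub_triangle) (simp_all add: section_closed section_proj \<sigma> l)
      also have "\<dots> \<le> \<epsilon> / 2 + \<delta>"
      proof (rule add_mono)
        have "vnorm \<Gamma> (S.sub (\<sigma> n) (\<sigma> ?m)) < \<epsilon> / 2" using N n by simp
        then show "bnorm B (bsub (\<sigma> n u) (\<sigma> ?m u)) \<le> \<epsilon> / 2" using diff[OF \<sigma> \<sigma> u, of n ?m] by simp
        show "bnorm B (bsub (\<sigma> ?m u) (l u)) \<le> \<delta>" using N' by (simp add: less_imp_le)
      qed
      finally show "bnorm B (bsub (\<sigma> n u) (l u)) \<le> \<epsilon> / 2 + \<delta>" .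
    qed
    moreover have "\<epsilon> / 2 < \<epsilon>" using \<epsilon> by simp
    ultimately show ?thesis using le_less_trans by blast
  qed
  have lc: "restrict l (units G) \<in> carr \<Gamma>"
  proof (rule sectionI)
    show "continuous_map (unit_space G) (btop B) l"
      unfolding unit_space_def
    proof (rule uniform_limit_section_continuous)
      fix \<epsilon> :: real assume "0 < \<epsilon>"
      then obtain N where "\<forall>u\<in>units G. bnorm B (bsub (\<sigma> N u) (l u)) < \<epsilon>" using unif by blast
      then show "\<exists>k. continuous_map (subtopology (gtop G) (units G)) (btop B) k \<and>
          (\<forall>u\<in>units G. bproj B (k u) = u \<and> bnorm B (bsub (l u) (k u)) < \<epsilon>)"
        using section_continuous[OF \<sigma>, of N] \<sigma>[of N]
        by (intro exI[of _ "\<sigma> N"])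
          (auto simp: unit_space_def section_proj section_closed l norm_sub_commute[of "l _"])
    qed (simp_all add: l units_subset)
    fix \<epsilon> :: real assume "0 < \<epsilon>"
    then have \<epsilon>: "0 < \<epsilon> / 2" by simp
    obtain N where N: "\<forall>u\<in>units G. bnorm B (bsub (\<sigma> N u) (l u)) < \<epsilon> / 2" using unif[OF \<epsilon>] by blast
    obtain K where K: "compactin (unit_space G) K"
      "\<And>u. u \<in> units G - K \<Longrightarrow> bnorm B (\<sigma> N u) < \<epsilon> / 2"
      using section_vanish[OF \<sigma> \<epsilon>] by blast
    have "bnorm B (l u) < \<epsilon>" if u: "u \<in> units G - K" for u
    proof -
      have "bnorm B (l u) = bnorm B (badd B (\<sigma> N u) (bsub (l u) (\<sigma> N u)))"
        using u by (simp add: add_sub_cancel section_closed section_proj \<sigma> l)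
      also have "\<dots> \<le> bnorm B (\<sigma> N u) + bnorm B (bsub (l u) (\<sigma> N u))"
        using u by (intro norm_triangle) (simp_all add: sub_closed sub_proj section_closed section_proj \<sigma> l)
      also have "\<dots> < \<epsilon>"
        using u K(2)[OF u] N norm_sub_commute[of "l u" "\<sigma> N u"]
        by (force simp: section_closed section_proj \<sigma> l)
      finally show ?thesis .
    qed
    then show "\<exists>K. compactin (unit_space G) K \<and> (\<forall>u\<in>units G - K. bnorm B (l u) < \<epsilon>)"
      using K(1) by blast
  qed (simp add: l)
  have "S.norm_lim \<sigma> (restrict l (units G))"
    unfolding S.norm_lim_def
  proof (intro conjI allI impI lc)
    fix \<epsilon> :: real assume \<epsilon>: "0 < \<epsilon>"
    obtain N where N: "\<forall>n\<ge>N. \<forall>u\<in>units G. bnorm B (bsub (\<sigma> n u) (l u)) < \<epsilon> / 2"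
      using unif[of "\<epsilon> / 2"] \<epsilon> by auto
    have "vnorm \<Gamma> (S.sub (\<sigma> n) (restrict l (units G))) \<le> \<epsilon> / 2" if "n \<ge> N" for n
      using N that \<epsilon> by (intro section_norm_le) (auto simp: S.sub_def bsub_def intro: less_imp_le)
    then show "\<exists>N. \<forall>n\<ge>N. vnorm \<Gamma> (S.sub (\<sigma> n) (restrict l (units G))) < \<epsilon>"
      using \<epsilon> by (intro exI[of _ N]) fastforce
  qed
  then show ?thesis by blast
qed

lemma section_cstar_identity:
  assumes f: "f \<in> carr \<Gamma>"
  shows "vnorm \<Gamma> (amul \<Gamma> (astar \<Gamma> f) f) = (vnorm \<Gamma> f)\<^sup>2"
proof (rule antisym)
  let ?p = "amul \<Gamma> (astar \<Gamma> f) f"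
  have p: "?p \<in> carr \<Gamma>" by (intro section_mult_closed section_star_closed f)
  have pu: "bnorm B (?p u) = (bnorm B (f u))\<^sup>2" if "u \<in> units G" for u
    using that f by (simp add: unit_cstar_identity section_closed section_proj)
  show "vnorm \<Gamma> ?p \<le> (vnorm \<Gamma> f)\<^sup>2"
    using section_norm_ge[OF f] norm_nonneg section_closed[OF f]
    by (intro section_norm_le) (simp_all only: pu zero_le_power2 power_mono)
  have "bnorm B (f u) \<le> sqrt (vnorm \<Gamma> ?p)" if "u \<in> units G" for u
    using section_norm_ge[OF p that] unfolding pu[OF that] by (rule real_le_rsqrt)
  then have "vnorm \<Gamma> f \<le> sqrt (vnorm \<Gamma> ?p)"
    by (intro section_norm_le real_sqrt_ge_zero section_norm_nonneg p)
  then have "(vnorm \<Gamma> f)\<^sup>2 \<le> (sqrt (vnorm \<Gamma> ?p))\<^sup>2"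
    by (intro power_mono section_norm_nonneg f)
  then show "(vnorm \<Gamma> f)\<^sup>2 \<le> vnorm \<Gamma> ?p"
    using section_norm_nonneg[OF p] by (simp only: real_sqrt_pow2)
qed

theorem section_algebra_cstar: "cstar_algebra \<Gamma>"
proof -
  have banach: "banach_space \<Gamma>"
    using normed_cspace.banach_spaceI[OF section_normed] section_complete by blast
  show ?thesis
  proof (intro cstar_algebra.intro banach cstar_algebra_axioms.intro)
    fix f k assume f: "f \<in> carr \<Gamma>" and k: "k \<in> carr \<Gamma>"
    show "vnorm \<Gamma> (amul \<Gamma> f k) \<le> vnorm \<Gamma> f * vnorm \<Gamma> k"
    proof (rule section_norm_le)
      fix u assume u: "u \<in> units G"
      have "bnorm B (bmul B (f u) (k u)) \<le> bnorm B (f u) * bnorm B (k u)"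
        using u by (simp add: unit_norm_mult[of _ _ u] section_closed section_proj f k)
      also have "\<dots> \<le> vnorm \<Gamma> f * vnorm \<Gamma> k"
        using u f k by (intro mult_mono section_norm_ge section_norm_nonneg norm_nonneg section_closed)
      finally show "bnorm B (amul \<Gamma> f k u) \<le> vnorm \<Gamma> f * vnorm \<Gamma> k" using u by simp
    qed (simp add: section_norm_nonneg f k)
  next
    fix f assume f: "f \<in> carr \<Gamma>"
    show "astar \<Gamma> (astar \<Gamma> f) = f"
      by (intro section_eqI section_star_closed f) (simp add: star_star section_closed f)
  qed ((rule section_mult_closed section_star_closed section_cstar_identity; assumption)
      | (auto simp: fun_eq_iff restrict_def section_closed section_proj unit_rng unit_src mult_assoc
        mult_add_left mult_add_right mult_scale_left mult_scale_right star_add star_scale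
        star_mult)[1])+
qed

end

lemma cstar_sum_simps [simp]:
  "carr (cstar_sum A D) = carr A \<times> carr D"
  "vadd (cstar_sum A D) p q = (vadd A (fst p) (fst q), vadd D (snd p) (snd q))"
  "vscale (cstar_sum A D) \<alpha> p = (vscale A \<alpha> (fst p), vscale D \<alpha> (snd p))"
  "vzero (cstar_sum A D) = (vzero A, vzero D)"
  "vnorm (cstar_sum A D) p = max (vnorm A (fst p)) (vnorm D (snd p))"
  "amul (cstar_sum A D) p q = (amul A (fst p) (fst q), amul D (snd p) (snd q))"
  "astar (cstar_sum A D) p = (astar A (fst p), astar D (snd p))"
  by (simp_all add: cstar_sum_def case_prod_unfold)

section \<open>The topology of the linking spaces\<close>

lemma link_topspace [simp]:
  "In11 x \<in> topspace (link_topology S T W) \<longleftrightarrow> x \<in> topspace S"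
  "In12 y \<in> topspace (link_topology S T W) \<longleftrightarrow> y \<in> topspace T"
  "In21 y \<in> topspace (link_topology S T W) \<longleftrightarrow> y \<in> topspace T"
  "In22 z \<in> topspace (link_topology S T W) \<longleftrightarrow> z \<in> topspace W"
proof -
  let ?A = "In11 ` topspace S \<union> In12 ` topspace T \<union> In21 ` topspace T \<union> In22 ` topspace W
    :: ('a, 'b, 'c) link set"
  have "In11 -` ?A = topspace S" "In12 -` ?A = topspace T" "In21 -` ?A = topspace T"
    "In22 -` ?A = topspace W" by auto
  then have "openin (link_topology S T W) ?A" by (simp add: openin_link_topology)
  then have "?A \<subseteq> topspace (link_topology S T W)" by (rule openin_subset)
  moreover have "openin (link_topology S T W) (topspace (link_topology S T W))" by simp
  then have "In11 -` topspace (link_topology S T W) \<subseteq> topspace S"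
    "In12 -` topspace (link_topology S T W) \<subseteq> topspace T"
    "In21 -` topspace (link_topology S T W) \<subseteq> topspace T"
    "In22 -` topspace (link_topology S T W) \<subseteq> topspace W"
    unfolding openin_link_topology by (simp_all add: openin_subset)
  ultimately show
    "In11 x \<in> topspace (link_topology S T W) \<longleftrightarrow> x \<in> topspace S"
    "In12 y \<in> topspace (link_topology S T W) \<longleftrightarrow> y \<in> topspace T"
    "In21 y \<in> topspace (link_topology S T W) \<longleftrightarrow> y \<in> topspace T"
    "In22 z \<in> topspace (link_topology S T W) \<longleftrightarrow> z \<in> topspace W"
    by auto
qed

lemma link_vimage_image:
  "In11 -` In11 ` U = U" "In12 -` In11 ` U = {}" "In21 -` In11 ` U = {}" "In22 -` In11 ` U = {}"
  "In11 -` In12 ` V = {}" "In12 -` In12 ` V = V" "In21 -` In12 ` V = {}" "In22 -` In12 ` V = {}"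
  "In11 -` In21 ` V = {}" "In12 -` In21 ` V = {}" "In21 -` In21 ` V = V" "In22 -` In21 ` V = {}"
  "In11 -` In22 ` W = {}" "In12 -` In22 ` W = {}" "In21 -` In22 ` W = {}" "In22 -` In22 ` W = W"
  by auto

lemma link_open_map:
  "open_map S (link_topology S T W) In11" "open_map T (link_topology S T W) In12"
  "open_map T (link_topology S T W) In21" "open_map W (link_topology S T W) In22"
  by (simp_all add: open_map_def openin_link_topology link_vimage_image)

lemma continuous_map_vimage:
  assumes "\<And>x. x \<in> topspace X \<Longrightarrow> f x \<in> topspace Y" "\<And>U. openin Y U \<Longrightarrow> openin X (f -` U)"
  shows "continuous_map X Y f"
  unfolding continuous_map_def
proof (intro conjI allI impI)
  fix U assume "openin Y U"
  then have "openin X (f -` U)" by (rule assms(2))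
  moreover have "{x \<in> topspace X. f x \<in> U} = f -` U" using openin_subset[OF calculation] by auto
  ultimately show "openin X {x \<in> topspace X. f x \<in> U}" by simp
qed (use assms(1) in auto)

lemma link_continuous_map:
  "continuous_map S (link_topology S T W) In11" "continuous_map T (link_topology S T W) In12"
  "continuous_map T (link_topology S T W) In21" "continuous_map W (link_topology S T W) In22"
  by (rule continuous_map_vimage; simp add: openin_link_topology)+

lemma link_continuous_compose:
  "continuous_map X S f \<Longrightarrow> continuous_map X (link_topology S T W) (\<lambda>x. In11 (f x))"
  "continuous_map X T g \<Longrightarrow> continuous_map X (link_topology S T W) (\<lambda>x. In12 (g x))"
  "continuous_map X T g \<Longrightarrow> continuous_map X (link_topology S T W) (\<lambda>x. In21 (g x))"
  "continuous_map X W h \<Longrightarrow> continuous_map X (link_topology S T W) (\<lambda>x. In22 (h x))"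
  by (erule continuous_map_compose[OF _ link_continuous_map(1), unfolded o_def]
      continuous_map_compose[OF _ link_continuous_map(2), unfolded o_def]
      continuous_map_compose[OF _ link_continuous_map(3), unfolded o_def]
      continuous_map_compose[OF _ link_continuous_map(4), unfolded o_def])+

lemma continuous_map_from_link:
  assumes "continuous_map S Y (\<lambda>x. f (In11 x))" "continuous_map T Y (\<lambda>x. f (In12 x))"
    "continuous_map T Y (\<lambda>x. f (In21 x))" "continuous_map W Y (\<lambda>x. f (In22 x))"
  shows "continuous_map (link_topology S T W) Y f"
  unfolding continuous_map_def
proof (intro conjI allI impI)
  have "f p \<in> topspace Y" if "p \<in> topspace (link_topology S T W)" for p
    using that assms by (cases p) (auto simp: continuous_map_def)
  then show "f \<in> topspace (link_topology S T W) \<rightarrow> topspace Y" by blast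
  fix U assume "openin Y U"
  with assms show "openin (link_topology S T W) {p \<in> topspace (link_topology S T W). f p \<in> U}"
    unfolding openin_link_topology by (auto simp: continuous_map_def vimage_def)
qed

lemma open_map_from_link:
  assumes "open_map S Y (\<lambda>x. f (In11 x))" "open_map T Y (\<lambda>x. f (In12 x))"
    "open_map T Y (\<lambda>x. f (In21 x))" "open_map W Y (\<lambda>x. f (In22 x))"
  shows "open_map (link_topology S T W) Y f"
  unfolding open_map_def
proof (intro allI impI)
  fix U assume U: "openin (link_topology S T W) U"
  have "f ` U = (\<lambda>x. f (In11 x)) ` (In11 -` U) \<union> (\<lambda>x. f (In12 x)) ` (In12 -` U)
      \<union> (\<lambda>x. f (In21 x)) ` (In21 -` U) \<union> (\<lambda>x. f (In22 x)) ` (In22 -` U)" (is "_ = ?R")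
  proof
    show "f ` U \<subseteq> ?R"
    proof
      fix y assume "y \<in> f ` U"
      then obtain p where "p \<in> U" "y = f p" by blast
      then show "y \<in> ?R" by (cases p) auto
    qed
  qed auto
  moreover have "openin Y ?R"
    using U assms unfolding openin_link_topology open_map_def by (intro openin_Un) blast+
  ultimately show "openin Y (f ` U)" by simp
qed

text \<open>For pairs of pieces whose elements are never composable.\<close>

lemma continuous_map_vacuous: "topspace X = {} \<Longrightarrow> continuous_map X Y f"
  by (simp add: continuous_map_def)

text \<open>Operations on the linking spaces are given piecewise; since the pieces are open, continuity is
  checked on pairs of pieces.\<close>

abbreviation continuous_on_pieces ::
    "'a topology \<Rightarrow> 'b topology \<Rightarrow> ('p \<times> 'q) set \<Rightarrow> 'z topology \<Rightarrow> ('p \<Rightarrow> 'q \<Rightarrow> 'z) \<Rightarrow> ('a \<Rightarrow> 'p)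
      \<Rightarrow> ('b \<Rightarrow> 'q) \<Rightarrow> bool" where
  "continuous_on_pieces X Y R Z f i j \<equiv>
    continuous_map (subtopology (prod_topology X Y) {(x, y). (i x, j y) \<in> R}) Z (\<lambda>(x, y). f (i x) (j y))"

lemma neighbourhoods_of_open_pieces:
  assumes "continuous_on_pieces X Y R Z f i j"
    and i: "open_map X P i" and j: "open_map Y Q j"
    and xy: "x \<in> topspace X" "y \<in> topspace Y" "(i x, j y) \<in> R"
  shows "continuous_at_pair P Q R Z f (i x) (j y)"
proof -
  let ?f = "\<lambda>x y. f (i x) (j y)"
  have *: "continuous_at_pair X Y {(x, y). (i x, j y) \<in> R} Z ?f x y"
    using assms(1)[unfolded continuous_map_prod_subtopology_iff, THEN spec, THEN spec, of x y] xy by simp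
  have "\<exists>U V. openin P U \<and> openin Q V \<and> i x \<in> U \<and> j y \<in> V \<and>
        (\<forall>x'\<in>U. \<forall>y'\<in>V. (x', y') \<in> R \<longrightarrow> f x' y' \<in> W)"
    if W: "openin Z W" "f (i x) (j y) \<in> W" for W
  proof -
    obtain U V where UV: "openin X U" "openin Y V" "x \<in> U" "y \<in> V"
      "\<forall>x'\<in>U. \<forall>y'\<in>V. (x', y') \<in> {(x, y). (i x, j y) \<in> R} \<longrightarrow> f (i x') (j y') \<in> W"
      using continuous_at_pairD[OF * W] .
    show ?thesis
      by (rule exI[of _ "i ` U"], rule exI[of _ "j ` V"]) (use UV i j in \<open>auto simp: open_map_def\<close>)
  qed
  with * show ?thesis by (simp add: continuous_at_pair_def)
qed

lemma continuous_map_link_prodI: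
  fixes S :: "'a topology" and T :: "'b topology" and W :: "'c topology"
    and S' :: "'d topology" and T' :: "'e topology" and W' :: "'f topology"
  assumes "continuous_on_pieces S S' R Z f In11 In11"
    and "continuous_on_pieces S T' R Z f In11 In12"
    and "continuous_on_pieces S T' R Z f In11 In21"
    and "continuous_on_pieces S W' R Z f In11 In22"
    and "continuous_on_pieces T S' R Z f In12 In11"
    and "continuous_on_pieces T T' R Z f In12 In12"
    and "continuous_on_pieces T T' R Z f In12 In21"
    and "continuous_on_pieces T W' R Z f In12 In22"
    and "continuous_on_pieces T S' R Z f In21 In11"
    and "continuous_on_pieces T T' R Z f In21 In12"
    and "continuous_on_pieces T T' R Z f In21 In21"
    and "continuous_on_pieces T W' R Z f In21 In22"
    and "continuous_on_pieces W S' R Z f In22 In11"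
    and "continuous_on_pieces W T' R Z f In22 In12"
    and "continuous_on_pieces W T' R Z f In22 In21"
    and "continuous_on_pieces W W' R Z f In22 In22"
  shows "continuous_map (subtopology (prod_topology (link_topology S T W) (link_topology S' T' W')) R) Z
    (\<lambda>(x, y). f x y)"
  unfolding continuous_map_prod_subtopology_iff
proof (intro allI impI, elim conjE)
  fix p q
  assume pq: "p \<in> topspace (link_topology S T W)" "q \<in> topspace (link_topology S' T' W')" "(p, q) \<in> R"
  note l = link_open_map[where S = S and T = T and W = W]
    and r = link_open_map[where S = S' and T = T' and W = W']
  note pieces = assms(1)[THEN neighbourhoods_of_open_pieces, OF l(1) r(1)]
    assms(2)[THEN neighbourhoods_of_open_pieces, OF l(1) r(2)]
    assms(3)[THEN neighbourhoods_of_open_pieces, OF l(1) r(3)]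
    assms(4)[THEN neighbourhoods_of_open_pieces, OF l(1) r(4)]
    assms(5)[THEN neighbourhoods_of_open_pieces, OF l(2) r(1)]
    assms(6)[THEN neighbourhoods_of_open_pieces, OF l(2) r(2)]
    assms(7)[THEN neighbourhoods_of_open_pieces, OF l(2) r(3)]
    assms(8)[THEN neighbourhoods_of_open_pieces, OF l(2) r(4)]
    assms(9)[THEN neighbourhoods_of_open_pieces, OF l(3) r(1)]
    assms(10)[THEN neighbourhoods_of_open_pieces, OF l(3) r(2)]
    assms(11)[THEN neighbourhoods_of_open_pieces, OF l(3) r(3)]
    assms(12)[THEN neighbourhoods_of_open_pieces, OF l(3) r(4)]
    assms(13)[THEN neighbourhoods_of_open_pieces, OF l(4) r(1)]
    assms(14)[THEN neighbourhoods_of_open_pieces, OF l(4) r(2)]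
    assms(15)[THEN neighbourhoods_of_open_pieces, OF l(4) r(3)]
    assms(16)[THEN neighbourhoods_of_open_pieces, OF l(4) r(4)]
  show "continuous_at_pair (link_topology S T W) (link_topology S' T' W') R Z f p q"
    by (insert pq, cases p; cases q; hypsubst; unfold link_topspace; rule pieces; assumption)
qed

lemma link_locally_compact:
  assumes "locally_compact_space S" "locally_compact_space T" "locally_compact_space W"
  shows "locally_compact_space (link_topology S T W)"
  unfolding locally_compact_space_def
proof
  fix p assume p: "p \<in> topspace (link_topology S T W)"
  have piece: "\<exists>U K. openin (link_topology S T W) U \<and> compactin (link_topology S T W) K \<and> i x \<in> U \<and> U \<subseteq> K"
    if X: "locally_compact_space X" and i: "open_map X (link_topology S T W) i"
      "continuous_map X (link_topology S T W) i" and x: "x \<in> topspace X" for X and x :: 'x and i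
  proof -
    obtain U K where "openin X U" "compactin X K" "x \<in> U" "U \<subseteq> K"
      using X x unfolding locally_compact_space_def by blast
    then show ?thesis
      using i image_compactin[OF _ i(2)]
      by (intro exI[of _ "i ` U"] exI[of _ "i ` K"]) (auto simp: open_map_def)
  qed
  note l = link_open_map[where S = S and T = T and W = W]
    and c = link_continuous_map[where S = S and T = T and W = W]
  note pieces = piece[OF assms(1) l(1) c(1)] piece[OF assms(2) l(2) c(2)]
    piece[OF assms(2) l(3) c(3)] piece[OF assms(3) l(4) c(4)]
  show "\<exists>U K. openin (link_topology S T W) U \<and> compactin (link_topology S T W) K \<and> p \<in> U \<and> U \<subseteq> K"
    by (insert p, cases p; hypsubst; unfold link_topspace; rule pieces; assumption)
qed

lemma link_Hausdorff:
  assumes "Hausdorff_space S" "Hausdorff_space T" "Hausdorff_space W"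
  shows "Hausdorff_space (link_topology S T W)"
proof -
  let ?sep = "\<lambda>p q. \<exists>U V. openin (link_topology S T W) U \<and> openin (link_topology S T W) V \<and>
    p \<in> U \<and> q \<in> V \<and> disjnt U V"
  have same: "?sep (i x) (i y)"
    if X: "Hausdorff_space X" and i: "open_map X (link_topology S T W) i" "inj i"
      and xy: "x \<in> topspace X" "y \<in> topspace X" "x \<noteq> y" for X and x y :: 'x and i
  proof -
    obtain U V where "openin X U" "openin X V" "x \<in> U" "y \<in> V" "disjnt U V"
      using X[unfolded Hausdorff_space_def, rule_format, of x y] xy by blast
    then show ?thesis
      using i
      by (intro exI[of _ "i ` U"] exI[of _ "i ` V"])
        (auto simp: open_map_def disjnt_def inj_def)
  qed
  have different: "?sep (i x) (j y)"
    if "open_map X (link_topology S T W) i" "open_map Y (link_topology S T W) j"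
      "x \<in> topspace X" "y \<in> topspace Y" "\<And>a b. i a \<noteq> j b" for X Y and x :: 'x and y :: 'y and i j
    using that
    by (intro exI[of _ "i ` topspace X"] exI[of _ "j ` topspace Y"])
      (auto simp: open_map_def disjnt_def)
  have inj: "inj In11" "inj In12" "inj In21" "inj In22" by (auto simp: inj_def)
  note l = link_open_map[where S = S and T = T and W = W]
  note pieces = same[OF assms(1) l(1) inj(1)] same[OF assms(2) l(2) inj(2)]
    same[OF assms(2) l(3) inj(3)] same[OF assms(3) l(4) inj(4)]
    different[OF l(1) l(2)] different[OF l(1) l(3)] different[OF l(1) l(4)]
    different[OF l(2) l(1)] different[OF l(2) l(3)] different[OF l(2) l(4)]
    different[OF l(3) l(1)] different[OF l(3) l(2)] different[OF l(3) l(4)]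
    different[OF l(4) l(1)] different[OF l(4) l(2)] different[OF l(4) l(3)]
  show ?thesis
    unfolding Hausdorff_space_def
  proof (intro allI impI, elim conjE)
    fix p q
    assume pq: "p \<in> topspace (link_topology S T W)" "q \<in> topspace (link_topology S T W)" "p \<noteq> q"
    show "?sep p q"
      by (insert pq, cases p; cases q; hypsubst; unfold link_topspace; rule pieces; (assumption | simp))
  qed
qed


section \<open>The linking groupoid\<close>

text \<open>Under the inverse of a closed injection, the preimage of a closed set is its image under the injection.\<close>

lemma closed_injection_inverse_continuous:
  assumes "closed_map P Q p" and "topspace Q \<inter> S \<subseteq> p ` topspace P"
    and inv: "\<And>x. x \<in> topspace P \<Longrightarrow> h (p x) = x"
  shows "continuous_map (subtopology Q S) P h"
  unfolding continuous_map_closedin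
proof (intro conjI allI impI)
  show "h \<in> topspace (subtopology Q S) \<rightarrow> topspace P" using assms(2) inv by auto
  fix C assume C: "closedin P C"
  then have "closedin Q (p ` C)" using assms(1) by (auto simp: closed_map_def)
  moreover have "{q \<in> topspace (subtopology Q S). h q \<in> C} = p ` C \<inter> S"
  proof
    show "{q \<in> topspace (subtopology Q S). h q \<in> C} \<subseteq> p ` C \<inter> S"
      using assms(2) inv by force
    show "p ` C \<inter> S \<subseteq> {q \<in> topspace (subtopology Q S). h q \<in> C}"
      using closedin_subset[OF C] closedin_subset[OF \<open>closedin Q (p ` C)\<close>] inv by auto
  qed
  ultimately show "closedin (subtopology Q S) {q \<in> topspace (subtopology Q S). h q \<in> C}"
    by (simp add: closedin_subtopology_Int_closed Int_commute)
qed

locale equivalent_groupoids = G: lch_groupoid G + H: lch_groupoid H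
  for G :: "'g groupoid" and H :: "'h groupoid" +
  fixes Z :: "('g, 'z, 'h) bispace"
  assumes equivalence: "groupoid_equivalence G H Z"
begin

abbreviation arrG ("\<G>") where "\<G> \<equiv> topspace (gtop G)"
abbreviation arrH ("\<H>") where "\<H> \<equiv> topspace (gtop H)"
abbreviation pts ("\<Z>") where "\<Z> \<equiv> topspace (ztop Z)"
abbreviation lbr where "lbr \<equiv> left_bracket G Z"
abbreviation rbr where "rbr \<equiv> right_bracket H Z"

sublocale L: free_proper_left_space G "ztop Z" "zrng Z" "zleft Z"
  using equivalence by (simp add: groupoid_equivalence_def)

sublocale R: free_proper_right_space H "ztop Z" "zsrc Z" "zright Z"
  using equivalence by (simp add: groupoid_equivalence_def)

lemma zrng_unit: "z \<in> \<Z> \<Longrightarrow> zrng Z z \<in> units G"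
  using L.moment_continuous by (auto simp: continuous_map_def G.topspace_unit_space)

lemma zsrc_unit: "z \<in> \<Z> \<Longrightarrow> zsrc Z z \<in> units H"
  using R.moment_continuous by (auto simp: continuous_map_def H.topspace_unit_space)

lemma zrng_simps:
  "z \<in> \<Z> \<Longrightarrow> zrng Z z \<in> \<G>" "z \<in> \<Z> \<Longrightarrow> grng G (zrng Z z) = zrng Z z"
  "z \<in> \<Z> \<Longrightarrow> gsrc G (zrng Z z) = zrng Z z"
  by (simp_all add: zrng_unit G.unit_closed G.unit_rng G.unit_src)

lemma zsrc_simps:
  "z \<in> \<Z> \<Longrightarrow> zsrc Z z \<in> \<H>" "z \<in> \<Z> \<Longrightarrow> grng H (zsrc Z z) = zsrc Z z"
  "z \<in> \<Z> \<Longrightarrow> gsrc H (zsrc Z z) = zsrc Z z"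
  by (simp_all add: zsrc_unit H.unit_closed H.unit_rng H.unit_src)

lemma zsrc_left: "\<lbrakk>g \<in> \<G>; z \<in> \<Z>; gsrc G g = zrng Z z\<rbrakk> \<Longrightarrow> zsrc Z (zleft Z g z) = zsrc Z z"
  and zrng_right: "\<lbrakk>z \<in> \<Z>; h \<in> \<H>; zsrc Z z = grng H h\<rbrakk> \<Longrightarrow> zrng Z (zright Z z h) = zrng Z z"
  and left_right: "\<lbrakk>g \<in> \<G>; z \<in> \<Z>; h \<in> \<H>; gsrc G g = zrng Z z; zsrc Z z = grng H h\<rbrakk>
    \<Longrightarrow> zright Z (zleft Z g z) h = zleft Z g (zright Z z h)"
  using equivalence by (auto simp: groupoid_equivalence_def)

lemma topspace_quotient: "topspace (quotient_topology X p) = p ` topspace X"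
proof
  show "topspace (quotient_topology X p) \<subseteq> p ` topspace X"
    using openin_topspace[of "quotient_topology X p"] unfolding openin_quotient_topology by simp
  have "{z \<in> topspace X. p z \<in> p ` topspace X} = topspace X" by auto
  then show "p ` topspace X \<subseteq> topspace (quotient_topology X p)"
    by (intro openin_subset) (simp add: openin_quotient_topology)
qed

text \<open>That the homeomorphism from the orbit space of \<open>G\<close> onto \<open>H\<^sup>(\<^sup>0\<^sup>)\<close> is injective means that elements with the same source lie in one orbit.\<close>

lemma left_transitive:
  assumes "y \<in> \<Z>" "z \<in> \<Z>" "zsrc Z y = zsrc Z z"
  obtains g where "g \<in> \<G>" "gsrc G g = zrng Z z" "zleft Z g z = y"
proof -
  obtain \<phi> where \<phi>: "homeomorphic_map (quotient_topology (ztop Z) (left_orbit G Z)) (unit_space H) \<phi>"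
    "\<forall>z\<in>\<Z>. \<phi> (left_orbit G Z z) = zsrc Z z"
    using equivalence unfolding groupoid_equivalence_def by blast
  then have "inj_on \<phi> (left_orbit G Z ` \<Z>)"
    by (simp add: homeomorphic_map_def topspace_quotient)
  then have "left_orbit G Z y = left_orbit G Z z"
    by (rule inj_onD) (use assms \<phi>(2) in auto)
  moreover have "y \<in> left_orbit G Z y"
    using assms(1) L.act_unit[of y] zrng_simps[of y]
    unfolding left_orbit_def by (intro CollectI exI[of _ "zrng Z y"]) simp
  ultimately show thesis using that by (auto simp: left_orbit_def)
qed

lemma right_transitive:
  assumes "y \<in> \<Z>" "z \<in> \<Z>" "zrng Z y = zrng Z z"
  obtains h where "h \<in> \<H>" "zsrc Z y = grng H h" "zright Z y h = z"
proof -
  obtain \<phi> where \<phi>: "homeomorphic_map (quotient_topology (ztop Z) (right_orbit H Z)) (unit_space G) \<phi>"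
    "\<forall>z\<in>\<Z>. \<phi> (right_orbit H Z z) = zrng Z z"
    using equivalence unfolding groupoid_equivalence_def by blast
  then have "inj_on \<phi> (right_orbit H Z ` \<Z>)"
    by (simp add: homeomorphic_map_def topspace_quotient)
  then have "right_orbit H Z y = right_orbit H Z z"
    by (rule inj_onD) (use assms \<phi>(2) in auto)
  moreover have "z \<in> right_orbit H Z z"
    using assms(2) R.act_unit[of z] zsrc_simps[of z]
    unfolding right_orbit_def by (intro CollectI exI[of _ "zsrc Z z"]) simp
  ultimately have "z \<in> right_orbit H Z y" by simp
  then show thesis using that by (auto simp: right_orbit_def)
qed

text \<open>Freeness, applied to \<open>k\<inverse> g\<close>.\<close>

lemma left_cancel:
  assumes "g \<in> \<G>" "k \<in> \<G>" "z \<in> \<Z>" "gsrc G g = zrng Z z" "gsrc G k = zrng Z z"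
    and eq: "zleft Z g z = zleft Z k z"
  shows "g = k"
proof -
  have rng: "grng G g = grng G k"
    using assms L.moment_act[of g z] L.moment_act[of k z] by simp
  have "zleft Z (gmul G (ginv G k) g) z = zleft Z (ginv G k) (zleft Z k z)"
    using assms rng by (simp add: L.act_act[symmetric] G.inv_closed G.src_inv)
  also have "\<dots> = z"
    using assms by (simp add: L.act_act G.inv_closed G.src_inv G.inv_mul L.act_unit)
  finally have fixed: "zleft Z (gmul G (ginv G k) g) z = z" .
  have "gmul G (ginv G k) g = zrng Z z"
    by (rule L.free) (use assms rng fixed in \<open>simp_all add: G.mul_closed G.src_mul G.inv_closed G.src_inv\<close>)
  then have "gmul G k (gmul G (ginv G k) g) = k"
    using assms G.mul_src[of k] by simp
  moreover have "gmul G k (gmul G (ginv G k) g) = g"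
    using assms rng G.mul_rng[of g]
    by (simp add: G.mul_assoc[symmetric] G.inv_closed G.src_inv G.rng_inv G.mul_inv)
  ultimately show ?thesis by simp
qed

lemma right_cancel:
  assumes "h \<in> \<H>" "k \<in> \<H>" "z \<in> \<Z>" "zsrc Z z = grng H h" "zsrc Z z = grng H k"
    and eq: "zright Z z h = zright Z z k"
  shows "h = k"
proof -
  have src: "gsrc H h = gsrc H k"
    using assms R.moment_act[of z h] R.moment_act[of z k] by simp
  have "zright Z z (gmul H h (ginv H k)) = zright Z (zright Z z k) (ginv H k)"
    using assms src by (simp add: R.act_act[symmetric] H.inv_closed H.rng_inv)
  also have "\<dots> = z"
    using assms by (simp add: R.act_act H.inv_closed H.rng_inv H.mul_inv) (metis R.act_unit)
  finally have fixed: "zright Z z (gmul H h (ginv H k)) = z" .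
  have "gmul H h (ginv H k) = zsrc Z z"
    by (rule R.free) (use assms src fixed in \<open>simp_all add: H.mul_closed H.rng_mul H.inv_closed H.rng_inv\<close>)
  then have "gmul H (gmul H h (ginv H k)) k = k"
    using assms H.mul_rng[of k] by simp
  moreover have "gmul H (gmul H h (ginv H k)) k = h"
    using assms src H.mul_src[of h]
    by (simp add: H.mul_assoc H.inv_closed H.src_inv H.rng_inv H.inv_mul)
  ultimately show ?thesis by simp
qed

lemma lbr_eqI:
  assumes "z \<in> \<Z>" "g \<in> \<G>" "gsrc G g = zrng Z z" "zleft Z g z = y"
  shows "lbr y z = g"
  unfolding left_bracket_def by (rule the_equality) (use assms left_cancel in auto)

lemma rbr_eqI:
  assumes "y \<in> \<Z>" "h \<in> \<H>" "zsrc Z y = grng H h" "zright Z y h = z"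
  shows "rbr y z = h"
  unfolding right_bracket_def by (rule the_equality) (use assms right_cancel in auto)

lemma lbr:
  assumes "y \<in> \<Z>" "z \<in> \<Z>" "zsrc Z y = zsrc Z z"
  shows "lbr y z \<in> \<G>" "gsrc G (lbr y z) = zrng Z z" "grng G (lbr y z) = zrng Z y"
    "zleft Z (lbr y z) z = y"
proof -
  obtain g where g: "g \<in> \<G>" "gsrc G g = zrng Z z" "zleft Z g z = y"
    using left_transitive[OF assms] .
  then have "lbr y z = g" using assms lbr_eqI by blast
  then show "lbr y z \<in> \<G>" "gsrc G (lbr y z) = zrng Z z" "grng G (lbr y z) = zrng Z y"
    "zleft Z (lbr y z) z = y"
    using g assms L.moment_act[of g z] by auto
qed

lemma rbr:
  assumes "y \<in> \<Z>" "z \<in> \<Z>" "zrng Z y = zrng Z z"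
  shows "rbr y z \<in> \<H>" "grng H (rbr y z) = zsrc Z y" "gsrc H (rbr y z) = zsrc Z z"
    "zright Z y (rbr y z) = z"
proof -
  obtain h where h: "h \<in> \<H>" "zsrc Z y = grng H h" "zright Z y h = z"
    using right_transitive[OF assms] .
  then have "rbr y z = h" using assms rbr_eqI by blast
  then show "rbr y z \<in> \<H>" "grng H (rbr y z) = zsrc Z y" "gsrc H (rbr y z) = zsrc Z z"
    "zright Z y (rbr y z) = z"
    using h assms R.moment_act[of y h] by auto
qed

text \<open>Properness and freeness make \<open>(g, z) \<mapsto> (g \<cdot> z, z)\<close> a closed injection; its inverse is
  \<open>(y, z) \<mapsto> (\<^sub>G[y, z], z)\<close>.\<close>

lemma lbr_continuous:
  "continuous_map (subtopology (prod_topology (ztop Z) (ztop Z)) {(y, z). zsrc Z y = zsrc Z z})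
    (gtop G) (\<lambda>(y, z). lbr y z)"
proof -
  let ?P = "subtopology (prod_topology (gtop G) (ztop Z)) {(g, z). gsrc G g = zrng Z z}"
  have "continuous_map (subtopology (prod_topology (ztop Z) (ztop Z)) {(y, z). zsrc Z y = zsrc Z z})
    ?P (\<lambda>(y, z). (lbr y z, z))"
  proof (rule closed_injection_inverse_continuous)
    show "closed_map ?P (prod_topology (ztop Z) (ztop Z)) (\<lambda>(g, z). (zleft Z g z, z))"
      using L.proper by (simp add: proper_map_def)
    show "topspace (prod_topology (ztop Z) (ztop Z)) \<inter> {(y, z). zsrc Z y = zsrc Z z}
        \<subseteq> (\<lambda>(g, z). (zleft Z g z, z)) ` topspace ?P"
    proof (clarsimp)
      fix y z assume "y \<in> \<Z>" "z \<in> \<Z>" "zsrc Z y = zsrc Z z"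
      then show "(y, z) \<in> (\<lambda>(g, z). (zleft Z g z, z)) ` (\<G> \<times> \<Z> \<inter> {(g, z). gsrc G g = zrng Z z})"
        using lbr[of y z] by (intro image_eqI[of _ _ "(lbr y z, z)"]) auto
    qed
  qed (auto intro: lbr_eqI)
  from continuous_map_compose[OF this continuous_map_from_subtopology[OF continuous_map_fst]]
  show ?thesis by (simp add: o_def case_prod_unfold)
qed

lemma rbr_continuous:
  "continuous_map (subtopology (prod_topology (ztop Z) (ztop Z)) {(y, z). zrng Z y = zrng Z z})
    (gtop H) (\<lambda>(y, z). rbr y z)"
proof -
  let ?P = "subtopology (prod_topology (ztop Z) (gtop H)) {(z, h). zsrc Z z = grng H h}"
  have "continuous_map (subtopology (prod_topology (ztop Z) (ztop Z)) {(y, z). zrng Z y = zrng Z z})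
    ?P (\<lambda>(y, z). (y, rbr y z))"
  proof (rule closed_injection_inverse_continuous)
    show "closed_map ?P (prod_topology (ztop Z) (ztop Z)) (\<lambda>(z, h). (z, zright Z z h))"
      using R.proper by (simp add: proper_map_def)
    show "topspace (prod_topology (ztop Z) (ztop Z)) \<inter> {(y, z). zrng Z y = zrng Z z}
        \<subseteq> (\<lambda>(z, h). (z, zright Z z h)) ` topspace ?P"
    proof (clarsimp)
      fix y z assume "y \<in> \<Z>" "z \<in> \<Z>" "zrng Z y = zrng Z z"
      then show "(y, z) \<in> (\<lambda>(z, h). (z, zright Z z h)) ` (\<Z> \<times> \<H> \<inter> {(z, h). zsrc Z z = grng H h})"
        using rbr[of y z] by (intro image_eqI[of _ _ "(y, rbr y z)"]) auto
    qed
  qed (auto intro: rbr_eqI)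
  from continuous_map_compose[OF this continuous_map_from_subtopology[OF continuous_map_snd]]
  show ?thesis by (simp add: o_def case_prod_unfold)
qed

lemma lbr_self: "z \<in> \<Z> \<Longrightarrow> lbr z z = zrng Z z"
  by (rule lbr_eqI) (simp_all add: zrng_simps L.act_unit)

lemma rbr_self: "z \<in> \<Z> \<Longrightarrow> rbr z z = zsrc Z z"
  by (rule rbr_eqI) (simp_all add: zsrc_simps R.act_unit)

lemma left_inverse: "\<lbrakk>g \<in> \<G>; z \<in> \<Z>; gsrc G g = zrng Z z\<rbrakk> \<Longrightarrow> zleft Z (ginv G g) (zleft Z g z) = z"
  by (simp add: L.act_act G.inv_closed G.src_inv G.inv_mul L.act_unit)

lemma left_inverse': "\<lbrakk>g \<in> \<G>; z \<in> \<Z>; grng G g = zrng Z z\<rbrakk> \<Longrightarrow> zleft Z g (zleft Z (ginv G g) z) = z"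
  by (simp add: L.act_act G.inv_closed G.src_inv G.rng_inv G.mul_inv L.act_unit)

lemma right_inverse: "\<lbrakk>h \<in> \<H>; z \<in> \<Z>; zsrc Z z = grng H h\<rbrakk> \<Longrightarrow> zright Z (zright Z z h) (ginv H h) = z"
  by (simp add: R.act_act H.inv_closed H.rng_inv H.mul_inv) (metis R.act_unit)

lemma right_inverse': "\<lbrakk>h \<in> \<H>; z \<in> \<Z>; zsrc Z z = gsrc H h\<rbrakk> \<Longrightarrow> zright Z (zright Z z (ginv H h)) h = z"
  by (simp add: R.act_act H.inv_closed H.rng_inv H.src_inv H.inv_mul) (metis R.act_unit)

text \<open>The following rules are the associativity laws of the linking groupoid for triples involving a
  bracket. Each holds because a bracket is the only element that carries one point to the other.\<close>

lemma lbr_left: "\<lbrakk>g \<in> \<G>; y \<in> \<Z>; z \<in> \<Z>; gsrc G g = zrng Z y; zsrc Z y = zsrc Z z\<rbrakk>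
    \<Longrightarrow> lbr (zleft Z g y) z = gmul G g (lbr y z)"
  by (rule lbr_eqI) (simp_all add: lbr G.mul_closed G.src_mul L.act_act[symmetric])

lemma lbr_right: "\<lbrakk>g \<in> \<G>; y \<in> \<Z>; z \<in> \<Z>; grng G g = zrng Z z; zsrc Z y = zsrc Z z\<rbrakk>
    \<Longrightarrow> lbr y (zleft Z (ginv G g) z) = gmul G (lbr y z) g"
  by (rule lbr_eqI)
    (simp_all add: lbr G.mul_closed G.src_mul L.act_act[symmetric] L.act_closed L.moment_act
      G.inv_closed G.src_inv G.rng_inv left_inverse')

lemma lbr_zright:
  assumes "h \<in> \<H>" "y \<in> \<Z>" "z \<in> \<Z>" "zsrc Z y = grng H h" "gsrc H h = zsrc Z z"
  shows "lbr (zright Z y h) z = lbr y (zright Z z (ginv H h))"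
proof (rule lbr_eqI)
  let ?w = "zright Z z (ginv H h)"
  have w: "?w \<in> \<Z>" "zsrc Z ?w = grng H h" "zrng Z ?w = zrng Z z"
    using assms by (simp_all add: R.act_closed R.moment_act zrng_right H.inv_closed H.rng_inv H.src_inv)
  note g = lbr[OF assms(2) w(1)]
  show "lbr y ?w \<in> \<G>" "gsrc G (lbr y ?w) = zrng Z z" using g w assms by simp_all
  have "zright Z (zleft Z (lbr y ?w) ?w) h = zleft Z (lbr y ?w) (zright Z ?w h)"
    using g w assms by (intro left_right) simp_all
  then show "zleft Z (lbr y ?w) z = zright Z y h"
    using g w assms by (simp add: right_inverse')
qed (rule assms)

lemma rbr_right: "\<lbrakk>h \<in> \<H>; y \<in> \<Z>; z \<in> \<Z>; zsrc Z z = grng H h; zrng Z y = zrng Z z\<rbrakk>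
    \<Longrightarrow> rbr y (zright Z z h) = gmul H (rbr y z) h"
  by (rule rbr_eqI) (simp_all add: rbr H.mul_closed H.rng_mul R.act_act[symmetric])

lemma rbr_left: "\<lbrakk>h \<in> \<H>; y \<in> \<Z>; z \<in> \<Z>; zsrc Z y = gsrc H h; zrng Z y = zrng Z z\<rbrakk>
    \<Longrightarrow> rbr (zright Z y (ginv H h)) z = gmul H h (rbr y z)"
  by (rule rbr_eqI)
    (simp_all add: rbr H.mul_closed H.rng_mul R.act_act[symmetric] R.act_closed R.moment_act
      H.inv_closed H.src_inv H.rng_inv right_inverse')

lemma lbr_rbr:
  assumes "x \<in> \<Z>" "y \<in> \<Z>" "z \<in> \<Z>" "zsrc Z x = zsrc Z y" "zrng Z y = zrng Z z"
  shows "zleft Z (lbr x y) z = zright Z x (rbr y z)"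
proof -
  note l = lbr[OF assms(1,2,4)] and r = rbr[OF assms(2,3,5)]
  have "zright Z (zleft Z (lbr x y) y) (rbr y z) = zleft Z (lbr x y) (zright Z y (rbr y z))"
    by (rule left_right) (use l r assms in simp_all)
  then show ?thesis by (simp only: l(4) r(4))
qed

lemma rbr_zleft: "\<lbrakk>g \<in> \<G>; y \<in> \<Z>; z \<in> \<Z>; zrng Z y = grng G g; gsrc G g = zrng Z z\<rbrakk>
    \<Longrightarrow> rbr (zleft Z (ginv G g) y) z = rbr y (zleft Z g z)"
  by (rule rbr_eqI)
    (simp_all add: rbr L.act_closed L.moment_act G.inv_closed G.rng_inv G.src_inv zsrc_left
      left_right left_inverse)

lemma lbr_inv: "\<lbrakk>y \<in> \<Z>; z \<in> \<Z>; zsrc Z y = zsrc Z z\<rbrakk> \<Longrightarrow> ginv G (lbr y z) = lbr z y"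
  by (rule lbr_eqI[symmetric])
    (use left_inverse[of "lbr y z" z] in \<open>simp_all add: lbr G.inv_closed G.src_inv\<close>)

lemma rbr_inv: "\<lbrakk>y \<in> \<Z>; z \<in> \<Z>; zrng Z y = zrng Z z\<rbrakk> \<Longrightarrow> ginv H (rbr y z) = rbr z y"
  by (rule rbr_eqI[symmetric])
    (use right_inverse[of "rbr y z" y] in \<open>simp_all add: rbr H.inv_closed H.rng_inv\<close>)

end

lemma linking_groupoid_simps [simp]:
  "gtop (linking_groupoid G H Z) = link_topology (gtop G) (ztop Z) (gtop H)"
  "gsrc (linking_groupoid G H Z) = link_src G H Z"
  "grng (linking_groupoid G H Z) = link_rng G H Z"
  "gmul (linking_groupoid G H Z) = link_mul G H Z"
  "ginv (linking_groupoid G H Z) = link_inv G H"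
  by (simp_all add: linking_groupoid_def)

context equivalent_groupoids
begin

lemma link_mul_continuous:
  "continuous_map
    (subtopology (prod_topology (gtop (linking_groupoid G H Z)) (gtop (linking_groupoid G H Z)))
      {(g, k). gsrc (linking_groupoid G H Z) g = grng (linking_groupoid G H Z) k})
    (gtop (linking_groupoid G H Z)) (\<lambda>(g, k). gmul (linking_groupoid G H Z) g k)"
  unfolding linking_groupoid_simps
proof (rule continuous_map_link_prodI, goal_cases)
  case 1 then show ?case
    using link_continuous_compose(1)[OF G.continuous_mul] by (simp add: case_prod_unfold)
next
  case 2 then show ?case
    using link_continuous_compose(2)[OF L.act_continuous] by (simp add: case_prod_unfold)
next
  case 7 then show ?case
    using link_continuous_compose(1)[OF lbr_continuous] by (simp add: case_prod_unfold)
next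
  case 8 then show ?case
    using link_continuous_compose(2)[OF R.act_continuous] by (simp add: case_prod_unfold)
next
  case 9
  have "continuous_map (subtopology (prod_topology (ztop Z) (gtop G)) {(z, g). zrng Z z = grng G g})
      (ztop Z) (\<lambda>p. zleft Z (ginv G (snd p)) (fst p))"
    using continuous_map_from_subtopology[OF continuous_map_compose[OF continuous_map_snd G.continuous_inv]]
    by (intro continuous_map_binary_op[OF L.act_continuous])
      (auto simp: o_def continuous_map_from_subtopology continuous_map_fst G.src_inv)
  then show ?case
    using link_continuous_compose(3) by (simp add: case_prod_unfold)
next
  case 10 then show ?case
    using link_continuous_compose(4)[OF rbr_continuous] by (simp add: case_prod_unfold)
next
  case 15
  have "continuous_map (subtopology (prod_topology (gtop H) (ztop Z)) {(h, z). gsrc H h = zsrc Z z})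
      (ztop Z) (\<lambda>p. zright Z (snd p) (ginv H (fst p)))"
    using continuous_map_from_subtopology[OF continuous_map_compose[OF continuous_map_fst H.continuous_inv]]
    by (intro continuous_map_binary_op[OF R.act_continuous])
      (auto simp: o_def continuous_map_from_subtopology continuous_map_snd H.rng_inv)
  then show ?case
    using link_continuous_compose(3) by (simp add: case_prod_unfold)
next
  case 16 then show ?case
    using link_continuous_compose(4)[OF H.continuous_mul] by (simp add: case_prod_unfold)
qed (simp_all add: continuous_map_vacuous)

text \<open>Of the sixteen composable types of triples, those without a bracket need only associativity of the
  actions and their commutation, together with \<open>(g k)\<inverse> = k\<inverse> g\<inverse>\<close> on the opposite space.\<close>

theorem linking_lch_groupoid: "lch_groupoid (linking_groupoid G H Z)"
proof (intro lch_groupoid.intro link_mul_continuous)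
  note closed = G.rng_closed G.src_closed G.mul_closed G.inv_closed
    H.rng_closed H.src_closed H.mul_closed H.inv_closed L.act_closed R.act_closed lbr rbr zrng_simps zsrc_simps
  note sides = G.rng_rng G.src_rng G.rng_src G.src_src G.rng_mul G.src_mul G.rng_inv G.src_inv
    H.rng_rng H.src_rng H.rng_src H.src_src H.rng_mul H.src_mul H.rng_inv H.src_inv
    L.moment_act R.moment_act zsrc_left zrng_right
  let ?L = "linking_groupoid G H Z"
  fix g assume g: "g \<in> topspace (gtop ?L)"
  show "grng ?L g \<in> topspace (gtop ?L)" "gsrc ?L g \<in> topspace (gtop ?L)"
    "grng ?L (grng ?L g) = grng ?L g" "gsrc ?L (grng ?L g) = grng ?L g"
    "grng ?L (gsrc ?L g) = gsrc ?L g" "gsrc ?L (gsrc ?L g) = gsrc ?L g"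
    "ginv ?L g \<in> topspace (gtop ?L)" "grng ?L (ginv ?L g) = gsrc ?L g"
    "gsrc ?L (ginv ?L g) = grng ?L g"
    using g by (cases g; simp add: closed sides)+
  show "gmul ?L (grng ?L g) g = g" "gmul ?L g (gsrc ?L g) = g"
    "gmul ?L (ginv ?L g) g = gsrc ?L g" "gmul ?L g (ginv ?L g) = grng ?L g"
    using g
    by (cases g; simp add: closed sides G.mul_rng G.mul_src G.inv_mul G.mul_inv H.mul_rng H.mul_src
        H.inv_mul H.mul_inv L.act_unit R.act_unit lbr_self rbr_self G.unit_inv H.unit_inv zrng_unit
        zsrc_unit)+
  fix k assume k: "k \<in> topspace (gtop ?L)" "gsrc ?L g = grng ?L k"
  show "gmul ?L g k \<in> topspace (gtop ?L)" "grng ?L (gmul ?L g k) = grng ?L g"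
    "gsrc ?L (gmul ?L g k) = gsrc ?L k"
    using g k by (cases g; cases k; simp add: closed sides)+
  fix l assume l: "l \<in> topspace (gtop ?L)" "gsrc ?L k = grng ?L l"
  show "gmul ?L (gmul ?L g k) l = gmul ?L g (gmul ?L k l)"
    using g k l
    by (cases g; cases k; cases l; simp add: closed sides G.mul_assoc H.mul_assoc L.act_act
        R.act_act left_right lbr_left lbr_right lbr_zright rbr_left rbr_right rbr_zleft
        lbr_rbr lbr_inv rbr_inv G.inv_of_mul H.inv_of_mul)
next
  let ?L = "linking_groupoid G H Z"
  show "continuous_map (gtop ?L) (gtop ?L) (ginv ?L)"
    unfolding linking_groupoid_simps
    by (rule continuous_map_from_link)
      (simp_all add: link_continuous_compose link_continuous_map G.continuous_inv H.continuous_inv)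
  have "locally_compact_space (ztop Z)" "Hausdorff_space (ztop Z)"
    using equivalence by (simp_all add: groupoid_equivalence_def)
  then show "locally_compact_space (gtop ?L)" "Hausdorff_space (gtop ?L)"
    by (simp_all add: link_locally_compact link_Hausdorff G.locally_compact H.locally_compact
        G.hausdorff H.hausdorff)
qed

end

section \<open>Faithfulness of multiplication in a Fell bundle\<close>

context fell_bundle
begin

lemma left_fibre_module:
  "g \<in> topspace (gtop G) \<Longrightarrow> full_left_hilbert_module (fibre_algebra B (grng G g)) (fibre B g)
    (bmul B) (\<lambda>a b. bmul B a (bstar B b))"
  using fibre_imprimitivity by (auto simp: imprimitivity_bimodule_def)

lemma right_fibre_module:
  "g \<in> topspace (gtop G) \<Longrightarrow> full_right_hilbert_module (fibre_algebra B (gsrc G g)) (fibre B g)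
    (bmul B) (\<lambda>a b. bmul B (bstar B a) b)"
  using fibre_imprimitivity by (auto simp: imprimitivity_bimodule_def)

lemma norm_mult_star:
  "b \<in> tot \<Longrightarrow> bnorm B (bmul B b (bstar B b)) = (bnorm B b)\<^sup>2"
  using full_left_hilbert_module.norm_ip[OF left_fibre_module[OF proj_base], of b b] by simp

lemma norm_star_mult:
  "b \<in> tot \<Longrightarrow> bnorm B (bmul B (bstar B b) b) = (bnorm B b)\<^sup>2"
  using full_right_hilbert_module.norm_ip[OF right_fibre_module[OF proj_base], of b b] by simp

lemma unit_mult_closed:
  assumes "a \<in> tot" "d \<in> tot" "bproj B a = grng G (bproj B d)"
  shows "gsrc G (bproj B a) = grng G (bproj B d)" "bmul B a d \<in> tot"
    "bproj B (bmul B a d) = bproj B d"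
proof -
  show s: "gsrc G (bproj B a) = grng G (bproj B d)"
    using assms by (simp add: src_rng proj_base)
  then show "bmul B a d \<in> tot" "bproj B (bmul B a d) = bproj B d"
    using assms by (simp_all add: mult_closed mult_proj mul_rng proj_base)
qed

text \<open>The norm of an element \<open>x\<close> over an arbitrary arrow is controlled by \<open>x x\<^sup>*\<close> over a unit, where the norm
  is submultiplicative: here \<open>\<parallel>a d\<parallel>\<^sup>2 = \<parallel>a (d d\<^sup>*) a\<^sup>*\<parallel>\<close>.\<close>

lemma norm_mult_unit_left:
  assumes a: "a \<in> tot" and d: "d \<in> tot"
    and proj: "bproj B a = grng G (bproj B d)"
  shows "bnorm B (bmul B a d) \<le> bnorm B a * bnorm B d"
proof -
  let ?u = "grng G (bproj B d)" and ?p = "bmul B d (bstar B d)"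
  have u: "?u \<in> units G" by (rule rng_unit[OF proj_base[OF d]])
  note ad = unit_mult_closed[OF a d proj]
  have s: "bstar B a \<in> tot" "bproj B (bstar B a) = ?u"
    "bnorm B (bstar B a) = bnorm B a"
    using a u by (simp_all add: star_closed star_proj unit_norm_star proj unit_inv)
  have p: "?p \<in> tot" "bproj B ?p = ?u"
    using d by (simp_all add: mult_closed mult_proj star_closed star_proj rng_inv mul_inv proj_base)
  have ap: "bmul B a ?p \<in> tot" "bproj B (bmul B a ?p) = ?u"
    using a p proj u by (simp_all add: mult_closed mult_proj unit_src unit_rng unit_mul)
  have 1: "bmul B (bmul B a d) (bstar B d) = bmul B a ?p"
    using a d ad by (intro mult_assoc) (simp_all add: star_closed star_proj rng_inv proj_base)
  have 2: "bmul B (bmul B (bmul B a d) (bstar B d)) (bstar B a)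
      = bmul B (bmul B a d) (bmul B (bstar B d) (bstar B a))"
    using a d ad s u
    by (intro mult_assoc) (simp_all add: star_closed star_proj rng_inv src_inv proj_base unit_rng)
  have "(bnorm B (bmul B a d))\<^sup>2 = bnorm B (bmul B (bmul B a d) (bmul B (bstar B d) (bstar B a)))"
    using a d ad by (simp add: norm_mult_star[symmetric] star_mult)
  also have "bmul B (bmul B a d) (bmul B (bstar B d) (bstar B a)) = bmul B (bmul B a ?p) (bstar B a)"
    using 1 2 by simp
  also have "bnorm B \<dots> \<le> bnorm B (bmul B a ?p) * bnorm B a"
    using unit_norm_mult[OF ap(1) s(1) ap(2) s(2) u] s(3) by simp
  also have "\<dots> \<le> (bnorm B a * bnorm B ?p) * bnorm B a"
    using unit_norm_mult[OF a p(1) proj p(2) u] norm_nonneg[OF a] by (rule mult_right_mono)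
  also have "\<dots> = (bnorm B a * bnorm B d)\<^sup>2"
    using d by (simp add: norm_mult_star power2_eq_square algebra_simps)
  finally show ?thesis
    by (rule power2_le_imp_le) (simp add: norm_nonneg a d)
qed

text \<open>An element of norm zero equals its multiple by \<open>0\<close>.\<close>

lemma mult_norm_zero:
  assumes "a \<in> tot" "b \<in> tot" "gsrc G (bproj B a) = grng G (bproj B b)"
    and "bnorm B a = 0"
  shows "bnorm B (bmul B a b) = 0"
proof -
  have "bnorm B (bscale B 0 a) = 0" using assms(1) by (simp add: norm_scale)
  then have "bscale B 0 a = a"
    using assms by (simp add: norm_eq_zero scale_closed scale_proj)
  then have "bmul B a b = bscale B 0 (bmul B a b)"
    using mult_scale_left[OF assms(1-3), of 0] by simp
  then have "bnorm B (bmul B a b) = cmod 0 * bnorm B (bmul B a b)"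
    using norm_scale[OF mult_closed[OF assms(1-3)], of 0] by simp
  then show ?thesis by simp
qed

text \<open>An element \<open>d\<close> killed by a total set is killed by the whole algebra, by continuity of
  \<open>a \<mapsto> a d\<close>, in particular by \<open>d d\<^sup>*\<close>; then \<open>(d d\<^sup>*)\<^sup>2 = 0\<close> and so \<open>d = 0\<close>.\<close>

lemma left_mult_separates:
  assumes x: "x \<in> tot" and y: "y \<in> tot" and xy: "bproj B x = bproj B y"
    and S: "S \<subseteq> carr (fibre_algebra B (grng G (bproj B x)))"
    and total: "total_set (fibre_algebra B (grng G (bproj B x))) S"
    and eq: "\<And>a. a \<in> S \<Longrightarrow> bmul B a x = bmul B a y"
  shows "x = y"
proof -
  define u where "u = grng G (bproj B x)"
  define d where "d = bsub x y"
  have d: "d \<in> tot" "grng G (bproj B d) = u"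
    using x y xy by (simp_all add: d_def u_def sub_closed sub_proj)
  have u: "u \<in> units G" using x by (simp add: u_def rng_unit proj_base)
  interpret A: cstar_algebra "fibre_algebra B u" by (rule unit_fibre_cstar[OF u])
  note mult = unit_mult_closed[OF _ d(1), unfolded d(2)]
  have src: "gsrc G u = u" by (rule unit_src[OF u])
  let ?W = "{a \<in> tot. bproj B a = u \<and> bnorm B (bmul B a d) = 0}"
  have bound: "bnorm B (bmul B a d) \<le> bnorm B a * bnorm B d"
    if "a \<in> tot" "bproj B a = u" for a
    using norm_mult_unit_left[of a d] that d by simp
  have "lin_subspace (fibre_algebra B u) ?W"
    unfolding lin_subspace_def
  proof (intro conjI ballI allI)
    have z: "bzero B u \<in> tot" "bproj B (bzero B u) = u" "bnorm B (bzero B u) = 0"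
      using A.zero_closed A.norm_eq_zero[OF A.zero_closed] by simp_all
    then show "vzero (fibre_algebra B u) \<in> ?W"
      using mult_norm_zero[OF z(1) d(1)] d(2) src by simp
    fix a assume a: "a \<in> ?W"
    show "vscale (fibre_algebra B u) \<alpha> a \<in> ?W" for \<alpha>
      using a d src mult[of a]
      by (simp add: scale_closed scale_proj mult_scale_left norm_scale)
    fix b assume b: "b \<in> ?W"
    have "bnorm B (badd B (bmul B a d) (bmul B b d)) \<le> 0"
      using norm_triangle[of "bmul B a d" "bmul B b d"] a b mult[of a] mult[of b] by simp
    moreover have "bmul B (badd B a b) d = badd B (bmul B a d) (bmul B b d)"
      using a b d src by (simp add: mult_add_left)
    moreover have "badd B (bmul B a d) (bmul B b d) \<in> tot"
      using a b mult[of a] mult[of b] by (simp add: add_closed)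
    ultimately show "vadd (fibre_algebra B u) a b \<in> ?W"
      using a b by (simp add: add_closed add_proj norm_nonneg order_antisym)
  qed auto
  moreover have "S \<subseteq> ?W"
  proof
    fix a assume a: "a \<in> S"
    then have a': "a \<in> tot" "bproj B a = u" using S by (auto simp: u_def)
    have "bmul B a d = bsub (bmul B a x) (bmul B a y)"
      using a' x y xy src
      by (simp add: d_def bsub_def mult_add_right mult_scale_right scale_closed scale_proj u_def)
    moreover have "bmul B a y \<in> tot"
      using unit_mult_closed[of a y] a' y xy by (simp add: u_def)
    ultimately show "a \<in> ?W"
      using a' eq[OF a] by (simp add: norm_sub_eq_zero)
  qed
  ultimately have hull: "lin_subspace (fibre_algebra B u) hull S \<subseteq> ?W"
    by (simp add: hull_minimal)
  \<comment> \<open>Up to a summand of small norm, \<open>a\<close> lies in the span of \<open>S\<close>.\<close>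
  have kill: "bnorm B (bmul B a d) = 0" if a: "a \<in> tot" "bproj B a = u" for a
  proof (rule antisym)
    show "0 \<le> bnorm B (bmul B a d)" using mult[of a] a by (simp add: norm_nonneg)
    show "bnorm B (bmul B a d) \<le> 0"
    proof (rule field_le_epsilon)
      fix \<epsilon> :: real assume \<epsilon>: "0 < \<epsilon>"
      have pos: "0 < bnorm B d + 1" using norm_nonneg[OF d(1)] by simp
      then have "0 < \<epsilon> / (bnorm B d + 1)" using \<epsilon> by simp
      then obtain w where "w \<in> lin_subspace (fibre_algebra B u) hull S"
        and "vnorm (fibre_algebra B u) (A.normed.sub a w) < \<epsilon> / (bnorm B d + 1)"
        using total[folded u_def, unfolded A.normed.total_set_iff, THEN bspec, of a] a by auto
      then have w: "w \<in> ?W" "bnorm B (bsub a w) < \<epsilon> / (bnorm B d + 1)"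
        using hull by (auto simp: A.normed.sub_def bsub_def)
      let ?r = "bsub a w"
      have r: "?r \<in> tot" "bproj B ?r = u"
        using a w by (simp_all add: sub_closed sub_proj)
      have "bmul B a d = bmul B (badd B w ?r) d"
        using a w by (simp add: add_sub_cancel)
      also have "\<dots> = badd B (bmul B w d) (bmul B ?r d)"
        using w r d src by (simp add: mult_add_left)
      finally have "bnorm B (bmul B a d) \<le> bnorm B (bmul B w d) + bnorm B (bmul B ?r d)"
        using norm_triangle[of "bmul B w d" "bmul B ?r d"] mult[of w] mult[of ?r] w r by simp
      also have "\<dots> \<le> bnorm B ?r * bnorm B d" using w bound[OF r] by simp
      also have "\<dots> \<le> bnorm B ?r * (bnorm B d + 1)"
        using norm_nonneg[OF r(1)] by (intro mult_left_mono) simp_all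
      also have "\<dots> \<le> \<epsilon>" using w(2) pos by (simp add: pos_less_divide_eq)
      finally show "bnorm B (bmul B a d) \<le> 0 + \<epsilon>" by simp
    qed
  qed
  let ?p = "bmul B d (bstar B d)"
  have p: "?p \<in> tot" "bproj B ?p = u"
    using d by (simp_all add: mult_closed mult_proj star_closed star_proj rng_inv mul_inv proj_base)
  have star_p: "bstar B ?p = ?p"
    using d by (simp add: star_mult star_closed star_proj rng_inv proj_base star_star)
  have "bmul B (bmul B ?p d) (bstar B d) = bmul B ?p ?p"
    using p d src mult[of ?p] by (simp add: mult_assoc star_closed star_proj rng_inv proj_base)
  then have "bnorm B (bmul B ?p ?p) = 0"
    using mult_norm_zero[of "bmul B ?p d" "bstar B d"] kill[OF p] mult[of ?p] p d
    by (simp add: star_closed star_proj rng_inv proj_base)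
  then have "bnorm B ?p = 0"
    using norm_star_mult[OF p(1)] star_p by simp
  then have "bnorm B d = 0" using norm_mult_star[OF d(1)] by simp
  then show "x = y" using x y xy by (simp add: d_def norm_sub_eq_zero)
qed

text \<open>The left version for the adjoints of \<open>x\<close> and \<open>y\<close>; this is why \<open>S\<close> is taken closed under the involution.\<close>

lemma right_mult_separates:
  assumes x: "x \<in> tot" and y: "y \<in> tot" and xy: "bproj B x = bproj B y"
    and S: "S \<subseteq> carr (fibre_algebra B (gsrc G (bproj B x)))" "\<And>a. a \<in> S \<Longrightarrow> bstar B a \<in> S"
    and total: "total_set (fibre_algebra B (gsrc G (bproj B x))) S"
    and eq: "\<And>a. a \<in> S \<Longrightarrow> bmul B x a = bmul B y a"
  shows "x = y"
proof -
  have u: "gsrc G (bproj B x) \<in> units G" using x by (simp add: src_unit proj_base)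
  have r: "grng G (bproj B (bstar B x)) = gsrc G (bproj B x)"
    using x by (simp add: star_proj rng_inv proj_base)
  have "bstar B x = bstar B y"
  proof (rule left_mult_separates)
    show "S \<subseteq> carr (fibre_algebra B (grng G (bproj B (bstar B x))))" unfolding r by (rule S(1))
    show "total_set (fibre_algebra B (grng G (bproj B (bstar B x)))) S" unfolding r by (rule total)
    fix a assume a: "a \<in> S"
    then have a': "a \<in> tot" "bproj B a = gsrc G (bproj B x)"
      and s: "bstar B a \<in> S" "bstar B a \<in> tot" "bproj B (bstar B a) = gsrc G (bproj B x)"
      using S by auto
    have swap: "bmul B a (bstar B w) = bstar B (bmul B w (bstar B a))"
      if "w \<in> tot" "gsrc G (bproj B w) = gsrc G (bproj B x)" for w
      using star_mult[OF that(1) s(2)] that(2) s(3) unit_rng[OF u] star_star[OF a'(1)] by simp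
    show "bmul B a (bstar B x) = bmul B a (bstar B y)"
      unfolding swap[OF x refl] swap[OF y arg_cong[OF xy[symmetric]]] eq[OF s(1)] ..
  qed (use x y xy in \<open>simp_all add: star_closed star_proj\<close>)
  then have "bstar B (bstar B x) = bstar B (bstar B y)" by (rule arg_cong)
  then show ?thesis unfolding star_star[OF x] star_star[OF y] .
qed

end


section \<open>Consequences of the axioms of an equivalence\<close>

locale equivalent_fell_bundles =
  B: fell_bundle G B + C: fell_bundle H C + E: fell_equivalence G H Z B C E
  for G :: "'g groupoid" and H :: "'h groupoid" and Z :: "('g, 'z, 'h) bispace"
    and B :: "('b, 'g) star_bundle" and C :: "('c, 'h) star_bundle"
    and E :: "('e, 'z, 'b, 'c) bibundle"

sublocale equivalent_fell_bundles \<subseteq> equivalent_groupoids G H Z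
  by (intro equivalent_groupoids.intro equivalent_groupoids_axioms.intro B.lch_groupoid_axioms
      C.lch_groupoid_axioms E.base_equivalence)

context equivalent_fell_bundles
begin

abbreviation totB ("\<B>") where "\<B> \<equiv> topspace (btop B)"
abbreviation totC ("\<C>") where "\<C> \<equiv> topspace (btop C)"
abbreviation totE ("\<E>") where "\<E> \<equiv> topspace (btop E)"

lemmas proj_base = B.proj_base C.proj_base E.proj_base

lemma left_module: "z \<in> \<Z> \<Longrightarrow> full_left_hilbert_module (fibre_algebra B (zrng Z z)) (fibre E z)
    (eleft E) (lip E)"
  using E.fibre_imprimitivity by (auto simp: imprimitivity_bimodule_def)

lemma right_module: "z \<in> \<Z> \<Longrightarrow> full_right_hilbert_module (fibre_algebra C (zsrc Z z)) (fibre E z)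
    (eright E) (rip E)"
  using E.fibre_imprimitivity by (auto simp: imprimitivity_bimodule_def)

lemma norm_lip: "e \<in> \<E> \<Longrightarrow> bnorm B (lip E e e) = (bnorm E e)\<^sup>2"
  using full_left_hilbert_module.norm_ip[OF left_module[OF E.proj_base], of e e] by simp

lemma norm_rip: "e \<in> \<E> \<Longrightarrow> bnorm C (rip E e e) = (bnorm E e)\<^sup>2"
  using full_right_hilbert_module.norm_ip[OF right_module[OF E.proj_base], of e e] by simp

lemma lip_full: "z \<in> \<Z> \<Longrightarrow> total_set (fibre_algebra B (zrng Z z))
    {lip E e f | e f. e \<in> carr (fibre E z) \<and> f \<in> carr (fibre E z)}"
  using full_left_hilbert_module.full[OF left_module] by blast

lemma rip_full: "z \<in> \<Z> \<Longrightarrow> total_set (fibre_algebra C (zsrc Z z))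
    {rip E e f | e f. e \<in> carr (fibre E z) \<and> f \<in> carr (fibre E z)}"
  using full_right_hilbert_module.full[OF right_module] by blast

text \<open>The difference \<open>d\<close> of the two elements satisfies \<open>\<langle>d, d\<rangle> = 0\<close>, and \<open>\<parallel>d\<parallel>\<^sup>2 = \<parallel>\<langle>d, d\<rangle>\<parallel>\<close>.\<close>

lemma lip_separates:
  assumes e: "e \<in> \<E>" and e': "e' \<in> \<E>" and proj: "bproj E e = bproj E e'"
    and eq: "\<And>f. f \<in> \<E> \<Longrightarrow> zsrc Z (bproj E e') = zsrc Z (bproj E f) \<Longrightarrow> lip E e f = lip E e' f"
  shows "e = e'"
proof -
  define d where "d = E.bsub e e'"
  have d: "d \<in> \<E>" "bproj E d = bproj E e'"
    using e e' proj by (simp_all add: d_def E.sub_closed E.sub_proj)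
  have "lip E d d = badd B (lip E e d) (bscale B (-1) (lip E e' d))"
    using e e' proj d
    by (subst (1) d_def) (simp add: E.bsub_def E.lip_add_left E.lip_scale_left E.scale_closed E.scale_proj)
  also have "\<dots> = B.bsub (lip E e' d) (lip E e' d)"
    using eq[OF d(1)] d(2) by (simp add: B.bsub_def)
  also have "bnorm B \<dots> = 0"
    using e' d by (simp add: B.norm_sub_eq_zero E.lip_closed)
  finally have "bnorm E d = 0" using norm_lip[OF d(1)] by simp
  then show ?thesis using e e' proj by (simp add: d_def E.norm_sub_eq_zero)
qed

lemma rip_separates:
  assumes e: "e \<in> \<E>" and e': "e' \<in> \<E>" and proj: "bproj E e = bproj E e'"
    and eq: "\<And>f. f \<in> \<E> \<Longrightarrow> zrng Z (bproj E f) = zrng Z (bproj E e') \<Longrightarrow> rip E f e = rip E f e'"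
  shows "e = e'"
proof -
  define d where "d = E.bsub e e'"
  have d: "d \<in> \<E>" "bproj E d = bproj E e'"
    using e e' proj by (simp_all add: d_def E.sub_closed E.sub_proj)
  have "rip E d d = badd C (rip E d e) (bscale C (-1) (rip E d e'))"
    using e e' proj d
    by (subst (2) d_def) (simp add: E.bsub_def E.rip_add_right E.rip_scale_right E.scale_closed E.scale_proj)
  also have "\<dots> = C.bsub (rip E d e') (rip E d e')"
    using eq[OF d(1)] d(2) by (simp add: C.bsub_def)
  also have "bnorm C \<dots> = 0"
    using e' d by (simp add: C.norm_sub_eq_zero E.rip_closed)
  finally have "bnorm E d = 0" using norm_rip[OF d(1)] by simp
  then show ?thesis using e e' proj by (simp add: d_def E.norm_sub_eq_zero)
qed

subsection \<open>Bilinearity of the actions\<close>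

text \<open>The axioms give bilinearity only for elements over units. In general, the two sides of each law
  have the same inner products with all elements over the same source, or the same range.\<close>

lemma left_zrng: "\<lbrakk>b \<in> \<B>; e \<in> \<E>; gsrc G (bproj B b) = zrng Z (bproj E e)\<rbrakk>
    \<Longrightarrow> zrng Z (bproj E (eleft E b e)) = grng G (bproj B b)"
  and left_zsrc: "\<lbrakk>b \<in> \<B>; e \<in> \<E>; gsrc G (bproj B b) = zrng Z (bproj E e)\<rbrakk>
    \<Longrightarrow> zsrc Z (bproj E (eleft E b e)) = zsrc Z (bproj E e)"
  by (simp_all add: E.left_proj L.moment_act zsrc_left proj_base)

lemma right_zrng: "\<lbrakk>e \<in> \<E>; c \<in> \<C>; zsrc Z (bproj E e) = grng H (bproj C c)\<rbrakk>
    \<Longrightarrow> zrng Z (bproj E (eright E e c)) = zrng Z (bproj E e)"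
  and right_zsrc: "\<lbrakk>e \<in> \<E>; c \<in> \<C>; zsrc Z (bproj E e) = grng H (bproj C c)\<rbrakk>
    \<Longrightarrow> zsrc Z (bproj E (eright E e c)) = gsrc H (bproj C c)"
  by (simp_all add: E.right_proj R.moment_act zrng_right proj_base)

lemma lip_sides: "\<lbrakk>e \<in> \<E>; f \<in> \<E>; zsrc Z (bproj E e) = zsrc Z (bproj E f)\<rbrakk>
    \<Longrightarrow> grng G (bproj B (lip E e f)) = zrng Z (bproj E e)"
  "\<lbrakk>e \<in> \<E>; f \<in> \<E>; zsrc Z (bproj E e) = zsrc Z (bproj E f)\<rbrakk>
    \<Longrightarrow> gsrc G (bproj B (lip E e f)) = zrng Z (bproj E f)"
  by (simp_all add: E.lip_proj lbr proj_base)

lemma rip_sides: "\<lbrakk>e \<in> \<E>; f \<in> \<E>; zrng Z (bproj E e) = zrng Z (bproj E f)\<rbrakk>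
    \<Longrightarrow> grng H (bproj C (rip E e f)) = zsrc Z (bproj E e)"
  "\<lbrakk>e \<in> \<E>; f \<in> \<E>; zrng Z (bproj E e) = zrng Z (bproj E f)\<rbrakk>
    \<Longrightarrow> gsrc H (bproj C (rip E e f)) = zsrc Z (bproj E f)"
  by (simp_all add: E.rip_proj rbr proj_base)

lemmas left_facts = E.left_closed E.left_proj E.add_closed E.add_proj E.scale_closed E.scale_proj
  B.add_closed B.add_proj B.scale_closed B.scale_proj zsrc_left proj_base E.lip_left[symmetric]
  E.lip_add_left E.lip_scale_left E.lip_closed lip_sides

lemma left_add_left: "\<lbrakk>a \<in> \<B>; b \<in> \<B>; e \<in> \<E>; bproj B a = bproj B b; gsrc G (bproj B a) = zrng Z (bproj E e)\<rbrakk>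
    \<Longrightarrow> eleft E (badd B a b) e = badd E (eleft E a e) (eleft E b e)"
  by (rule lip_separates) (simp_all add: left_facts B.mult_add_left)

lemma left_add_right: "\<lbrakk>b \<in> \<B>; e \<in> \<E>; f \<in> \<E>; bproj E e = bproj E f; gsrc G (bproj B b) = zrng Z (bproj E e)\<rbrakk>
    \<Longrightarrow> eleft E b (badd E e f) = badd E (eleft E b e) (eleft E b f)"
  by (rule lip_separates) (simp_all add: left_facts B.mult_add_right E.lip_proj lbr)

lemma left_scale_left: "\<lbrakk>b \<in> \<B>; e \<in> \<E>; gsrc G (bproj B b) = zrng Z (bproj E e)\<rbrakk>
    \<Longrightarrow> eleft E (bscale B \<alpha> b) e = bscale E \<alpha> (eleft E b e)"
  by (rule lip_separates) (simp_all add: left_facts B.mult_scale_left)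

lemma left_scale_right: "\<lbrakk>b \<in> \<B>; e \<in> \<E>; gsrc G (bproj B b) = zrng Z (bproj E e)\<rbrakk>
    \<Longrightarrow> eleft E b (bscale E \<alpha> e) = bscale E \<alpha> (eleft E b e)"
  by (rule lip_separates) (simp_all add: left_facts B.mult_scale_right)

lemmas right_facts = E.right_closed E.right_proj E.add_closed E.add_proj E.scale_closed E.scale_proj
  C.add_closed C.add_proj C.scale_closed C.scale_proj zrng_right proj_base E.rip_right[symmetric]
  E.rip_add_right E.rip_scale_right E.rip_closed rip_sides

lemma right_add_left: "\<lbrakk>e \<in> \<E>; f \<in> \<E>; c \<in> \<C>; bproj E e = bproj E f; zsrc Z (bproj E e) = grng H (bproj C c)\<rbrakk>
    \<Longrightarrow> eright E (badd E e f) c = badd E (eright E e c) (eright E f c)"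
  by (rule rip_separates) (simp_all add: right_facts C.mult_add_left E.rip_proj rbr)

lemma right_add_right: "\<lbrakk>e \<in> \<E>; c \<in> \<C>; d \<in> \<C>; bproj C c = bproj C d; zsrc Z (bproj E e) = grng H (bproj C c)\<rbrakk>
    \<Longrightarrow> eright E e (badd C c d) = badd E (eright E e c) (eright E e d)"
  by (rule rip_separates) (simp_all add: right_facts C.mult_add_right)

lemma right_scale_left: "\<lbrakk>e \<in> \<E>; c \<in> \<C>; zsrc Z (bproj E e) = grng H (bproj C c)\<rbrakk>
    \<Longrightarrow> eright E (bscale E \<alpha> e) c = bscale E \<alpha> (eright E e c)"
  by (rule rip_separates) (simp_all add: right_facts C.mult_scale_left)

lemma right_scale_right: "\<lbrakk>e \<in> \<E>; c \<in> \<C>; zsrc Z (bproj E e) = grng H (bproj C c)\<rbrakk>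
    \<Longrightarrow> eright E e (bscale C \<alpha> c) = bscale E \<alpha> (eright E e c)"
  by (rule rip_separates) (simp_all add: right_facts C.mult_scale_right)

subsection \<open>Adjoints of the actions\<close>

lemma star_sides:
  "b \<in> \<B> \<Longrightarrow> grng G (bproj B (bstar B b)) = gsrc G (bproj B b)"
  "b \<in> \<B> \<Longrightarrow> gsrc G (bproj B (bstar B b)) = grng G (bproj B b)"
  "c \<in> \<C> \<Longrightarrow> grng H (bproj C (bstar C c)) = gsrc H (bproj C c)"
  "c \<in> \<C> \<Longrightarrow> gsrc H (bproj C (bstar C c)) = grng H (bproj C c)"
  by (simp_all add: B.star_proj C.star_proj B.rng_inv B.src_inv C.rng_inv C.src_inv proj_base)

text \<open>The adjoint of the axiom that moves an element of \<open>\<B>\<close> into the left argument.\<close>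

lemma lip_mult:
  assumes "e \<in> \<E>" "f \<in> \<E>" "b \<in> \<B>" "zsrc Z (bproj E e) = zsrc Z (bproj E f)"
    "grng G (bproj B b) = zrng Z (bproj E f)"
  shows "bmul B (lip E e f) b = lip E e (eleft E (bstar B b) f)"
proof -
  have "lip E e (eleft E (bstar B b) f) = bstar B (lip E (eleft E (bstar B b) f) e)"
    using assms by (simp add: E.lip_star E.left_closed left_zsrc B.star_closed star_sides)
  also have "\<dots> = bstar B (bmul B (bstar B b) (lip E f e))"
    using assms by (simp add: E.lip_left B.star_closed star_sides)
  also have "\<dots> = bmul B (lip E e f) b"
    using assms
    by (simp add: B.star_mult B.star_closed star_sides lip_sides E.lip_closed E.lip_star B.star_star)
  finally show ?thesis by simp
qed

lemma rip_mult:
  assumes "e \<in> \<E>" "f \<in> \<E>" "c \<in> \<C>" "zrng Z (bproj E e) = zrng Z (bproj E f)"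
    "gsrc H (bproj C c) = zsrc Z (bproj E e)"
  shows "bmul C c (rip E e f) = rip E (eright E e (bstar C c)) f"
proof -
  have "rip E (eright E e (bstar C c)) f = bstar C (rip E f (eright E e (bstar C c)))"
    using assms by (simp add: E.rip_star E.right_closed right_zrng C.star_closed star_sides)
  also have "\<dots> = bstar C (bmul C (rip E f e) (bstar C c))"
    using assms by (simp add: E.rip_right C.star_closed star_sides)
  also have "\<dots> = bmul C c (rip E e f)"
    using assms
    by (simp add: C.star_mult C.star_closed star_sides rip_sides E.rip_closed E.rip_star C.star_star)
  finally show ?thesis by simp
qed

text \<open>Right inner products \<open>\<langle>x, y\<rangle>\<close> with \<open>x\<close>, \<open>y\<close> in one fibre are total, so it suffices to compare the two
  sides after multiplication with them. This turns right inner products into left ones, by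
  \<open>\<langle>x, y\<rangle> \<langle>e, f\<rangle> = \<langle>x, \<^sub>B\<langle>y, e\<rangle> f\<rangle>\<close>, and for the left ones the rule for moving \<open>b\<close> is known.\<close>

lemma rip_left_adjoint:
  assumes b: "b \<in> \<B>" and e: "e \<in> \<E>" and f: "f \<in> \<E>"
    and be: "zrng Z (bproj E e) = grng G (bproj B b)" and bf: "gsrc G (bproj B b) = zrng Z (bproj E f)"
  shows "rip E (eleft E (bstar B b) e) f = rip E e (eleft E b f)"
proof -
  let ?w = "eleft E (bstar B b) e"
  have w: "?w \<in> \<E>" "zrng Z (bproj E ?w) = zrng Z (bproj E f)" "zsrc Z (bproj E ?w) = zsrc Z (bproj E e)"
    using assms by (simp_all add: E.left_closed B.star_closed star_sides left_zrng left_zsrc)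
  have v: "eleft E b f \<in> \<E>" "zrng Z (bproj E (eleft E b f)) = zrng Z (bproj E e)"
    using assms by (simp_all add: E.left_closed left_zrng)
  have sides: "grng H (bproj C (rip E ?w f)) = zsrc Z (bproj E ?w)"
    using w f by (simp add: rip_sides)
  show ?thesis
  proof (rule C.left_mult_separates)
    show "rip E ?w f \<in> \<C>" "rip E e (eleft E b f) \<in> \<C>" using w v e f by (simp_all add: E.rip_closed)
    show "bproj C (rip E ?w f) = bproj C (rip E e (eleft E b f))"
      using assms w v
      by (simp add: E.rip_proj E.left_proj B.star_closed B.src_inv B.star_proj rbr_zleft proj_base)
    show "total_set (fibre_algebra C (grng H (bproj C (rip E ?w f))))
        {rip E x y | x y. x \<in> carr (fibre E (bproj E ?w)) \<and> y \<in> carr (fibre E (bproj E ?w))}"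
      unfolding sides by (rule rip_full[OF E.proj_base[OF w(1)]])
    show "{rip E x y | x y. x \<in> carr (fibre E (bproj E ?w)) \<and> y \<in> carr (fibre E (bproj E ?w))}
        \<subseteq> carr (fibre_algebra C (grng H (bproj C (rip E ?w f))))"
      unfolding sides using w(1) by (auto simp: E.rip_closed E.rip_proj rbr_self E.proj_base)
    fix a assume "a \<in> {rip E x y | x y. x \<in> carr (fibre E (bproj E ?w)) \<and> y \<in> carr (fibre E (bproj E ?w))}"
    then obtain x y where xy: "a = rip E x y" "x \<in> \<E>" "y \<in> \<E>" "bproj E x = bproj E ?w"
      "bproj E y = bproj E ?w" by auto
    have "bmul C a (rip E ?w f) = rip E x (eleft E (lip E y ?w) f)"
      using xy w f by (simp add: E.rip_right E.rip_closed rip_sides E.lip_rip)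
    also have "lip E y ?w = bmul B (lip E y e) b"
      using xy w e b be by (simp add: lip_mult)
    also have "eleft E \<dots> f = eleft E (lip E y e) (eleft E b f)"
      using xy w e b be bf f by (simp add: E.left_left E.lip_closed lip_sides)
    also have "rip E x \<dots> = bmul C a (rip E e (eleft E b f))"
      using xy w v e f by (simp add: E.rip_right E.rip_closed rip_sides E.lip_rip)
    finally show "bmul C a (rip E ?w f) = bmul C a (rip E e (eleft E b f))" .
  qed
qed

text \<open>The mirror image: left inner products are total and are multiplied from the right.\<close>

lemma lip_right_adjoint:
  assumes c: "c \<in> \<C>" and e: "e \<in> \<E>" and f: "f \<in> \<E>"
    and ec: "zsrc Z (bproj E e) = grng H (bproj C c)" and cf: "gsrc H (bproj C c) = zsrc Z (bproj E f)"
  shows "lip E (eright E e c) f = lip E e (eright E f (bstar C c))"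
proof -
  let ?w = "eright E e c" and ?v = "eright E f (bstar C c)"
  have w: "?w \<in> \<E>" "zrng Z (bproj E ?w) = zrng Z (bproj E e)" "zsrc Z (bproj E ?w) = zsrc Z (bproj E f)"
    using assms by (simp_all add: E.right_closed right_zrng right_zsrc)
  have v: "?v \<in> \<E>" "zsrc Z (bproj E e) = zsrc Z (bproj E ?v)" "zrng Z (bproj E ?v) = zrng Z (bproj E f)"
    using assms by (simp_all add: E.right_closed C.star_closed star_sides right_zsrc right_zrng)
  have sides: "gsrc G (bproj B (lip E ?w f)) = zrng Z (bproj E f)"
    using w f by (simp add: lip_sides)
  show ?thesis
  proof (rule B.right_mult_separates)
    let ?S = "{lip E x y | x y. x \<in> carr (fibre E (bproj E f)) \<and> y \<in> carr (fibre E (bproj E f))}"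
    show "lip E ?w f \<in> \<B>" "lip E e ?v \<in> \<B>" using w v e f by (simp_all add: E.lip_closed)
    show "bproj B (lip E ?w f) = bproj B (lip E e ?v)"
      using assms w v
      by (simp add: E.lip_proj E.right_proj C.star_closed C.rng_inv C.star_proj lbr_zright proj_base)
    show "total_set (fibre_algebra B (gsrc G (bproj B (lip E ?w f)))) ?S"
      unfolding sides by (rule lip_full[OF E.proj_base[OF f]])
    show "?S \<subseteq> carr (fibre_algebra B (gsrc G (bproj B (lip E ?w f))))"
      unfolding sides using f by (auto simp: E.lip_closed E.lip_proj lbr_self E.proj_base)
    show "bstar B a \<in> ?S" if "a \<in> ?S" for a
      using that E.lip_star by fastforce
    fix a assume "a \<in> ?S"
    then obtain x y where xy: "a = lip E x y" "x \<in> \<E>" "y \<in> \<E>" "bproj E x = bproj E f"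
      "bproj E y = bproj E f" by auto
    have "bmul B (lip E ?w f) a = lip E (eright E ?w (rip E f x)) y"
      using xy w f by (simp add: E.lip_left E.lip_closed lip_sides E.lip_rip)
    also have "eright E ?w (rip E f x) = eright E e (bmul C c (rip E f x))"
      using xy e c ec cf f by (simp add: E.right_right E.rip_closed rip_sides)
    also have "bmul C c (rip E f x) = rip E ?v x"
      using xy f c cf by (simp add: rip_mult)
    also have "lip E (eright E e \<dots>) y = bmul B (lip E e ?v) a"
      using xy v e f by (simp add: E.lip_left E.lip_closed lip_sides E.lip_rip)
    finally show "bmul B (lip E ?w f) a = bmul B (lip E e ?v) a" .
  qed
qed

end

section \<open>Fell bundles from their left inner products\<close>

lemma (in fell_bundle) norm_star:
  assumes "b \<in> topspace (btop B)"
  shows "bnorm B (bstar B b) = bnorm B b"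
proof -
  have "(bnorm B (bstar B b))\<^sup>2 = (bnorm B b)\<^sup>2"
    using norm_mult_star[OF star_closed[OF assms]] norm_star_mult[OF assms] star_star[OF assms]
    by simp
  then show ?thesis
    using norm_nonneg[OF assms] norm_nonneg[OF star_closed[OF assms]] by simp
qed

text \<open>The algebraic axioms of \<^locale>\<open>fell_bundle\<close>, without those on the fibres. All equations
  of an imprimitivity bimodule follow from them, and the involution exchanges the two inner products,
  so that of the bimodule axioms only positivity, norm and fullness of the left one remain to be checked.\<close>

locale star_bundle_laws = lch_groupoid G + usc_banach_bundle "gtop G" B
  for G :: "'g groupoid" and B :: "('b, 'g) star_bundle" +
  assumes mult_closed: "\<lbrakk>a \<in> tot; b \<in> tot;
            gsrc G (bproj B a) = grng G (bproj B b)\<rbrakk>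
          \<Longrightarrow> bmul B a b \<in> tot"
    and mult_proj: "\<lbrakk>a \<in> tot; b \<in> tot;
            gsrc G (bproj B a) = grng G (bproj B b)\<rbrakk>
          \<Longrightarrow> bproj B (bmul B a b) = gmul G (bproj B a) (bproj B b)"
    and mult_continuous: "continuous_map
          (subtopology (prod_topology (btop B) (btop B))
            {(a, b). gsrc G (bproj B a) = grng G (bproj B b)})
          (btop B) (\<lambda>(a, b). bmul B a b)"
    and mult_add_left: "\<lbrakk>a \<in> tot; a' \<in> tot; b \<in> tot;
            bproj B a = bproj B a'; gsrc G (bproj B a) = grng G (bproj B b)\<rbrakk>
          \<Longrightarrow> bmul B (badd B a a') b = badd B (bmul B a b) (bmul B a' b)"
    and mult_add_right: "\<lbrakk>a \<in> tot; b \<in> tot; b' \<in> tot;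
            bproj B b = bproj B b'; gsrc G (bproj B a) = grng G (bproj B b)\<rbrakk>
          \<Longrightarrow> bmul B a (badd B b b') = badd B (bmul B a b) (bmul B a b')"
    and mult_scale_left: "\<lbrakk>a \<in> tot; b \<in> tot;
            gsrc G (bproj B a) = grng G (bproj B b)\<rbrakk>
          \<Longrightarrow> bmul B (bscale B \<alpha> a) b = bscale B \<alpha> (bmul B a b)"
    and mult_scale_right: "\<lbrakk>a \<in> tot; b \<in> tot;
            gsrc G (bproj B a) = grng G (bproj B b)\<rbrakk>
          \<Longrightarrow> bmul B a (bscale B \<alpha> b) = bscale B \<alpha> (bmul B a b)"
    and mult_assoc: "\<lbrakk>a \<in> tot; b \<in> tot; c \<in> tot;
            gsrc G (bproj B a) = grng G (bproj B b); gsrc G (bproj B b) = grng G (bproj B c)\<rbrakk>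
          \<Longrightarrow> bmul B (bmul B a b) c = bmul B a (bmul B b c)"
    and star_closed: "a \<in> tot \<Longrightarrow> bstar B a \<in> tot"
    and star_proj: "a \<in> tot \<Longrightarrow> bproj B (bstar B a) = ginv G (bproj B a)"
    and star_continuous: "continuous_map (btop B) (btop B) (bstar B)"
    and star_star: "a \<in> tot \<Longrightarrow> bstar B (bstar B a) = a"
    and star_add: "\<lbrakk>a \<in> tot; b \<in> tot; bproj B a = bproj B b\<rbrakk>
          \<Longrightarrow> bstar B (badd B a b) = badd B (bstar B a) (bstar B b)"
    and star_scale: "a \<in> tot
          \<Longrightarrow> bstar B (bscale B \<alpha> a) = bscale B (cnj \<alpha>) (bstar B a)"
    and star_mult: "\<lbrakk>a \<in> tot; b \<in> tot;
            gsrc G (bproj B a) = grng G (bproj B b)\<rbrakk>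
          \<Longrightarrow> bstar B (bmul B a b) = bmul B (bstar B b) (bstar B a)"
begin

lemma star_sides:
  "a \<in> tot \<Longrightarrow> grng G (bproj B (bstar B a)) = gsrc G (bproj B a)"
  "a \<in> tot \<Longrightarrow> gsrc G (bproj B (bstar B a)) = grng G (bproj B a)"
  by (simp_all add: star_proj rng_inv src_inv proj_base)

theorem fell_bundleI:
  assumes cstar: "\<And>u. u \<in> units G \<Longrightarrow> cstar_algebra (fibre_algebra B u)"
    and norm_star: "\<And>b. b \<in> tot \<Longrightarrow> bnorm B (bstar B b) = bnorm B b"
    and positive: "\<And>b. b \<in> tot \<Longrightarrow>
      positive_elem (fibre_algebra B (grng G (bproj B b))) (bmul B b (bstar B b))"
    and norm: "\<And>b. b \<in> tot \<Longrightarrow> bnorm B (bmul B b (bstar B b)) = (bnorm B b)\<^sup>2"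
    and full: "\<And>g. g \<in> topspace (gtop G) \<Longrightarrow> total_set (fibre_algebra B (grng G g))
      {bmul B a (bstar B b) | a b. a \<in> carr (fibre B g) \<and> b \<in> carr (fibre B g)}"
  shows "fell_bundle G B"
proof -
  have imprimitivity: "imprimitivity_bimodule (fibre_algebra B (grng G g)) (fibre_algebra B (gsrc G g))
      (fibre B g) (bmul B) (bmul B) (\<lambda>a b. bmul B a (bstar B b)) (\<lambda>a b. bmul B (bstar B a) b)"
    if g: "g \<in> topspace (gtop G)" for g
  proof -
    note unit = rng_unit[OF g] src_unit[OF g]
    have inv: "grng G (ginv G g) = gsrc G g" "ginv G (ginv G g) = g"
      using g inv_unique[of "ginv G g" g] by (simp_all add: rng_inv src_inv inv_closed inv_mul)
    \<comment> \<open>The involution maps the fibre over \<open>g\<close> onto the fibre over its inverse.\<close>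
    have full_right: "total_set (fibre_algebra B (gsrc G g))
        {bmul B (bstar B a) b | a b. a \<in> carr (fibre B g) \<and> b \<in> carr (fibre B g)}"
    proof -
      have "{bmul B (bstar B a) b | a b. a \<in> carr (fibre B g) \<and> b \<in> carr (fibre B g)}
          = {bmul B a (bstar B b) | a b. a \<in> carr (fibre B (ginv G g)) \<and> b \<in> carr (fibre B (ginv G g))}"
        (is "?R = ?L")
      proof
        show "?R \<subseteq> ?L"
        proof clarify
          fix a b assume "a \<in> carr (fibre B g)" "b \<in> carr (fibre B g)"
          then show "\<exists>a' b'. bmul B (bstar B a) b = bmul B a' (bstar B b') \<and>
              a' \<in> carr (fibre B (ginv G g)) \<and> b' \<in> carr (fibre B (ginv G g))"
            by (intro exI[of _ "bstar B a"] exI[of _ "bstar B b"])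
              (simp add: star_star star_closed star_proj)
        qed
        show "?L \<subseteq> ?R"
        proof clarify
          fix a b assume "a \<in> carr (fibre B (ginv G g))" "b \<in> carr (fibre B (ginv G g))"
          then show "\<exists>a' b'. bmul B a (bstar B b) = bmul B (bstar B a') b' \<and>
              a' \<in> carr (fibre B g) \<and> b' \<in> carr (fibre B g)"
            by (intro exI[of _ "bstar B a"] exI[of _ "bstar B b"])
              (simp add: star_star star_closed star_proj inv)
        qed
      qed
      then show ?thesis using full[OF inv_closed[OF g]] inv(1) by simp
    qed
    have right: "positive_elem (fibre_algebra B (gsrc G g)) (bmul B (bstar B b) b)"
      "bnorm B (bmul B (bstar B b) b) = (bnorm B b)\<^sup>2"
      if "b \<in> tot" "bproj B b = g" for b
      using positive[OF star_closed[OF that(1)]] norm[OF star_closed[OF that(1)]] that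
      by (simp_all add: star_star star_sides norm_star)
    note facts = mult_closed mult_proj mult_assoc mult_add_left mult_add_right mult_scale_left
      mult_scale_right star_closed star_proj star_star star_add star_scale star_mult
      rng_rng src_rng rng_src src_src rng_inv src_inv mul_rng mul_src mul_inv inv_mul inv_closed
      rng_closed src_closed mul_closed rng_mul src_mul
      add_closed add_proj scale_closed scale_proj unit_inv[OF unit(1)] unit_inv[OF unit(2)]
    show ?thesis
    proof (intro imprimitivity_bimodule.intro full_left_hilbert_module.intro
        full_right_hilbert_module.intro full_left_hilbert_module_axioms.intro
        full_right_hilbert_module_axioms.intro imprimitivity_bimodule_axioms.intro
        cstar unit fibre_banach g full full_right)
    qed (use g in \<open>auto simp: facts right norm positive\<close>)
  qed
  show ?thesis
    by (intro fell_bundle.intro fell_bundle_axioms.intro lch_groupoid_axioms usc_banach_bundle_axioms)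
      (rule imprimitivity cstar mult_closed mult_proj mult_continuous mult_add_left mult_add_right
        mult_scale_left mult_scale_right mult_assoc star_closed star_proj star_continuous star_star
        star_add star_scale star_mult; assumption)+
qed

end


section \<open>The linking bundle as a Banach bundle\<close>

text \<open>\<open>\<B>\<close>, \<open>\<E>\<close>, \<open>\<E>\<^sup>o\<^sup>p\<close> and \<open>\<C>\<close> enter the linking bundle in the same way: as open pieces \<open>j\<close> over
  open pieces \<open>i\<close> of the base, (conjugate) linear and isometric on fibres.\<close>

locale bundle_piece = P: usc_banach_bundle X P
  for X :: "'x topology" and P :: "('p, 'x, 'm) banach_bundle_scheme" +
  fixes Y :: "'y topology" and Q :: "('q, 'y) star_bundle"
    and i :: "'x \<Rightarrow> 'y" and j :: "'p \<Rightarrow> 'q" and \<kappa> :: "complex \<Rightarrow> complex"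
  assumes kappa: "\<kappa> = id \<or> \<kappa> = cnj"
    and base_open: "open_map X Y i" and base_inj: "inj i"
    and total_open: "open_map (btop P) (btop Q) j" and total_inj: "inj j"
    and total_continuous: "continuous_map (btop P) (btop Q) j"
    and total_iff: "j b \<in> topspace (btop Q) \<longleftrightarrow> b \<in> topspace (btop P)"
    and over: "bproj Q q = i x \<Longrightarrow> \<exists>b. q = j b"
    and map_proj: "bproj Q (j b) = i (bproj P b)"
    and map_zero: "bzero Q (i x) = j (bzero P x)"
    and map_add: "badd Q (j a) (j b) = j (badd P a b)"
    and map_scale: "bscale Q \<alpha> (j b) = j (bscale P (\<kappa> \<alpha>) b)"
    and map_norm: "bnorm Q (j b) = bnorm P b"
begin

lemma fibre_image: "{q \<in> topspace (btop Q). bproj Q q = i x} = j ` carr (fibre P x)"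
proof
  show "{q \<in> topspace (btop Q). bproj Q q = i x} \<subseteq> j ` carr (fibre P x)"
  proof
    fix q assume q: "q \<in> {q \<in> topspace (btop Q). bproj Q q = i x}"
    then obtain b where "q = j b" using over by blast
    then show "q \<in> j ` carr (fibre P x)"
      using q base_inj by (auto simp: total_iff map_proj inj_eq)
  qed
qed (auto simp: total_iff map_proj)

lemma fibre_isometry:
  assumes "x \<in> topspace X"
  shows "semilinear_isometry (fibre P x) (fibre Q (i x)) \<kappa> j"
    and "semilinear_isometry (fibre P x) (fibre_algebra Q (i x)) \<kappa> j"
proof -
  have "bij_betw j (carr (fibre P x)) {q \<in> topspace (btop Q). bproj Q q = i x}"
    unfolding fibre_image by (intro inj_on_imp_bij_betw inj_on_subset[OF total_inj]) simp
  then show "semilinear_isometry (fibre P x) (fibre Q (i x)) \<kappa> j"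
    "semilinear_isometry (fibre P x) (fibre_algebra Q (i x)) \<kappa> j"
    by (intro semilinear_isometry.intro semilinear_isometry_axioms.intro P.fibre_banach assms kappa;
        simp add: map_zero map_add map_scale map_norm)+
qed

lemmas fibre_banach = semilinear_isometry.banach_image[OF fibre_isometry(1)]

text \<open>A filter converging in the base to a point of the piece lives on the piece.\<close>

lemma norm_limit:
  assumes tot: "\<forall>\<^sub>F q in F. q \<in> topspace (btop Q)" and norm: "(bnorm Q \<longlongrightarrow> 0) F"
    and lim: "limitin Y (bproj Q) (i x) F" and x: "x \<in> topspace X"
  shows "limitin (btop Q) (\<lambda>q. q) (bzero Q (i x)) F"
proof -
  have i: "\<forall>\<^sub>F q in F. bproj Q q \<in> i ` U" if "openin X U" "x \<in> U" for U
    using lim base_open that by (auto simp: limitin_def open_map_def)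
  have j: "\<forall>\<^sub>F q in F. q = j (inv j q)"
    using i[OF openin_topspace x]
    by eventually_elim (metis imageE over total_inj inv_f_f)
  have "limitin (btop P) (inv j) (bzero P x) F"
  proof (rule P.norm_limit_along)
    show "\<forall>\<^sub>F q in F. inv j q \<in> topspace (btop P)"
      using tot j by eventually_elim (metis total_iff)
    have "\<forall>\<^sub>F q in F. bnorm Q q = bnorm P (inv j q)"
      using j by eventually_elim (metis map_norm)
    then show "((\<lambda>q. bnorm P (inv j q)) \<longlongrightarrow> 0) F"
      using norm tendsto_cong by fastforce
    show "limitin X (\<lambda>q. bproj P (inv j q)) x F"
      unfolding limitin_def
    proof (intro conjI allI impI x)
      fix U assume "openin X U \<and> x \<in> U"
      then have "\<forall>\<^sub>F q in F. bproj Q q \<in> i ` U" using i by blast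
      then show "\<forall>\<^sub>F q in F. bproj P (inv j q) \<in> U"
        using j by eventually_elim (metis map_proj inj_image_mem_iff[OF base_inj])
    qed
  qed
  then have lim: "limitin (btop P) (inv j) (bzero P x) F" .
  show ?thesis
    unfolding limitin_def
  proof (intro conjI allI impI)
    show "bzero Q (i x) \<in> topspace (btop Q)"
      using x by (simp add: map_zero total_iff P.zero_closed)
    fix U assume U: "openin (btop Q) U \<and> bzero Q (i x) \<in> U"
    then have "openin (btop P) {b \<in> topspace (btop P). j b \<in> U}"
      using openin_continuous_map_preimage[OF total_continuous] by blast
    moreover have "bzero P x \<in> {b \<in> topspace (btop P). j b \<in> U}"
      using U x by (simp add: map_zero P.zero_closed)
    ultimately have "\<forall>\<^sub>F q in F. inv j q \<in> {b \<in> topspace (btop P). j b \<in> U}"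
      using lim unfolding limitin_def by blast
    then show "\<forall>\<^sub>F q in F. q \<in> U"
      using j by eventually_elim simp
  qed
qed

end

lemma link_topspace_eq: "topspace (link_topology S T W) =
    In11 ` topspace S \<union> In12 ` topspace T \<union> In21 ` topspace T \<union> In22 ` topspace W" (is "_ = ?R")
proof -
  have "p \<in> topspace (link_topology S T W) \<longleftrightarrow> p \<in> ?R" for p by (cases p) auto
  then show ?thesis by blast
qed

lemma linking_bundle_simps [simp]:
  "btop (linking_bundle B C E) = link_topology (btop B) (btop E) (btop C)"
  "bproj (linking_bundle B C E) = map_link (bproj B) (bproj E) (bproj C)"
  "badd (linking_bundle B C E) = link_add B C E"
  "bscale (linking_bundle B C E) = link_scale B C E"
  "bzero (linking_bundle B C E) = map_link (bzero B) (bzero E) (bzero C)"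
  "bnorm (linking_bundle B C E) = link_norm B C E"
  "bmul (linking_bundle B C E) = link_bmul B C E"
  "bstar (linking_bundle B C E) = link_star B C"
  by (simp_all add: linking_bundle_def)

context equivalent_fell_bundles
begin

abbreviation LG where "LG \<equiv> linking_groupoid G H Z"
abbreviation LB where "LB \<equiv> linking_bundle B C E"

lemma map_link_eq_iff:
  "map_link f g h p = In11 x \<longleftrightarrow> (\<exists>a. p = In11 a \<and> f a = x)"
  "map_link f g h p = In12 y \<longleftrightarrow> (\<exists>a. p = In12 a \<and> g a = y)"
  "map_link f g h p = In21 y \<longleftrightarrow> (\<exists>a. p = In21 a \<and> g a = y)"
  "map_link f g h p = In22 z \<longleftrightarrow> (\<exists>a. p = In22 a \<and> h a = z)"
  by (cases p; auto)+

sublocale piece11: bundle_piece "gtop G" B "gtop LG" LB In11 In11 id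
  by unfold_locales (auto simp: link_open_map link_continuous_map map_link_eq_iff inj_def)

sublocale piece12: bundle_piece "ztop Z" E "gtop LG" LB In12 In12 id
  by unfold_locales (auto simp: link_open_map link_continuous_map map_link_eq_iff inj_def)

sublocale piece21: bundle_piece "ztop Z" E "gtop LG" LB In21 In21 cnj
  by unfold_locales (auto simp: link_open_map link_continuous_map map_link_eq_iff inj_def)

sublocale piece22: bundle_piece "gtop H" C "gtop LG" LB In22 In22 id
  by unfold_locales (auto simp: link_open_map link_continuous_map map_link_eq_iff inj_def)

lemma link_scale_continuous:
  "continuous_map (prod_topology euclidean (btop LB)) (btop LB) (\<lambda>(\<alpha>, b). bscale LB \<alpha> b)"
proof -
  have cnj: "continuous_map (prod_topology euclidean (btop E)) (prod_topology euclidean (btop E))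
      (\<lambda>(\<alpha>, e). (cnj \<alpha>, e))"
    unfolding case_prod_unfold
    using continuous_map_compose[OF continuous_map_fst, of euclidean euclidean cnj "btop E"]
    by (intro continuous_map_pairedI continuous_map_snd) (simp add: o_def continuous_on_cnj)
  \<comment> \<open>Scalars act on the opposite piece by their conjugates.\<close>
  have conj_scale: "continuous_map (prod_topology euclidean (btop E)) (btop E) (\<lambda>(\<alpha>, e). bscale E (cnj \<alpha>) e)"
    using continuous_map_compose[OF cnj E.scale_continuous] by (simp add: o_def case_prod_unfold)
  have id: "open_map euclidean euclidean (\<lambda>\<alpha> :: complex. \<alpha>)" by (simp add: open_map_def)
  have pieces:
    "continuous_on_pieces euclidean (btop B) UNIV (btop LB) (link_scale B C E) (\<lambda>\<alpha>. \<alpha>) In11"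
    "continuous_on_pieces euclidean (btop E) UNIV (btop LB) (link_scale B C E) (\<lambda>\<alpha>. \<alpha>) In12"
    "continuous_on_pieces euclidean (btop E) UNIV (btop LB) (link_scale B C E) (\<lambda>\<alpha>. \<alpha>) In21"
    "continuous_on_pieces euclidean (btop C) UNIV (btop LB) (link_scale B C E) (\<lambda>\<alpha>. \<alpha>) In22"
    using link_continuous_compose(1)[OF B.scale_continuous] link_continuous_compose(2)[OF E.scale_continuous]
      link_continuous_compose(3)[OF conj_scale] link_continuous_compose(4)[OF C.scale_continuous]
    by (simp_all add: case_prod_unfold)
  note open_pieces = link_open_map[where S = "btop B" and T = "btop E" and W = "btop C"]
  note nbhd = neighbourhoods_of_open_pieces[OF pieces(1) id open_pieces(1)]
    neighbourhoods_of_open_pieces[OF pieces(2) id open_pieces(2)]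
    neighbourhoods_of_open_pieces[OF pieces(3) id open_pieces(3)]
    neighbourhoods_of_open_pieces[OF pieces(4) id open_pieces(4)]
  have "continuous_map (subtopology (prod_topology euclidean (btop LB)) UNIV) (btop LB)
      (\<lambda>(\<alpha>, b). bscale LB \<alpha> b)"
    unfolding continuous_map_prod_subtopology_iff linking_bundle_simps
  proof (intro allI impI, elim conjE)
    fix \<alpha> :: complex and q
    assume q: "\<alpha> \<in> topspace euclidean" "q \<in> topspace (link_topology (btop B) (btop E) (btop C))" "(\<alpha>, q) \<in> UNIV"
    show "continuous_at_pair euclidean (link_topology (btop B) (btop E) (btop C)) UNIV
        (link_topology (btop B) (btop E) (btop C)) (link_scale B C E) \<alpha> q"
      by (insert q, cases q; hypsubst; unfold link_topspace linking_bundle_simps;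
          rule nbhd[unfolded linking_bundle_simps]; (assumption | rule UNIV_I))
  qed
  then show ?thesis by simp
qed

theorem linking_usc_banach_bundle: "usc_banach_bundle (gtop LG) LB"
proof -
  interpret LG: lch_groupoid LG by (rule linking_lch_groupoid)
  show ?thesis
  proof (rule usc_banach_bundle.intro)
    show "locally_compact_space (gtop LG)" "Hausdorff_space (gtop LG)"
      by (rule LG.locally_compact, rule LG.hausdorff)
    show "continuous_map (btop LB) (gtop LG) (bproj LB)"
      unfolding linking_bundle_simps linking_groupoid_simps
      by (rule continuous_map_from_link)
        (simp_all add: link_continuous_compose B.proj_continuous C.proj_continuous E.proj_continuous)
    show "open_map (btop LB) (gtop LG) (bproj LB)"
      unfolding linking_bundle_simps linking_groupoid_simps
      using open_map_compose[OF B.proj_open link_open_map(1)] open_map_compose[OF E.proj_open link_open_map(2)]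
        open_map_compose[OF E.proj_open link_open_map(3)] open_map_compose[OF C.proj_open link_open_map(4)]
      by (intro open_map_from_link) (simp_all add: o_def)
    show "bproj LB ` topspace (btop LB) = topspace (gtop LG)"
      by (simp add: link_topspace_eq image_Un image_image B.proj_surj[symmetric]
          C.proj_surj[symmetric] E.proj_surj[symmetric])
    show "banach_space (fibre LB x)" if "x \<in> topspace (gtop LG)" for x
      using that piece11.fibre_banach piece12.fibre_banach piece21.fibre_banach piece22.fibre_banach
      by (cases x) simp_all
    show "openin (btop LB) {b \<in> topspace (btop LB). bnorm LB b < t}" for t
      using B.norm_usc[of t] E.norm_usc[of t] C.norm_usc[of t]
      by (simp add: openin_link_topology vimage_def)
    show "continuous_map (subtopology (prod_topology (btop LB) (btop LB)) {(a, b). bproj LB a = bproj LB b})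
        (btop LB) (\<lambda>(a, b). badd LB a b)"
      unfolding linking_bundle_simps
    proof (rule continuous_map_link_prodI, goal_cases)
      case 1 then show ?case
        using link_continuous_compose(1)[OF B.add_continuous] by (simp add: case_prod_unfold)
    next
      case 6 then show ?case
        using link_continuous_compose(2)[OF E.add_continuous] by (simp add: case_prod_unfold)
    next
      case 11 then show ?case
        using link_continuous_compose(3)[OF E.add_continuous] by (simp add: case_prod_unfold)
    next
      case 16 then show ?case
        using link_continuous_compose(4)[OF C.add_continuous] by (simp add: case_prod_unfold)
    qed (simp_all add: continuous_map_vacuous)
    show "continuous_map (prod_topology euclidean (btop LB)) (btop LB) (\<lambda>(\<alpha>, b). bscale LB \<alpha> b)"
      by (rule link_scale_continuous)
    fix F x assume F: "\<forall>\<^sub>F b in F. b \<in> topspace (btop LB)" "(bnorm LB \<longlongrightarrow> 0) F"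
      "limitin (gtop LG) (bproj LB) x F"
    then have "x \<in> topspace (gtop LG)" by (simp add: limitin_def)
    then show "limitin (btop LB) (\<lambda>b. b) (bzero LB x) F"
      using F piece11.norm_limit[of F] piece12.norm_limit[of F] piece21.norm_limit[of F]
        piece22.norm_limit[of F]
      by (cases x) (simp_all del: linking_bundle_simps)
  qed
qed

end

section \<open>The linking bundle as a Fell bundle\<close>

context equivalent_fell_bundles
begin

lemma link_bmul_continuous:
  "continuous_map (subtopology (prod_topology (btop LB) (btop LB))
      {(a, b). gsrc LG (bproj LB a) = grng LG (bproj LB b)})
    (btop LB) (\<lambda>(a, b). bmul LB a b)"
  unfolding linking_bundle_simps linking_groupoid_simps
proof (rule continuous_map_link_prodI, goal_cases)
  case 1 then show ?case
    using link_continuous_compose(1)[OF B.mult_continuous] by (simp add: case_prod_unfold)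
next
  case 2 then show ?case
    using link_continuous_compose(2)[OF E.left_continuous] by (simp add: case_prod_unfold)
next
  case 7 then show ?case
    using link_continuous_compose(1)[OF E.lip_continuous] by (simp add: case_prod_unfold)
next
  case 8 then show ?case
    using link_continuous_compose(2)[OF E.right_continuous] by (simp add: case_prod_unfold)
next
  case 9
  have "continuous_map (subtopology (prod_topology (btop E) (btop B))
      {(e, b). zrng Z (bproj E e) = grng G (bproj B b)}) (btop E)
      (\<lambda>p. eleft E (bstar B (snd p)) (fst p))"
    using continuous_map_from_subtopology[OF continuous_map_compose[OF continuous_map_snd B.star_continuous]]
    by (intro continuous_map_binary_op[OF E.left_continuous])
      (auto simp: o_def continuous_map_from_subtopology continuous_map_fst star_sides)
  then show ?case
    using link_continuous_compose(3) by (simp add: case_prod_unfold)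
next
  case 10 then show ?case
    using link_continuous_compose(4)[OF E.rip_continuous] by (simp add: case_prod_unfold)
next
  case 15
  have "continuous_map (subtopology (prod_topology (btop C) (btop E))
      {(c, e). gsrc H (bproj C c) = zsrc Z (bproj E e)}) (btop E)
      (\<lambda>p. eright E (snd p) (bstar C (fst p)))"
    using continuous_map_from_subtopology[OF continuous_map_compose[OF continuous_map_fst C.star_continuous]]
    by (intro continuous_map_binary_op[OF E.right_continuous])
      (auto simp: o_def continuous_map_from_subtopology continuous_map_snd star_sides)
  then show ?case
    using link_continuous_compose(3) by (simp add: case_prod_unfold)
next
  case 16 then show ?case
    using link_continuous_compose(4)[OF C.mult_continuous] by (simp add: case_prod_unfold)
qed (simp_all add: continuous_map_vacuous)

text \<open>The sixteen composable types of triples: besides the axioms, associativity uses the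
  rules for moving \<open>\<B>\<close> and \<open>\<C>\<close> from one argument of an inner product to the other.\<close>

lemma link_bmul_assoc:
  assumes "a \<in> topspace (btop LB)" "b \<in> topspace (btop LB)" "c \<in> topspace (btop LB)"
    and "gsrc LG (bproj LB a) = grng LG (bproj LB b)" "gsrc LG (bproj LB b) = grng LG (bproj LB c)"
  shows "bmul LB (bmul LB a b) c = bmul LB a (bmul LB b c)"
  using assms
  by (cases a; cases b; cases c)
    (simp_all add: B.mult_assoc C.mult_assoc E.left_left E.right_right E.actions_commute
      E.lip_left E.rip_right E.lip_rip lip_mult rip_mult rip_left_adjoint lip_right_adjoint
      B.star_mult C.star_mult B.star_closed C.star_closed star_sides E.lip_star E.rip_star)

theorem linking_star_bundle_laws: "star_bundle_laws LG LB"
proof (intro star_bundle_laws.intro linking_lch_groupoid linking_usc_banach_bundle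
    star_bundle_laws_axioms.intro link_bmul_continuous link_bmul_assoc)
  note closed = B.mult_closed C.mult_closed E.left_closed E.right_closed E.lip_closed E.rip_closed
    B.star_closed C.star_closed
  fix a assume a: "a \<in> topspace (btop LB)"
  show "bstar LB a \<in> topspace (btop LB)" "bstar LB (bstar LB a) = a"
    "bproj LB (bstar LB a) = ginv LG (bproj LB a)"
    "bstar LB (bscale LB \<alpha> a) = bscale LB (cnj \<alpha>) (bstar LB a)" for \<alpha>
    using a by (cases a; simp add: closed B.star_star C.star_star B.star_proj C.star_proj B.star_scale
        C.star_scale)+
  show "bstar LB (badd LB a b) = badd LB (bstar LB a) (bstar LB b)"
    if "b \<in> topspace (btop LB)" "bproj LB a = bproj LB b" for b
    using a that by (cases a; cases b) (simp_all add: B.star_add C.star_add)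
  fix b assume b: "b \<in> topspace (btop LB)" and ab: "gsrc LG (bproj LB a) = grng LG (bproj LB b)"
  show "bmul LB a b \<in> topspace (btop LB)"
    using a b ab by (cases a; cases b) (simp_all add: closed star_sides)
  show "bproj LB (bmul LB a b) = gmul LG (bproj LB a) (bproj LB b)"
    using a b ab
    by (cases a; cases b) (simp_all add: B.mult_proj C.mult_proj E.left_proj E.right_proj E.lip_proj
        E.rip_proj closed B.star_proj C.star_proj B.src_inv C.rng_inv proj_base)
  show "bstar LB (bmul LB a b) = bmul LB (bstar LB b) (bstar LB a)"
    using a b ab
    by (cases a; cases b)
      (simp_all add: B.star_mult C.star_mult E.lip_star E.rip_star B.star_star C.star_star)
  show "bmul LB (bscale LB \<alpha> a) b = bscale LB \<alpha> (bmul LB a b)" for \<alpha>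
    using a b ab
    by (cases a; cases b) (simp_all add: B.mult_scale_left C.mult_scale_left left_scale_left
        left_scale_right right_scale_left right_scale_right E.lip_scale_left E.rip_scale_left
        C.star_scale closed star_sides)
  show "bmul LB a (bscale LB \<alpha> b) = bscale LB \<alpha> (bmul LB a b)" for \<alpha>
    using a b ab
    by (cases a; cases b) (simp_all add: B.mult_scale_right C.mult_scale_right left_scale_left
        left_scale_right right_scale_left right_scale_right E.lip_scale_right E.rip_scale_right
        B.star_scale closed star_sides)
  show "bmul LB (badd LB a a') b = badd LB (bmul LB a b) (bmul LB a' b)"
    if "a' \<in> topspace (btop LB)" "bproj LB a = bproj LB a'" for a'
    using a b ab that
    by (cases a; cases a'; cases b) (simp_all add: B.mult_add_left C.mult_add_left left_add_left
        left_add_right right_add_left right_add_right E.lip_add_left E.rip_add_left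
        C.star_add C.star_proj C.rng_inv proj_base closed star_sides)
  show "bmul LB a (badd LB b b') = badd LB (bmul LB a b) (bmul LB a b')"
    if "b' \<in> topspace (btop LB)" "bproj LB b = bproj LB b'" for b'
    using a b ab that
    by (cases a; cases b; cases b') (simp_all add: B.mult_add_right C.mult_add_right left_add_left
        left_add_right right_add_left right_add_right E.lip_add_right E.rip_add_right
        B.star_add B.star_proj B.src_inv proj_base closed star_sides)
next
  show "continuous_map (btop LB) (btop LB) (bstar LB)"
    unfolding linking_bundle_simps
    by (rule continuous_map_from_link)
      (simp_all add: link_continuous_compose link_continuous_map B.star_continuous C.star_continuous)
qed

lemma link_units:
  "In11 u \<in> units LG \<longleftrightarrow> u \<in> units G" "In22 v \<in> units LG \<longleftrightarrow> v \<in> units H"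
  "In12 z \<notin> units LG" "In21 z \<notin> units LG"
proof -
  have "units LG = In11 ` units G \<union> In22 ` units H"
  proof
    show "units LG \<subseteq> In11 ` units G \<union> In22 ` units H"
      unfolding units_def[of LG]
      by (auto simp: link_topspace_eq B.rng_unit C.rng_unit zrng_unit zsrc_unit)
    show "In11 ` units G \<union> In22 ` units H \<subseteq> units LG"
      unfolding units_def linking_groupoid_simps link_topspace_eq by force
  qed
  then show "In11 u \<in> units LG \<longleftrightarrow> u \<in> units G" "In22 v \<in> units LG \<longleftrightarrow> v \<in> units H"
    "In12 z \<notin> units LG" "In21 z \<notin> units LG" by auto
qed

end

lemma cstar_algebra_image:
  assumes "cstar_algebra A" and "semilinear_isometry A W id \<phi>"
    and mul: "\<And>x y. x \<in> carr A \<Longrightarrow> y \<in> carr A \<Longrightarrow> amul W (\<phi> x) (\<phi> y) = \<phi> (amul A x y)"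
    and star: "\<And>x. x \<in> carr A \<Longrightarrow> astar W (\<phi> x) = \<phi> (astar A x)"
  shows "cstar_algebra W"
proof -
  interpret A: cstar_algebra A by fact
  interpret I: semilinear_isometry A W id \<phi> by fact
  show ?thesis
    by (intro cstar_algebra.intro I.banach_image cstar_algebra_axioms.intro)
      (auto simp: I.carr_image mul star I.map_add I.map_scale I.map_norm A.add_closed A.scale_closed
        A.mult_closed A.star_closed A.mult_assoc A.mult_add_left A.mult_add_right A.mult_scale_left
        A.mult_scale_right A.star_star A.star_add A.star_scale A.star_mult A.norm_mult A.cstar_identity)
qed

lemma pairs_of_images:
  "{f a b | a b. a \<in> j ` X \<and> b \<in> j ` Y} = {f (j a) (j b) | a b. a \<in> X \<and> b \<in> Y}"
  by blast

lemma total_image_of_pairs: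
  assumes "semilinear_isometry A W id \<phi>" "total_set A {f a b | a b. a \<in> X \<and> b \<in> Y}"
    and "\<And>a b. a \<in> X \<Longrightarrow> b \<in> Y \<Longrightarrow> f a b \<in> carr A"
  shows "total_set W {\<phi> (f a b) | a b. a \<in> X \<and> b \<in> Y}"
proof -
  have "\<phi> ` {f a b | a b. a \<in> X \<and> b \<in> Y} = {\<phi> (f a b) | a b. a \<in> X \<and> b \<in> Y}" by blast
  then show ?thesis using semilinear_isometry.total_image[OF assms(1,2)] assms(3) by auto
qed

context bundle_piece
begin

lemma carr_fibre_image: "carr (fibre Q (i x)) = j ` carr (fibre P x)"
  using fibre_image by simp

lemma fibre_algebra_isometry:
  assumes "x \<in> topspace X" "banach_space V"
    and "carr V = carr (fibre P x)" "vadd V = badd P" "vscale V = bscale P" "vzero V = bzero P x"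
      "vnorm V = bnorm P"
  shows "semilinear_isometry V (fibre_algebra Q (i x)) \<kappa> j"
proof -
  interpret F: semilinear_isometry "fibre P x" "fibre_algebra Q (i x)" \<kappa> j
    by (rule fibre_isometry(2)[OF assms(1)])
  show ?thesis
    using assms F.kappa F.bij F.map_zero F.map_add F.map_scale F.map_norm
    by (intro semilinear_isometry.intro semilinear_isometry_axioms.intro) simp_all
qed

end

context equivalent_fell_bundles
begin

lemma link_unit_isometry:
  "u \<in> units G \<Longrightarrow> semilinear_isometry (fibre_algebra B u) (fibre_algebra LB (In11 u)) id In11"
  "v \<in> units H \<Longrightarrow> semilinear_isometry (fibre_algebra C v) (fibre_algebra LB (In22 v)) id In22"
  by (rule piece11.fibre_algebra_isometry piece22.fibre_algebra_isometry;
      simp add: B.unit_closed C.unit_closed cstar_algebra.axioms(1) B.unit_fibre_cstar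
        C.unit_fibre_cstar)+

lemma positive_image:
  assumes "positive_elem A a" "semilinear_isometry A W id \<phi>"
    and "\<And>x. x \<in> carr A \<Longrightarrow> amul W (astar W (\<phi> x)) (\<phi> x) = \<phi> (amul A (astar A x) x)"
  shows "positive_elem W (\<phi> a)"
  using assms semilinear_isometry.carr_image[OF assms(2)]
  by (force simp: positive_elem_def)

lemma link_positive:
  "u \<in> units G \<Longrightarrow> positive_elem (fibre_algebra B u) a \<Longrightarrow> positive_elem (fibre_algebra LB (In11 u)) (In11 a)"
  "v \<in> units H \<Longrightarrow> positive_elem (fibre_algebra C v) c \<Longrightarrow> positive_elem (fibre_algebra LB (In22 v)) (In22 c)"
  by (rule positive_image[OF _ link_unit_isometry(1)] positive_image[OF _ link_unit_isometry(2)];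
      simp)+

text \<open>On \<open>\<E>\<close> the left inner product \<open>e f\<^sup>*\<close> is the left inner product of the equivalence; on \<open>\<E>\<^sup>o\<^sup>p\<close> it is
  \<open>\<langle>e, f\<rangle>\<close> with values in \<open>\<C>\<close>, so that the right Hilbert module structure of the fibres of \<open>\<E>\<close> supplies
  positivity, norm and fullness there.\<close>

theorem linking_fell_bundle: "fell_bundle LG LB"
proof (rule star_bundle_laws.fell_bundleI[OF linking_star_bundle_laws])
  fix u assume u: "u \<in> units LG"
  show "cstar_algebra (fibre_algebra LB u)"
  proof (cases u)
    case (In11 v)
    then show ?thesis
      using u by (simp only: link_units)
        (rule cstar_algebra_image[OF B.unit_fibre_cstar link_unit_isometry(1)], simp_all)
  next
    case (In22 v)
    then show ?thesis
      using u by (simp only: link_units)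
        (rule cstar_algebra_image[OF C.unit_fibre_cstar link_unit_isometry(2)], simp_all)
  qed (use u link_units in auto)
next
  fix b assume b: "b \<in> topspace (btop LB)"
  show "bnorm LB (bstar LB b) = bnorm LB b"
    using b by (cases b) (simp_all add: B.norm_star C.norm_star)
  show "bnorm LB (bmul LB b (bstar LB b)) = (bnorm LB b)\<^sup>2"
    using b by (cases b) (simp_all add: B.norm_mult_star C.norm_mult_star norm_lip norm_rip)
  show "positive_elem (fibre_algebra LB (grng LG (bproj LB b))) (bmul LB b (bstar LB b))"
  proof (cases b)
    case (In11 a)
    then show ?thesis
      using b full_left_hilbert_module.ip_positive[OF B.left_fibre_module[OF B.proj_base], of a a]
      by (simp add: link_positive B.rng_unit proj_base)
  next
    case (In12 e)
    then show ?thesis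
      using b full_left_hilbert_module.ip_positive[OF left_module[OF E.proj_base], of e e]
      by (simp add: link_positive zrng_unit proj_base)
  next
    case (In21 e)
    then show ?thesis
      using b full_right_hilbert_module.ip_positive[OF right_module[OF E.proj_base], of e e]
      by (simp add: link_positive zsrc_unit proj_base)
  next
    case (In22 c)
    then show ?thesis
      using b full_left_hilbert_module.ip_positive[OF C.left_fibre_module[OF C.proj_base], of c c]
      by (simp add: link_positive C.rng_unit proj_base)
  qed
next
  fix g assume g: "g \<in> topspace (gtop LG)"
  show "total_set (fibre_algebra LB (grng LG g))
      {bmul LB a (bstar LB b) | a b. a \<in> carr (fibre LB g) \<and> b \<in> carr (fibre LB g)}"
  proof (cases g)
    case (In11 x)
    then have x: "x \<in> \<G>" using g by simp
    note M = B.left_fibre_module[OF x]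
    show ?thesis
      using total_image_of_pairs[OF link_unit_isometry(1)[OF B.rng_unit[OF x]]
          full_left_hilbert_module.full[OF M] full_left_hilbert_module.ip_closed[OF M]]
      unfolding In11 piece11.carr_fibre_image pairs_of_images by simp
  next
    case (In12 x)
    then have x: "x \<in> \<Z>" using g by simp
    note M = left_module[OF x]
    show ?thesis
      using total_image_of_pairs[OF link_unit_isometry(1)[OF zrng_unit[OF x]]
          full_left_hilbert_module.full[OF M] full_left_hilbert_module.ip_closed[OF M]]
      unfolding In12 piece12.carr_fibre_image pairs_of_images by simp
  next
    case (In21 x)
    then have x: "x \<in> \<Z>" using g by simp
    note M = right_module[OF x]
    show ?thesis
      using total_image_of_pairs[OF link_unit_isometry(2)[OF zsrc_unit[OF x]]
          full_right_hilbert_module.full[OF M] full_right_hilbert_module.ip_closed[OF M]]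
      unfolding In21 piece21.carr_fibre_image pairs_of_images by simp
  next
    case (In22 x)
    then have x: "x \<in> \<H>" using g by simp
    note M = C.left_fibre_module[OF x]
    show ?thesis
      using total_image_of_pairs[OF link_unit_isometry(2)[OF C.rng_unit[OF x]]
          full_left_hilbert_module.full[OF M] full_left_hilbert_module.ip_closed[OF M]]
      unfolding In22 piece22.carr_fibre_image pairs_of_images by simp
  qed
qed

end

section \<open>Sections of the linking bundle over its unit space\<close>

lemma continuous_map_through_open_piece:
  assumes "continuous_map T Y f" "open_map X Y j" "inj j" "\<And>t. t \<in> topspace T \<Longrightarrow> f t \<in> j ` topspace X"
  shows "continuous_map T X (\<lambda>t. inv j (f t))"
  unfolding continuous_map_def
proof (intro conjI allI impI)
  show "(\<lambda>t. inv j (f t)) \<in> topspace T \<rightarrow> topspace X"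
    using assms(3,4) by (force simp: inv_f_f)
  fix U assume U: "openin X U"
  have "{t \<in> topspace T. inv j (f t) \<in> U} = {t \<in> topspace T. f t \<in> j ` U}"
    using assms(3,4) by (force simp: inv_f_f)
  moreover have "openin Y (j ` U)" using assms(2) U by (simp add: open_map_def)
  ultimately show "openin T {t \<in> topspace T. inv j (f t) \<in> U}"
    using openin_continuous_map_preimage[OF assms(1)] by simp
qed

text \<open>A Fell bundle embedded in another over an open and closed piece of the base. Openness makes
  restrictions of continuous sections continuous, closedness makes them vanish at infinity.\<close>

locale fell_piece = F: fell_bundle G P + Q: fell_bundle K Q +
    bundle_piece "gtop G" P "gtop K" Q i j id
  for G :: "'x groupoid" and P :: "('p, 'x) star_bundle"
    and K :: "'y groupoid" and Q :: "('q, 'y) star_bundle" and i j +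
  assumes base_continuous: "continuous_map (gtop G) (gtop K) i"
    and base_closed: "closedin (gtop K) (i ` topspace (gtop G))"
    and unit_iff: "i u \<in> units K \<longleftrightarrow> u \<in> units G"
    and map_mult: "bmul Q (j a) (j b) = j (bmul P a b)"
    and map_star: "bstar Q (j a) = j (bstar P a)"
begin

definition res :: "('y \<Rightarrow> 'q) \<Rightarrow> 'x \<Rightarrow> 'p" where
  "res f = (\<lambda>u\<in>units G. inv j (f (i u)))"

lemma unit_base_continuous: "continuous_map (unit_space G) (unit_space K) i"
  unfolding unit_space_def
  by (rule continuous_map_into_subtopology[OF continuous_map_from_subtopology[OF base_continuous]])
    (auto simp: unit_iff)

lemma unit_base_open: "open_map (unit_space G) (unit_space K) i"
  unfolding open_map_def
proof (intro allI impI)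
  fix U assume "openin (unit_space G) U"
  then obtain T where T: "openin (gtop G) T" "U = T \<inter> units G"
    by (auto simp: unit_space_def openin_subtopology)
  then have "openin (gtop K) (i ` T)" using base_open by (simp add: open_map_def)
  moreover have "i ` U = i ` T \<inter> units K" using T(2) unit_iff by auto
  ultimately show "openin (unit_space K) (i ` U)"
    by (auto simp: unit_space_def openin_subtopology)
qed

lemma section_in_piece:
  assumes "f \<in> carr Q.\<Gamma>" "u \<in> units G"
  shows "f (i u) = j (res f u)"
proof -
  have "bproj Q (f (i u)) = i u" using assms by (intro Q.section_proj) (simp_all add: unit_iff)
  then obtain b where "f (i u) = j b" using over by blast
  then show ?thesis using assms(2) total_inj by (simp add: res_def inv_f_f)
qed

lemma res_fibre:
  assumes "f \<in> carr Q.\<Gamma>" "u \<in> units G"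
  shows "res f u \<in> topspace (btop P)" "bproj P (res f u) = u"
proof -
  have "f (i u) \<in> topspace (btop Q)" "bproj Q (f (i u)) = i u"
    using assms by (simp_all add: Q.section_closed Q.section_proj unit_iff)
  then show "res f u \<in> topspace (btop P)" "bproj P (res f u) = u"
    by (simp_all add: section_in_piece[OF assms] total_iff map_proj inj_eq[OF base_inj])
qed

lemma res_closed:
  assumes f: "f \<in> carr Q.\<Gamma>"
  shows "res f \<in> carr F.\<Gamma>"
  unfolding res_def
proof (rule F.sectionI)
  have res: "res f u = inv j (f (i u))" if "u \<in> units G" for u using that by (simp add: res_def)
  show "continuous_map (unit_space G) (btop P) (\<lambda>u. inv j (f (i u)))"
  proof (rule continuous_map_through_open_piece[OF _ total_open total_inj])
    show "continuous_map (unit_space G) (btop Q) (\<lambda>u. f (i u))"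
      using continuous_map_compose[OF unit_base_continuous Q.section_continuous[OF f]]
      by (simp add: o_def)
    show "f (i u) \<in> j ` topspace (btop P)" if "u \<in> topspace (unit_space G)" for u
      using that section_in_piece[OF f] res_fibre[OF f] by (simp add: F.topspace_unit_space)
  qed
  show "bproj P (inv j (f (i u))) = u" if "u \<in> units G" for u
    using res_fibre(2)[OF f that] res[OF that] by simp
  fix \<epsilon> :: real assume "0 < \<epsilon>"
  then obtain C where C: "compactin (unit_space K) C"
    "\<And>p. p \<in> units K - C \<Longrightarrow> bnorm Q (f p) < \<epsilon>"
    using Q.section_vanish[OF f] by blast
  \<comment> \<open>The part of \<open>C\<close> on the piece is compact because the piece is closed.\<close>
  let ?I = "i ` units G"
  have I: "?I = i ` topspace (gtop G) \<inter> units K"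
    using unit_iff F.unit_closed by auto
  have "closedin (unit_space K) ?I"
    unfolding I unit_space_def
    using base_closed by (auto simp: closedin_subtopology)
  then have "compactin (unit_space K) (?I \<inter> C)" using C(1) by (rule closed_Int_compactin)
  then have "compactin (subtopology (unit_space K) ?I) (?I \<inter> C)"
    by (simp add: compactin_subtopology)
  moreover have "continuous_map (subtopology (unit_space K) ?I) (unit_space G) (\<lambda>p. inv i p)"
    by (rule continuous_map_through_open_piece[OF
          continuous_map_from_subtopology[OF continuous_map_id[unfolded id_def]] unit_base_open base_inj])
      (auto simp: F.topspace_unit_space)
  ultimately have "compactin (unit_space G) (inv i ` (?I \<inter> C))" by (rule image_compactin)
  moreover have "bnorm P (inv j (f (i u))) < \<epsilon>" if u: "u \<in> units G - inv i ` (?I \<inter> C)" for u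
  proof -
    have "i u \<notin> C"
      using u inv_f_f[OF base_inj, of u] by (metis DiffD1 DiffD2 IntI image_eqI)
    then have "bnorm Q (f (i u)) < \<epsilon>" using u C(2) by (simp add: unit_iff)
    moreover have "bnorm Q (f (i u)) = bnorm P (res f u)"
      using u section_in_piece[OF f, of u] by (simp only: DiffD1 map_norm)
    ultimately show ?thesis using u res[of u] by simp
  qed
  ultimately show "\<exists>C. compactin (unit_space G) C \<and> (\<forall>u\<in>units G - C. bnorm P (inv j (f (i u))) < \<epsilon>)"
    by blast
qed

lemma res_norm_le:
  assumes "f \<in> carr Q.\<Gamma>"
  shows "vnorm F.\<Gamma> (res f) \<le> vnorm Q.\<Gamma> f"
proof (rule F.section_norm_le)
  fix u assume u: "u \<in> units G"
  then show "bnorm P (res f u) \<le> vnorm Q.\<Gamma> f"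
    using Q.section_norm_ge[OF assms, of "i u"] section_in_piece[OF assms u]
    by (simp add: unit_iff map_norm)
qed (rule Q.section_norm_nonneg[OF assms])

lemma res_zero: "res (vzero Q.\<Gamma>) = vzero F.\<Gamma>"
  by (auto simp: fun_eq_iff res_def restrict_def unit_iff map_zero inv_f_f[OF total_inj])

lemma res_hom:
  assumes "f \<in> carr Q.\<Gamma>" "k \<in> carr Q.\<Gamma>"
  shows "res (vadd Q.\<Gamma> f k) = vadd F.\<Gamma> (res f) (res k)"
    and "res (vscale Q.\<Gamma> \<alpha> f) = vscale F.\<Gamma> \<alpha> (res f)"
    and "res (amul Q.\<Gamma> f k) = amul F.\<Gamma> (res f) (res k)"
    and "res (astar Q.\<Gamma> f) = astar F.\<Gamma> (res f)"
proof -
  have eq: "res g = (\<lambda>u\<in>units G. b u)" if "\<And>u. u \<in> units G \<Longrightarrow> g (i u) = j (b u)" for g b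
    using that by (auto simp: res_def fun_eq_iff restrict_def inv_f_f[OF total_inj])
  note in_piece = section_in_piece[OF assms(1)] section_in_piece[OF assms(2)]
  show "res (vadd Q.\<Gamma> f k) = vadd F.\<Gamma> (res f) (res k)"
    "res (vscale Q.\<Gamma> \<alpha> f) = vscale F.\<Gamma> \<alpha> (res f)"
    "res (amul Q.\<Gamma> f k) = amul F.\<Gamma> (res f) (res k)"
    "res (astar Q.\<Gamma> f) = astar F.\<Gamma> (res f)"
    unfolding section_algebra_simps
    by (rule eq; simp add: unit_iff in_piece map_add map_scale map_mult map_star)+
qed

end

context equivalent_fell_bundles
begin

lemma link_pieces_closed:
  "closedin (gtop LG) (In11 ` \<G>)" "closedin (gtop LG) (In22 ` \<H>)"
proof -
  have 1: "topspace (gtop LG) - In11 ` \<G> = In12 ` \<Z> \<union> In21 ` \<Z> \<union> In22 ` \<H>"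
    and 2: "topspace (gtop LG) - In22 ` \<H> = In11 ` \<G> \<union> In12 ` \<Z> \<union> In21 ` \<Z>"
    by (auto simp: link_topspace_eq)
  have "openin (gtop LG) (In11 ` \<G>)" "openin (gtop LG) (In12 ` \<Z>)" "openin (gtop LG) (In21 ` \<Z>)"
    "openin (gtop LG) (In22 ` \<H>)"
    by (simp_all add: openin_link_topology link_vimage_image)
  then show "closedin (gtop LG) (In11 ` \<G>)" "closedin (gtop LG) (In22 ` \<H>)"
    unfolding closedin_def 1 2 by (auto simp: link_topspace_eq)
qed

sublocale link11: fell_piece G B LG LB In11 In11
  by (intro fell_piece.intro fell_piece_axioms.intro B.fell_bundle_axioms linking_fell_bundle
      piece11.bundle_piece_axioms link_pieces_closed)
    (simp_all add: link_continuous_map link_units)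

sublocale link22: fell_piece H C LG LB In22 In22
  by (intro fell_piece.intro fell_piece_axioms.intro C.fell_bundle_axioms linking_fell_bundle
      piece22.bundle_piece_axioms link_pieces_closed)
    (simp_all add: link_continuous_map link_units)

text \<open>The section of the linking bundle with given restrictions to \<open>G\<^sup>(\<^sup>0\<^sup>)\<close> and \<open>H\<^sup>(\<^sup>0\<^sup>)\<close>.\<close>

fun glue :: "('g \<Rightarrow> 'b) \<Rightarrow> ('h \<Rightarrow> 'c) \<Rightarrow> ('g, 'z, 'h) link \<Rightarrow> ('b, 'e, 'c) link" where
  "glue f k (In11 u) = In11 (f u)"
| "glue f k (In22 v) = In22 (k v)"
| "glue f k _ = undefined"

lemma link_unit_cases:
  assumes "p \<in> units LG"
  obtains u where "p = In11 u" "u \<in> units G" | v where "p = In22 v" "v \<in> units H"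
  using assms by (cases p) (auto simp: link_units)

lemma glue_closed:
  assumes f: "f \<in> carr (section_algebra G B)" and k: "k \<in> carr (section_algebra H C)"
  shows "restrict (glue f k) (units LG) \<in> carr (section_algebra LG LB)"
proof (rule link11.Q.sectionI)
  show "continuous_map (unit_space LG) (btop LB) (glue f k)"
    unfolding continuous_map_def link11.Q.topspace_unit_space
  proof (intro conjI allI impI)
    have "glue f k p \<in> topspace (btop LB)" if "p \<in> units LG" for p
      using that by (cases p rule: link_unit_cases) (simp_all add: B.section_closed C.section_closed f k)
    then show "glue f k \<in> units LG \<rightarrow> topspace (btop LB)" by blast
    fix U assume "openin (btop LB) U"
    then have U: "openin (btop B) (In11 -` U)" "openin (btop C) (In22 -` U)"
      by (simp_all add: openin_link_topology)
    have "openin (unit_space LG) (In11 ` {u \<in> topspace (unit_space G). f u \<in> In11 -` U})"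
      using link11.unit_base_open openin_continuous_map_preimage[OF B.section_continuous[OF f] U(1)]
      by (simp add: open_map_def)
    moreover have "openin (unit_space LG) (In22 ` {v \<in> topspace (unit_space H). k v \<in> In22 -` U})"
      using link22.unit_base_open openin_continuous_map_preimage[OF C.section_continuous[OF k] U(2)]
      by (simp add: open_map_def)
    moreover have "{p \<in> units LG. glue f k p \<in> U}
        = In11 ` {u \<in> topspace (unit_space G). f u \<in> In11 -` U}
          \<union> In22 ` {v \<in> topspace (unit_space H). k v \<in> In22 -` U}"
      by (auto simp: B.topspace_unit_space C.topspace_unit_space link_units elim!: link_unit_cases)
    ultimately show "openin (unit_space LG) {p \<in> units LG. glue f k p \<in> U}"
      using openin_Un by simp
  qed
  show "bproj LB (glue f k p) = p" if "p \<in> units LG" for p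
    using that by (cases p rule: link_unit_cases) (simp_all add: B.section_proj C.section_proj f k)
  fix \<epsilon> :: real assume \<epsilon>: "0 < \<epsilon>"
  obtain K where K: "compactin (unit_space G) K" "\<And>u. u \<in> units G - K \<Longrightarrow> bnorm B (f u) < \<epsilon>"
    using B.section_vanish[OF f \<epsilon>] by blast
  obtain K' where K': "compactin (unit_space H) K'" "\<And>v. v \<in> units H - K' \<Longrightarrow> bnorm C (k v) < \<epsilon>"
    using C.section_vanish[OF k \<epsilon>] by blast
  have "compactin (unit_space LG) (In11 ` K \<union> In22 ` K')"
    by (intro compactin_Un image_compactin[OF K(1) link11.unit_base_continuous]
        image_compactin[OF K'(1) link22.unit_base_continuous])
  moreover have "bnorm LB (glue f k p) < \<epsilon>" if "p \<in> units LG - (In11 ` K \<union> In22 ` K')" for p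
    using that by (cases rule: link_unit_cases[OF DiffD1[OF that]]) (auto intro: K(2) K'(2))
  ultimately show "\<exists>K. compactin (unit_space LG) K \<and> (\<forall>p\<in>units LG - K. bnorm LB (glue f k p) < \<epsilon>)"
    by blast
qed

text \<open>Restriction to the two parts of the unit space is isometric, since the supremum over their union is
  the larger of the two suprema. So the direct sum inherits the axioms of a C*-algebra from the
  sections of the linking bundle.\<close>

theorem linking_section_algebra:
  "cstar_isomorphic (section_algebra LG LB) (cstar_sum (section_algebra G B) (section_algebra H C))"
proof -
  let ?\<phi> = "\<lambda>f. (link11.res f, link22.res f)"
  have bij: "bij_betw ?\<phi> (carr link11.Q.\<Gamma>) (carr (cstar_sum B.\<Gamma> C.\<Gamma>))"
    unfolding bij_betw_def
  proof
    show "inj_on ?\<phi> (carr link11.Q.\<Gamma>)"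
    proof (rule inj_onI)
      fix f k assume fk: "f \<in> carr link11.Q.\<Gamma>" "k \<in> carr link11.Q.\<Gamma>" "?\<phi> f = ?\<phi> k"
      show "f = k"
      proof (rule link11.Q.section_eqI[OF fk(1,2)])
        fix p assume "p \<in> units LG"
        then show "f p = k p"
          using fk by (cases p rule: link_unit_cases)
            (simp_all add: link11.section_in_piece link22.section_in_piece)
      qed
    qed
    show "?\<phi> ` carr link11.Q.\<Gamma> = carr (cstar_sum B.\<Gamma> C.\<Gamma>)"
    proof
      show "?\<phi> ` carr link11.Q.\<Gamma> \<subseteq> carr (cstar_sum B.\<Gamma> C.\<Gamma>)"
        using link11.res_closed link22.res_closed by auto
      show "carr (cstar_sum B.\<Gamma> C.\<Gamma>) \<subseteq> ?\<phi> ` carr link11.Q.\<Gamma>"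
      proof clarify
        fix f k assume "(f, k) \<in> carr (cstar_sum B.\<Gamma> C.\<Gamma>)"
        then have f: "f \<in> carr B.\<Gamma>" and k: "k \<in> carr C.\<Gamma>" by simp_all
        let ?g = "restrict (glue f k) (units LG)"
        have g: "?g \<in> carr link11.Q.\<Gamma>" by (rule glue_closed[OF f k])
        have "link11.res ?g = f"
          by (rule B.section_eqI[OF link11.res_closed[OF g] f])
            (simp add: link11.res_def link_units inv_f_f[OF piece11.total_inj])
        moreover have "link22.res ?g = k"
          by (rule C.section_eqI[OF link22.res_closed[OF g] k])
            (simp add: link22.res_def link_units inv_f_f[OF piece22.total_inj])
        ultimately show "(f, k) \<in> ?\<phi> ` carr link11.Q.\<Gamma>" using g by (intro image_eqI[of _ _ ?g]) simp_all
      qed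
    qed
  qed
  have norm: "vnorm (cstar_sum B.\<Gamma> C.\<Gamma>) (?\<phi> f) = vnorm link11.Q.\<Gamma> f" if f: "f \<in> carr link11.Q.\<Gamma>" for f
  proof (rule antisym)
    show "vnorm (cstar_sum B.\<Gamma> C.\<Gamma>) (?\<phi> f) \<le> vnorm link11.Q.\<Gamma> f"
      using link11.res_norm_le[OF f] link22.res_norm_le[OF f] by simp
    show "vnorm link11.Q.\<Gamma> f \<le> vnorm (cstar_sum B.\<Gamma> C.\<Gamma>) (?\<phi> f)"
    proof (rule link11.Q.section_norm_le)
      fix p assume "p \<in> units LG"
      then show "bnorm LB (f p) \<le> vnorm (cstar_sum B.\<Gamma> C.\<Gamma>) (?\<phi> f)"
        using B.section_norm_ge[OF link11.res_closed[OF f]] C.section_norm_ge[OF link22.res_closed[OF f]]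
        by (cases p rule: link_unit_cases)
          (auto simp: link11.section_in_piece[OF f] link22.section_in_piece[OF f] le_max_iff_disj)
    qed (simp add: B.section_norm_nonneg link11.res_closed f le_max_iff_disj)
  qed
  have iso: "semilinear_isometry link11.Q.\<Gamma> (cstar_sum B.\<Gamma> C.\<Gamma>) id ?\<phi>"
    using bij norm link11.res_zero link22.res_zero link11.res_hom link22.res_hom
    by (intro semilinear_isometry.intro semilinear_isometry_axioms.intro
        cstar_algebra.axioms(1)[OF link11.Q.section_algebra_cstar])
      (simp_all del: section_algebra_simps)
  have "cstar_algebra (cstar_sum B.\<Gamma> C.\<Gamma>)"
    by (rule cstar_algebra_image[OF link11.Q.section_algebra_cstar iso])
      (simp_all add: link11.res_hom link22.res_hom del: section_algebra_simps)
  with bij show ?thesis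
    unfolding cstar_isomorphic_def
    using link11.res_hom link22.res_hom
    by (intro conjI link11.Q.section_algebra_cstar exI[of _ ?\<phi>]) (simp_all del: section_algebra_simps)
qed

end


theorem lemma3:
  fixes G :: "'g groupoid" and H :: "'h groupoid" and Z :: "('g, 'z, 'h) bispace"
    and B :: "('b, 'g) star_bundle" and C :: "('c, 'h) star_bundle"
    and E :: "('e, 'z, 'b, 'c) bibundle"
  assumes "lch_groupoid G" and "lch_groupoid H"
    and "groupoid_equivalence G H Z"
    and "fell_bundle G B" and "fell_bundle H C"
    and "fell_equivalence G H Z B C E"
  shows "fell_bundle (linking_groupoid G H Z) (linking_bundle B C E) \<and>
    cstar_isomorphic (section_algebra (linking_groupoid G H Z) (linking_bundle B C E))
      (cstar_sum (section_algebra G B) (section_algebra H C))"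
proof -
  interpret equivalent_fell_bundles G H Z B C E
    by (intro equivalent_fell_bundles.intro assms)
  show ?thesis
    using linking_fell_bundle linking_section_algebra by simp
qed

end
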